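(* Let $J\in(0,\tfrac{1}{3\sqrt3})$ be such that the minimal Legendrian immersion $u_{0,J}:\mathbb{R}^2\to S^5$ (defined in the context) is doubly periodic, and let $\Sigma$ be the resulting minimal Legendrian $2$-torus. Then $\frac{1}{2\pi}\theta_2(T_J)=\frac mn$ for relatively prime integers $m\ge 4$ and $n\ge 7$, and $$\operatorname{s-ind}(\Sigma)\ \ge\ 2n-8\ \ge\ 6,$$ $$\operatorname{l-ind}(\Sigma)\ \ge\ 2n-2\ \ge\ 12,$$ $$N_\Sigma(1)\ \ge\ 2m+5\ \ge\ 13,$$ $$N_\Sigma(2)\ \ge\ 2n+6\ \ge\ 20.$$
   Context: **The immersions $u_{0,J}$.** Let $J\in(0,\frac{1}{3\sqrt3})$. Let $\gamma$ be the non-constant smooth periodic solution of $$\tfrac14\dot\gamma^2+J^2=2\gamma^3-\gamma^2+\tfrac1{27}=(\tfrac13-\gamma)^2(\tfrac13+2\gamma)$$ with $\gamma(0)=\gamma_{\min}$, the minimum value of $\gamma$ (here $\gamma_{\min}$ is the unique negative $\gamma$ at which the right-hand side equals $J^2$). Let $T=T_J$ be the basic period of $\gamma$. Put $R_1^2=R_3^2=\tfrac13-\gamma$, $R_2^2=\tfrac13+2\gamma$ with $R_i>0$, and define $\theta_1=\theta_3$, $\theta_2$ by $\theta_i(0)=0$, $\dot\theta_1=-J/R_1^2$, $\dot\theta_2=2J/R_2^2$. Then $$u_{0,J}(s,t)=\big(e^{is}R_1(t)e^{i\theta_1(t)},\ R_2(t)e^{i\theta_2(t)},\ e^{-is}R_1(t)e^{i\theta_1(t)}\big)$$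 is a minimal Legendrian immersion $\mathbb{R}^2\to S^5\subset\mathbb{C}^3$. It is doubly periodic for a countable dense set of $J$. When it is doubly periodic, $\Sigma$ denotes the torus $\mathbb{R}^2/\Lambda$ with the metric induced by $u_{0,J}$, where $\Lambda$ is the period lattice of $u_{0,J}$. **Indices.** $\Delta$ is the nonnegative Laplacian on functions on $\Sigma$; eigenvalues are counted with multiplicity. $N_\Sigma(\beta)$, for $\beta\ge0$, is the number of eigenvalues in $[0,\beta(\beta+1)]$. $\operatorname{l-ind}(\Sigma)$ is the number of eigenvalues in the open interval $(0,6)$, and $$\operatorname{s-ind}(\Sigma)=N_\Sigma(2)-b^0(\Sigma)-6-(\dim SU(3)-\dim G),$$ where $b^0(\Sigma)=1$, $\dim SU(3)=8$, and $G$ is the subgroup of $SU(3)$ leaving the cone over $\Sigma$ invariant. *)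

theory Defs
  imports "HOL-Analysis.Analysis" "HOL-Library.Function_Algebras"
begin

section \<open>Laplacian of an immersion of the plane\<close>

definition pd :: "2 \<Rightarrow> (real^2 \<Rightarrow> 'a::real_normed_vector) \<Rightarrow> real^2 \<Rightarrow> 'a" where
  "pd i f p = vector_derivative (\<lambda>h. f (p + h *\<^sub>R axis i 1)) (at 0)"

text \<open>Frechet differentiability of every iterated partial derivative at every point makes
  all of them continuous, so this is \<open>C\<^sup>\<infinity>\<close>.\<close>

definition smooth :: "(real^2 \<Rightarrow> 'a::real_normed_vector) \<Rightarrow> bool" where
  "smooth f \<longleftrightarrow> (\<forall>is. foldr pd is f differentiable_on UNIV)"

definition induced_metric :: "(real^2 \<Rightarrow> complex^3) \<Rightarrow> real^2 \<Rightarrow> real^2^2" where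
  "induced_metric u p = (\<chi> i j. inner (pd i u p) (pd j u p))"

text \<open>Nonnegative Laplace--Beltrami operator of the induced metric in the global
  coordinates of the plane.\<close>

definition laplacian ::
  "(real^2 \<Rightarrow> complex^3) \<Rightarrow> (real^2 \<Rightarrow> real) \<Rightarrow> real^2 \<Rightarrow> real" where
  "laplacian u f p =
     - (\<Sum>i\<in>UNIV. pd i (\<lambda>q. sqrt (det (induced_metric u q)) *
          (\<Sum>j\<in>UNIV. matrix_inv (induced_metric u q) $ i $ j * pd j f q)) p)
       / sqrt (det (induced_metric u p))"

definition period_lattice :: "(real^2 \<Rightarrow> 'a) \<Rightarrow> (real^2) set" where
  "period_lattice u = {v. \<forall>p. u (p + v) = u p}"

text \<open>For an immersion the periods form a discrete group, so this says that they form a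
  lattice of rank two.\<close>

definition doubly_periodic :: "(real^2 \<Rightarrow> 'a) \<Rightarrow> bool" where
  "doubly_periodic u \<longleftrightarrow> span (period_lattice u) = UNIV"


section \<open>Eigenvalue counts\<close>

text \<open>Functions on the torus are the functions on the plane that are periodic with respect
  to the period lattice of \<open>u\<close>.\<close>

definition eigenspace :: "(real^2 \<Rightarrow> complex^3) \<Rightarrow> real \<Rightarrow> (real^2 \<Rightarrow> real) set" where
  "eigenspace u ev =
     {f. smooth f \<and> (\<forall>v\<in>period_lattice u. \<forall>p. f (p + v) = f p)
       \<and> (\<forall>p. laplacian u f p = ev * f p)}"

global_interpretation fun_vs: vector_space "\<lambda>(c::real) (f::real^2 \<Rightarrow> real) p. c * f p"
  by unfold_locales (auto simp: fun_eq_iff algebra_simps)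

text \<open>The dimension of the eigenspace, as an extended natural number; it is \<open>0\<close> precisely
  when \<open>ev\<close> is not an eigenvalue.\<close>

definition multiplicity :: "(real^2 \<Rightarrow> complex^3) \<Rightarrow> real \<Rightarrow> enat" where
  "multiplicity u ev =
     (SUP B\<in>{B. finite B \<and> B \<subseteq> eigenspace u ev \<and> fun_vs.independent B}. enat (card B))"

definition eigenvalue_count :: "(real^2 \<Rightarrow> complex^3) \<Rightarrow> real set \<Rightarrow> enat" where
  "eigenvalue_count u I = (\<Sum>\<^sub>\<infinity>ev\<in>I. multiplicity u ev)"

definition N_Sigma :: "(real^2 \<Rightarrow> complex^3) \<Rightarrow> real \<Rightarrow> enat" where
  "N_Sigma u \<beta> = eigenvalue_count u {0..\<beta> * (\<beta> + 1)}"

definition l_ind :: "(real^2 \<Rightarrow> complex^3) \<Rightarrow> enat" where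
  "l_ind u = eigenvalue_count u {0<..<6}"


section \<open>Symmetries of the cone and the stability index\<close>

definition SU3 :: "(complex^3^3) set" where
  "SU3 = {A. A ** (\<chi> i j. cnj (A $ j $ i)) = mat 1 \<and> det A = 1}"

definition cone :: "(real^2 \<Rightarrow> complex^3) \<Rightarrow> (complex^3) set" where
  "cone u = {r *\<^sub>R u p |r p. r > 0}"

definition cone_symmetries :: "(real^2 \<Rightarrow> complex^3) \<Rightarrow> (complex^3^3) set" where
  "cone_symmetries u = {A\<in>SU3. (\<lambda>x. A *v x) ` cone u = cone u}"

text \<open>The type of matrices is not an instance of the class of normed algebras, so the
  library function \<open>exp\<close> does not apply to it.\<close>

definition matrix_exp :: "complex^3^3 \<Rightarrow> complex^3^3" where
  "matrix_exp A = (\<Sum>k. (1 / fact k) *\<^sub>R ((\<lambda>B. A ** B) ^^ k) (mat 1))"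

definition lie_algebra :: "(complex^3^3) set \<Rightarrow> (complex^3^3) set" where
  "lie_algebra G = {X. \<forall>t::real. matrix_exp (t *\<^sub>R X) \<in> G}"

text \<open>Dimension of a closed matrix group as a real Lie group.\<close>

definition group_dim :: "(complex^3^3) set \<Rightarrow> nat" where
  "group_dim G = dim (lie_algebra G)"

text \<open>The constant \<open>1\<close> is the zeroth Betti number of the torus and \<open>8\<close> is the
  dimension of \<open>SU(3)\<close>.\<close>

definition s_ind :: "(real^2 \<Rightarrow> complex^3) \<Rightarrow> ereal" where
  "s_ind u = ereal_of_enat (N_Sigma u 2) - 1 - 6
     - ereal (8 - real (group_dim (cone_symmetries u)))"


section \<open>The immersions\<close>

definition basic_period :: "(real \<Rightarrow> 'a) \<Rightarrow> real \<Rightarrow> bool" where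
  "basic_period f T \<longleftrightarrow> T > 0 \<and> (\<forall>t. f (t + T) = f t)
     \<and> (\<forall>T'. 0 < T' \<and> T' < T \<longrightarrow> \<not> (\<forall>t. f (t + T') = f t))"

definition profile :: "real \<Rightarrow> (real \<Rightarrow> real) \<Rightarrow> bool" where
  "profile J \<gamma> \<longleftrightarrow>
     (\<forall>k. (deriv ^^ k) \<gamma> differentiable_on UNIV)
     \<and> \<not> \<gamma> constant_on UNIV
     \<and> (\<exists>T>0. \<forall>t. \<gamma> (t + T) = \<gamma> t)
     \<and> (\<forall>t. (deriv \<gamma> t)\<^sup>2 / 4 + J\<^sup>2 = 2 * \<gamma> t ^ 3 - (\<gamma> t)\<^sup>2 + 1 / 27)
     \<and> (\<forall>t. \<gamma> 0 \<le> \<gamma> t)"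

definition R1 :: "(real \<Rightarrow> real) \<Rightarrow> real \<Rightarrow> real" where
  "R1 \<gamma> t = sqrt (1 / 3 - \<gamma> t)"

definition R2 :: "(real \<Rightarrow> real) \<Rightarrow> real \<Rightarrow> real" where
  "R2 \<gamma> t = sqrt (1 / 3 + 2 * \<gamma> t)"

definition phases :: "real \<Rightarrow> (real \<Rightarrow> real) \<Rightarrow> (real \<Rightarrow> real) \<Rightarrow> (real \<Rightarrow> real) \<Rightarrow> bool" where
  "phases J \<gamma> \<theta>1 \<theta>2 \<longleftrightarrow> \<theta>1 0 = 0 \<and> \<theta>2 0 = 0
     \<and> (\<forall>t. (\<theta>1 has_real_derivative - J / (R1 \<gamma> t)\<^sup>2) (at t))
     \<and> (\<forall>t. (\<theta>2 has_real_derivative 2 * J / (R2 \<gamma> t)\<^sup>2) (at t))"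

text \<open>The coordinates of the plane are \<open>s = p $ 1\<close> and \<open>t = p $ 2\<close>.\<close>

definition u0 ::
  "(real \<Rightarrow> real) \<Rightarrow> (real \<Rightarrow> real) \<Rightarrow> (real \<Rightarrow> real) \<Rightarrow> real^2 \<Rightarrow> complex^3" where
  "u0 \<gamma> \<theta>1 \<theta>2 p = vector
     [cis (p $ 1) * of_real (R1 \<gamma> (p $ 2)) * cis (\<theta>1 (p $ 2)),
      of_real (R2 \<gamma> (p $ 2)) * cis (\<theta>2 (p $ 2)),
      cis (- (p $ 1)) * of_real (R1 \<gamma> (p $ 2)) * cis (\<theta>1 (p $ 2))]"

end

(*
  The induced metric is conformal, rho(t) (ds^2 + dt^2), so the functions cos (k s + b) g(t) are
  eigenfunctions as soon as g solves Hill's equation g'' = (k^2 - l rho) g. The coordinates of u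
  give six eigenfunctions for 2, and the moment maps of su(3) give seven for 6. Those that do not
  depend on s oscillate: the second coordinate winds m times and gamma n times around 0 over
  the period n T of rho. By Sturm oscillation theory for k = 0 there are then 2 m - 1 eigenvalues
  below 2 and 2 n - 1 below 6. The bound for s-ind also uses dim G >= 1, from translations in s.
  Since rho is even, the periodic problem splits into a Neumann and a Dirichlet problem, solved by shooting.

  With w = 1/3 + 2 gamma and w1 < w2 < w3 the roots of w (1 - w)^2 - 4 J^2, the rotation number
  theta2 T / pi is the average of sqrt (w3 / (w3 - w)) for a probability measure on [w1, w2]. It
  exceeds 1, and by AM-GM it is less than 6/5. So 1/2 < m / n < 3/5, which forces m >= 4 and n >= 7.
*)

theory Submission
  imports Defs
begin

text \<open>Shooting needs solutions that depend continuously on \<open>l\<close> and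
  \<open>t\<close> jointly, hence Hill's equation is solved by a power series in \<open>l\<close>
  that converges everywhere. At \<open>l0\<close> an explicit solution is known, but its boundary
  condition fixes the Pruefer angle at the endpoint only modulo \<pi>. The missing integer comes
  from a comparison angle with known total increment, \<phi> for 6 and \<open>\<theta>2\<close> for
  2: up to the constant \<open>pi / 2\<close>, the two angles never differ by half a turn. Since
  only lower bounds are asked for, intermediate values then suffice.

  The rotation number is an elliptic integral. Both of its bounds compare it with integrals whose
  value \<pi> can be read off from the polar angle on an ellipse. AM-GM is the tool for the upper
  bound because it turns the square root into integrands of just this kind. The average of w3 / (w3
  - w) is at most 4/3, so the best bound to be had this way is 2 / sqrt 3, and 6/5 lies just above
  it.\<close>

section \<open>Primitives and integrated derivative bounds\<close>

text \<open>The oriented integral from 0 to \<open>t\<close>: an interval whose endpoints are in the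
  wrong order is empty and contributes 0.\<close>

definition prim :: "(real \<Rightarrow> real) \<Rightarrow> real \<Rightarrow> real" where
  "prim f t = integral {0..t} f - integral {t..0} f"

lemma prim_0 [simp]: "prim f 0 = 0"
  by (simp add: prim_def)

lemma prim_nonneg_arg: "0 \<le> t \<Longrightarrow> prim f t = integral {0..t} f"
  by (cases "t = 0") (auto simp: prim_def)

lemma DERIV_prim:
  assumes "continuous_on UNIV f"
  shows "(prim f has_real_derivative f t) (at t)"
proof -
  define H where "H = \<bar>t\<bar> + 1"
  have H: "- H < t" "t < H" "0 < H" by (auto simp: H_def)
  have int: "f integrable_on {a..b}" for a b
    using assms continuous_on_subset integrable_continuous_real by blast
  have eq: "integral {-H..x} f - integral {-H..0} f = prim f x" if "x \<in> {-H<..<H}" for x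
  proof (cases "0 \<le> x")
    case True
    have "integral {-H..0} f + integral {0..x} f = integral {-H..x} f"
      by (rule Henstock_Kurzweil_Integration.integral_combine) (use H True int in auto)
    then show ?thesis using True by (simp add: prim_nonneg_arg)
  next
    case False
    have "integral {-H..x} f + integral {x..0} f = integral {-H..0} f"
      by (rule Henstock_Kurzweil_Integration.integral_combine) (use that False int in auto)
    then show ?thesis using False by (simp add: prim_def)
  qed
  have "((\<lambda>x. integral {-H..x} f) has_real_derivative f t) (at t within {-H..H})"
    by (rule integral_has_real_derivative) (use assms H continuous_on_subset in auto)
  then have "((\<lambda>x. integral {-H..x} f) has_real_derivative f t) (at t)"
    using H by (metis at_within_Icc_at)
  then have "((\<lambda>x. integral {-H..x} f - integral {-H..0} f) has_real_derivative f t) (at t)"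
    by (auto intro!: derivative_eq_intros)
  then show ?thesis
    by (rule has_field_derivative_transform_within_open[where S = "{-H<..<H}"]) (use H eq in auto)
qed

lemma continuous_on_UNIV_if_DERIV:
  assumes "\<And>t. (f has_real_derivative f' t) (at t)"
  shows "continuous_on UNIV f"
  using assms by (meson DERIV_continuous continuous_at_imp_continuous_on)

lemma DERIV_zero_const:
  assumes "\<And>t. (f has_real_derivative 0) (at t)"
  shows "f a = (f b :: real)"
  using assms DERIV_isconst_all by blast

text \<open>The single integration behind the factorial bounds on the series: the monomial bound is
  itself a derivative, so \<open>f\<close> is compared with its primitive for positive
  \<open>t\<close> and reflected for negative \<open>t\<close>.\<close>

lemma abs_power_bound:
  fixes f :: "real \<Rightarrow> real"
  assumes der: "\<And>t. (f has_real_derivative f' t) (at t)" and "f 0 = 0"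
    and bd: "\<And>t. \<bar>t\<bar> \<le> H \<Longrightarrow> \<bar>f' t\<bar> \<le> C * \<bar>t\<bar> ^ n / fact n" and "\<bar>t\<bar> \<le> H"
  shows "\<bar>f t\<bar> \<le> C * \<bar>t\<bar> ^ Suc n / fact (Suc n)"
proof -
  have pos: "\<bar>g t\<bar> \<le> C * t ^ Suc n / fact (Suc n)"
    if g: "\<And>t. (g has_real_derivative g' t) (at t)" "g 0 = 0"
      "\<And>t. \<bar>t\<bar> \<le> H \<Longrightarrow> \<bar>g' t\<bar> \<le> C * \<bar>t\<bar> ^ n / fact n" "0 \<le> t" "t \<le> H" for g g' :: "real \<Rightarrow> real" and t
  proof -
    define E where "E = (\<lambda>t::real. C * t ^ Suc n / fact (Suc n))"
    have E: "(E has_real_derivative C * x ^ n / fact n) (at x)" for x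
    proof -
      have "((\<lambda>t. C * t ^ Suc n / fact (Suc n)) has_real_derivative
          C * (real (Suc n) * x ^ n) / fact (Suc n)) (at x)"
        using DERIV_cdivide[OF DERIV_cmult[OF DERIV_pow[of "Suc n" x UNIV], of C], of "fact (Suc n)"]
        by (simp del: of_nat_Suc fact_Suc power_Suc)
      moreover have "C * (real (Suc n) * x ^ n) / fact (Suc n) = C * x ^ n / fact n"
        unfolding fact_Suc by (simp del: of_nat_Suc)
      ultimately show ?thesis by (simp add: E_def)
    qed
    have "E 0 = 0" by (simp add: E_def)
    have "(\<lambda>x. E x - g x) 0 \<le> (\<lambda>x. E x - g x) t"
    proof (rule DERIV_nonneg_imp_nondecreasing[OF \<open>0 \<le> t\<close>])
      fix x assume x: "0 \<le> x" "x \<le> t"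
      then have "\<bar>g' x\<bar> \<le> C * x ^ n / fact n" using that(3)[of x] that(5) by simp
      then show "\<exists>y. ((\<lambda>x. E x - g x) has_real_derivative y) (at x) \<and> 0 \<le> y"
        using DERIV_diff[OF E[of x] g(1)[of x]]
        by (intro exI[of _ "C * x ^ n / fact n - g' x"]) auto
    qed
    moreover have "(\<lambda>x. E x + g x) 0 \<le> (\<lambda>x. E x + g x) t"
    proof (rule DERIV_nonneg_imp_nondecreasing[OF \<open>0 \<le> t\<close>])
      fix x assume x: "0 \<le> x" "x \<le> t"
      then have "\<bar>g' x\<bar> \<le> C * x ^ n / fact n" using that(3)[of x] that(5) by simp
      then show "\<exists>y. ((\<lambda>x. E x + g x) has_real_derivative y) (at x) \<and> 0 \<le> y"
        using DERIV_add[OF E[of x] g(1)[of x]]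
        by (intro exI[of _ "C * x ^ n / fact n + g' x"]) auto
    qed
    ultimately show ?thesis using \<open>E 0 = 0\<close> \<open>g 0 = 0\<close> by (auto simp: E_def abs_le_iff)
  qed
  show ?thesis
  proof (cases "0 \<le> t")
    case True
    then show ?thesis using pos[of f f' t] der assms by simp
  next
    case False
    have d: "((\<lambda>t. f (- t)) has_real_derivative - f' (- t)) (at t)" for t
      using DERIV_chain2[OF der DERIV_minus[OF DERIV_ident], of t UNIV] by simp
    have bd': "\<bar>- f' (- t)\<bar> \<le> C * \<bar>t\<bar> ^ n / fact n" if "\<bar>t\<bar> \<le> H" for t
      using bd[of "- t"] that by simp
    have "\<bar>f (- (- t))\<bar> \<le> C * (- t) ^ Suc n / fact (Suc n)"
      by (rule pos[OF d _ bd']) (use assms False in auto)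
    then show ?thesis using False by simp
  qed
qed

section \<open>Hill's equation with a spectral parameter\<close>

text \<open>The coefficients of the solution as a power series in the spectral parameter.\<close>

fun hill_coeff :: "(real \<Rightarrow> real) \<Rightarrow> (real \<Rightarrow> real) \<Rightarrow> nat \<Rightarrow> real \<Rightarrow> real" where
  "hill_coeff \<rho> f 0 = f"
| "hill_coeff \<rho> f (Suc n) = prim (prim (\<lambda>t. - \<rho> t * hill_coeff \<rho> f n t))"

text \<open>Weierstrass M-test with one majorant for terms and derivatives. It must beat every
  geometric sequence because \<open>l\<close> ranges over all reals.\<close>

lemma suminf_deriv_continuous:
  fixes a a' :: "nat \<Rightarrow> real \<Rightarrow> real"
  assumes der: "\<And>n t. (a n has_real_derivative a' n t) (at t)"
    and bd: "\<And>n t. \<bar>t\<bar> \<le> H \<Longrightarrow> \<bar>a n t\<bar> \<le> m n" and bd': "\<And>n t. \<bar>t\<bar> \<le> H \<Longrightarrow> \<bar>a' n t\<bar> \<le> m n"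
    and m: "\<And>L. summable (\<lambda>n. L ^ n * m n)"
    and "H > 0"
  shows "\<bar>t\<bar> < H \<Longrightarrow> ((\<lambda>t. \<Sum>n. l ^ n * a n t) has_real_derivative (\<Sum>n. l ^ n * a' n t)) (at t)"
    and "continuous_on ({-L..L} \<times> {-H..H}) (\<lambda>(l, t). \<Sum>n. l ^ n * a n t)"
proof -
  show "((\<lambda>t. \<Sum>n. l ^ n * a n t) has_real_derivative (\<Sum>n. l ^ n * a' n t)) (at t)" if "\<bar>t\<bar> < H" for t
  proof -
    have u: "uniformly_convergent_on {-H..H} (\<lambda>k x. \<Sum>i<k. l ^ i * a' i x)"
      by (rule Weierstrass_m_test'[OF _ m[of "\<bar>l\<bar>"]])
        (auto simp: abs_mult power_abs intro!: mult_left_mono bd')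
    have s: "summable (\<lambda>n. l ^ n * a n 0)"
      by (rule summable_comparison_test'[OF m[of "\<bar>l\<bar>"], of 0])
        (use \<open>H > 0\<close> in \<open>auto simp: abs_mult power_abs intro!: mult_left_mono bd\<close>)
    have d: "((\<lambda>t. l ^ n * a n t) has_real_derivative l ^ n * a' n x) (at x within {-H..H})" for n x
      using DERIV_cmult[OF der] has_field_derivative_at_within by blast
    show ?thesis
      by (rule has_field_derivative_series'(2)[where S = "{-H..H}" and f = "\<lambda>n t. l ^ n * a n t"
          and f' = "\<lambda>n t. l ^ n * a' n t" and ?x0.0 = 0]) (use d u s that \<open>H > 0\<close> in auto)
  qed
  have ul: "uniform_limit ({-L..L} \<times> {-H..H}) (\<lambda>k p. \<Sum>i<k. fst p ^ i * a i (snd p))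
     (\<lambda>p. \<Sum>i. fst p ^ i * a i (snd p)) sequentially"
    by (rule Weierstrass_m_test[OF _ m[of "\<bar>L\<bar>"]])
      (auto simp: abs_mult power_abs intro!: mult_mono power_mono bd)
  have "continuous_on UNIV (a n)" for n
    using der by (rule continuous_on_UNIV_if_DERIV)
  then have c: "continuous_on ({-L..L} \<times> {-H..H}) (\<lambda>p. a i (snd p))" for i
    by (rule continuous_on_compose2) (auto intro!: continuous_intros)
  show "continuous_on ({-L..L} \<times> {-H..H}) (\<lambda>(l, t). \<Sum>n. l ^ n * a n t)"
    unfolding case_prod_beta
    by (rule uniform_limit_theorem[OF _ ul]) (auto intro!: always_eventually continuous_intros c)
qed

text \<open>Comparing powers of \<open>l\<close> in y'' = - l \<rho> y, y = sum of l^n c_n, gives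
  c_(n+1)'' = - \<rho> c_n. The initial data sit in c_0 = a + b t, and all later coefficients vanish
  to first order at 0.\<close>

lemma hill_solution_exists:
  fixes \<rho> :: "real \<Rightarrow> real" and a b :: real
  assumes cont: "continuous_on UNIV \<rho>" and bd: "\<And>t. \<bar>\<rho> t\<bar> \<le> K"
  obtains y y' :: "real \<Rightarrow> real \<Rightarrow> real" where
    "\<And>l t. (y l has_real_derivative y' l t) (at t)"
    "\<And>l t. (y' l has_real_derivative - l * \<rho> t * y l t) (at t)"
    "\<And>l. y l 0 = a" "\<And>l. y' l 0 = b"
    "continuous_on UNIV (\<lambda>(l, t). y l t)" "continuous_on UNIV (\<lambda>(l, t). y' l t)"
proof -
  define c where "c = hill_coeff \<rho> (\<lambda>t. a + b * t)"
  \<comment> \<open>\<open>d n\<close> and \<open>e n\<close> are the first and second derivatives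
    of \<open>c n\<close>.\<close>
  define d where "d = (\<lambda>n. case n of 0 \<Rightarrow> (\<lambda>_. b) | Suc k \<Rightarrow> prim (\<lambda>t. - \<rho> t * c k t))"
  define e where "e = (\<lambda>n. case n of 0 \<Rightarrow> (\<lambda>_. 0) | Suc k \<Rightarrow> (\<lambda>t. - \<rho> t * c k t))"
  have cc: "continuous_on UNIV (c n) \<and> continuous_on UNIV (d n)" for n
  proof (induction n)
    case 0
    then show ?case by (auto simp: c_def d_def intro!: continuous_intros)
  next
    case (Suc n)
    then have "continuous_on UNIV (\<lambda>t. - \<rho> t * c n t)" using cont by (auto intro!: continuous_intros)
    then have "continuous_on UNIV (prim (\<lambda>t. - \<rho> t * c n t))"
      by (rule continuous_on_UNIV_if_DERIV[OF DERIV_prim])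
    moreover from this have "continuous_on UNIV (prim (prim (\<lambda>t. - \<rho> t * c n t)))"
      by (rule continuous_on_UNIV_if_DERIV[OF DERIV_prim])
    ultimately show ?case by (simp add: c_def d_def)
  qed
  have ec: "continuous_on UNIV (e n)" for n
    using cc cont by (cases n) (auto simp: e_def intro!: continuous_intros)
  have cS: "c (Suc n) = prim (d (Suc n))" and dS: "d (Suc n) = prim (\<lambda>t. - \<rho> t * c n t)" for n
    by (auto simp: c_def d_def)
  have dc: "(c n has_real_derivative d n t) (at t)" for n t
  proof (cases n)
    case 0
    then show ?thesis by (auto simp: c_def d_def intro!: derivative_eq_intros)
  next
    case (Suc k)
    then show ?thesis using DERIV_prim cc[of n] cS by metis
  qed
  have dd: "(d n has_real_derivative e n t) (at t)" for n t
  proof (cases n)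
    case 0
    then show ?thesis by (auto simp: d_def e_def)
  next
    case (Suc k)
    then show ?thesis using DERIV_prim ec[of n] by (simp add: d_def e_def)
  qed
  define C where "C = (\<lambda>H. \<bar>a\<bar> + \<bar>b\<bar> * H)"
  have K0: "0 \<le> K" using bd[of 0] by linarith
  \<comment> \<open>Two integrations gain two powers of \<open>t\<close>. One of them is given up as
    a factor \<open>H\<close>, which leaves a bound with a single factorial and the same shape at
    every stage.\<close>
  have cb: "\<bar>c n t\<bar> \<le> C H * (K * H) ^ n * \<bar>t\<bar> ^ n / fact n" if "\<bar>t\<bar> \<le> H" for n t H
    using that
  proof (induction n arbitrary: t)
    case 0
    have "\<bar>b * t\<bar> \<le> \<bar>b\<bar> * H" using 0 by (simp add: abs_mult mult_left_mono)
    then show ?case by (auto simp: c_def C_def)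
  next
    case (Suc n)
    have H0: "0 \<le> H" using Suc by linarith
    have eb: "\<bar>e (Suc n) t\<bar> \<le> K * C H * (K * H) ^ n * \<bar>t\<bar> ^ n / fact n" if "\<bar>t\<bar> \<le> H" for t
    proof -
      have "\<bar>\<rho> t\<bar> * \<bar>c n t\<bar> \<le> K * (C H * (K * H) ^ n * \<bar>t\<bar> ^ n / fact n)"
        using bd Suc.IH[OF that] K0 by (intro mult_mono) auto
      then show ?thesis by (simp add: e_def abs_mult algebra_simps)
    qed
    have db: "\<bar>d (Suc n) t\<bar> \<le> K * C H * (K * H) ^ n * \<bar>t\<bar> ^ Suc n / fact (Suc n)" if "\<bar>t\<bar> \<le> H" for t
      by (rule abs_power_bound[OF dd _ eb that]) (auto simp: dS)
    define B where "B = K * C H * (K * H) ^ n * \<bar>t\<bar> ^ Suc n / fact (Suc n)"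
    have B: "\<bar>d (Suc n) s\<bar> \<le> B" if "\<bar>s\<bar> \<le> \<bar>t\<bar>" for s
    proof -
      have "K * C H * (K * H) ^ n * \<bar>s\<bar> ^ Suc n / fact (Suc n) \<le> B"
        unfolding B_def using that K0 H0
        by (intro divide_right_mono mult_left_mono power_mono) (auto simp: C_def)
      then show ?thesis using db[of s] that Suc.prems by linarith
    qed
    have "\<bar>c (Suc n) t\<bar> \<le> B * \<bar>t\<bar> ^ Suc 0 / fact (Suc 0)"
      by (rule abs_power_bound[OF dc, where H = "\<bar>t\<bar>"]) (use B in \<open>auto simp: cS\<close>)
    also have "\<dots> \<le> B * H"
    proof -
      have "0 \<le> B" using order_trans[OF abs_ge_zero B[of 0]] by simp
      then show ?thesis using Suc.prems by (simp add: mult_left_mono)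
    qed
    finally show ?case by (simp add: B_def algebra_simps)
  qed
  define m where "m = (\<lambda>H n. C H * (K * H * H) ^ n / fact n)"
  define m' where "m' = (\<lambda>H n. case n of 0 \<Rightarrow> \<bar>b\<bar> | Suc k \<Rightarrow> K * H * m H k)"
  define m'' where "m'' = (\<lambda>H n. case n of 0 \<Rightarrow> 0 | Suc k \<Rightarrow> K * m H k)"
  have cm: "\<bar>c n t\<bar> \<le> m H n" if "\<bar>t\<bar> \<le> H" for n t H
  proof -
    have "C H * (K * H) ^ n * \<bar>t\<bar> ^ n / fact n \<le> C H * (K * H) ^ n * H ^ n / fact n"
      using that K0 by (intro divide_right_mono mult_left_mono power_mono) (auto simp: C_def)
    then show ?thesis using cb[OF that, of n] by (simp add: m_def power_mult_distrib algebra_simps)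
  qed
  have em: "\<bar>e n t\<bar> \<le> m'' H n" if "\<bar>t\<bar> \<le> H" for n t H
    using bd K0 cm[OF that]
    by (cases n) (auto simp: e_def m''_def abs_mult intro!: mult_mono)
  have dm: "\<bar>d n t\<bar> \<le> m' H n" if "\<bar>t\<bar> \<le> H" for n t H
  proof (cases n)
    case (Suc k)
    have "\<bar>d (Suc k) t\<bar> \<le> (K * m H k) * \<bar>t\<bar> ^ Suc 0 / fact (Suc 0)"
      by (rule abs_power_bound[OF dd _ _ that]) (use em[of _ H "Suc k"] in \<open>auto simp: dS m''_def\<close>)
    also have "\<dots> \<le> K * m H k * H"
    proof -
      have "0 \<le> m H k" using cm[OF that, of k] by linarith
      then show ?thesis using that K0 by (auto intro!: mult_left_mono)
    qed
    finally show ?thesis using Suc by (simp add: m'_def algebra_simps)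
  qed (simp add: d_def m'_def)
  have sm: "summable (\<lambda>n. L ^ n * m H n)" for L H
  proof -
    have "summable (\<lambda>n. C H * ((L * (K * H * H)) ^ n /\<^sub>R fact n))"
      by (intro summable_mult summable_exp_generic)
    moreover have "C H * ((L * (K * H * H)) ^ n /\<^sub>R fact n) = L ^ n * m H n" for n
      by (simp add: m_def power_mult_distrib divide_inverse algebra_simps)
    ultimately show ?thesis by (simp only:)
  qed
  have sm': "summable (\<lambda>n. L ^ n * m' H n)" and sm'': "summable (\<lambda>n. L ^ n * m'' H n)" for L H
  proof -
    have "summable (\<lambda>n. (L * (K * H)) * (L ^ n * m H n))"
      by (intro summable_mult sm)
    then have "summable (\<lambda>n. L ^ Suc n * m' H (Suc n))"
      by (simp add: m'_def algebra_simps)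
    then show "summable (\<lambda>n. L ^ n * m' H n)" by (subst (asm) summable_Suc_iff)
    have "summable (\<lambda>n. (L * K) * (L ^ n * m H n))"
      by (intro summable_mult sm)
    then have "summable (\<lambda>n. L ^ Suc n * m'' H (Suc n))"
      by (simp add: m''_def algebra_simps)
    then show "summable (\<lambda>n. L ^ n * m'' H n)" by (subst (asm) summable_Suc_iff)
  qed
  \<comment> \<open>One majorant for the coefficients and both derivatives serves the series for
    \<open>y\<close> as well as the one for \<open>y'\<close>.\<close>
  define M where "M = (\<lambda>H n. m H n + m' H n + m'' H n)"
  have M: "summable (\<lambda>n. L ^ n * M H n)" for L H
    using summable_add[OF summable_add[OF sm sm'] sm''] by (simp only: M_def distrib_left)
  have b: "\<bar>c n t\<bar> \<le> M H n" "\<bar>d n t\<bar> \<le> M H n" "\<bar>e n t\<bar> \<le> M H n" if "\<bar>t\<bar> \<le> H" for n t H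
    using cm[OF that, of n] dm[OF that, of n] em[OF that, of n] by (auto simp: M_def)
  define y where "y = (\<lambda>l t. \<Sum>n. l ^ n * c n t)"
  define y' where "y' = (\<lambda>l t. \<Sum>n. l ^ n * d n t)"
  have "(y l has_real_derivative y' l t) (at t)" for l t
    unfolding y_def y'_def
    by (rule suminf_deriv_continuous(1)[where H = "\<bar>t\<bar> + 1" and m = "M (\<bar>t\<bar> + 1)"])
      (use dc cc b M in auto)
  moreover have "(y' l has_real_derivative - l * \<rho> t * y l t) (at t)" for l t
  proof -
    have 1: "(y' l has_real_derivative (\<Sum>n. l ^ n * e n t)) (at t)"
      unfolding y'_def
      by (rule suminf_deriv_continuous(1)[where H = "\<bar>t\<bar> + 1" and m = "M (\<bar>t\<bar> + 1)"])
        (use dd ec b M in auto)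
    have s: "summable (\<lambda>n. l ^ n * c n t)"
      by (rule summable_comparison_test'[OF sm[of "\<bar>l\<bar>" "\<bar>t\<bar>"], of 0])
        (auto simp: abs_mult power_abs intro!: mult_left_mono cm)
    have se: "summable (\<lambda>n. l ^ n * e n t)"
      by (rule summable_comparison_test'[OF sm''[of "\<bar>l\<bar>" "\<bar>t\<bar>"], of 0])
        (auto simp: abs_mult power_abs intro!: mult_left_mono em)
    have "(\<Sum>n. l ^ n * e n t) = (\<Sum>n. l ^ Suc n * e (Suc n) t)"
      using suminf_split_head[OF se] by (simp add: e_def)
    also have "\<dots> = (\<Sum>n. (- l * \<rho> t) * (l ^ n * c n t))"
      by (simp add: e_def algebra_simps)
    also have "\<dots> = - l * \<rho> t * y l t"
      unfolding y_def by (rule suminf_mult[OF s])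
    finally show ?thesis using 1 by simp
  qed
  moreover have "y l 0 = a" for l
  proof -
    have "(\<lambda>n. l ^ n * c n 0) = (\<lambda>n. if n = 0 then a else 0)"
      by (auto simp: fun_eq_iff c_def gr0_conv_Suc)
    then have "(\<lambda>n. l ^ n * c n 0) sums a" using sums_single[of 0 "\<lambda>_. a"] by (simp add: eq_commute)
    then show ?thesis by (simp add: y_def sums_iff)
  qed
  moreover have "y' l 0 = b" for l
  proof -
    have "(\<lambda>n. l ^ n * d n 0) = (\<lambda>n. if n = 0 then b else 0)"
      by (auto simp: fun_eq_iff d_def gr0_conv_Suc)
    then have "(\<lambda>n. l ^ n * d n 0) sums b" using sums_single[of 0 "\<lambda>_. b"] by (simp add: eq_commute)
    then show ?thesis by (simp add: y'_def sums_iff)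
  qed
  moreover have "continuous_on UNIV (\<lambda>(l, t). y l t)" "continuous_on UNIV (\<lambda>(l, t). y' l t)"
  proof -
    have glue: "continuous_on UNIV g" if "\<And>L H. H > 0 \<Longrightarrow> continuous_on ({-L..L} \<times> {-H..H}) g"
      for g :: "real \<times> real \<Rightarrow> real"
    proof (rule continuous_at_imp_continuous_on, safe)
      fix l t :: real
      define L where "L = \<bar>l\<bar> + 1"
      define H where "H = \<bar>t\<bar> + 1"
      have "continuous_on ({-L<..<L} \<times> {-H<..<H}) g"
        by (rule continuous_on_subset[OF that[of H L]]) (auto simp: H_def)
      moreover have "open ({-L<..<L} \<times> {-H<..<H})" by (intro open_Times) auto
      moreover have "(l, t) \<in> {-L<..<L} \<times> {-H<..<H}" by (auto simp: L_def H_def)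
      ultimately show "isCont g (l, t)" using continuous_on_eq_continuous_at by blast
    qed
    show "continuous_on UNIV (\<lambda>(l, t). y l t)"
      unfolding y_def
      by (rule glue, rule suminf_deriv_continuous(2)[where m = "M _", OF dc b(1) b(2) M])
    show "continuous_on UNIV (\<lambda>(l, t). y' l t)"
      unfolding y'_def
      by (rule glue, rule suminf_deriv_continuous(2)[where m = "M _", OF dd b(2) b(3) M])
  qed
  ultimately show ?thesis using that by blast
qed

section \<open>Wronskians and reflection symmetry\<close>

lemma wronskian_const:
  fixes f f' g g' q :: "real \<Rightarrow> real"
  assumes "\<And>t. (f has_real_derivative f' t) (at t)" "\<And>t. (f' has_real_derivative q t * f t) (at t)"
    and "\<And>t. (g has_real_derivative g' t) (at t)" "\<And>t. (g' has_real_derivative q t * g t) (at t)"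
  shows "f s * g' s - f' s * g s = f t * g' t - f' t * g t"
proof -
  have "((\<lambda>t. f t * g' t - f' t * g t) has_real_derivative 0) (at t)" for t
    using assms by (auto intro!: derivative_eq_intros simp: algebra_simps)
  then show ?thesis by (rule DERIV_zero_const)
qed

text \<open>Uniqueness by Cramer's rule: the Wronskians of \<open>f\<close> with the fundamental
  system \<open>y\<close>, \<open>v\<close> vanish at \<open>a\<close>, hence everywhere, and
  \<open>f\<close> is a linear combination of them.\<close>

lemma linear_ode_zero:
  fixes f f' y y' v v' q :: "real \<Rightarrow> real"
  assumes f: "\<And>t. (f has_real_derivative f' t) (at t)" "\<And>t. (f' has_real_derivative q t * f t) (at t)"
    and y: "\<And>t. (y has_real_derivative y' t) (at t)" "\<And>t. (y' has_real_derivative q t * y t) (at t)"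
    and v: "\<And>t. (v has_real_derivative v' t) (at t)" "\<And>t. (v' has_real_derivative q t * v t) (at t)"
    and W: "y 0 * v' 0 - y' 0 * v 0 = 1"
    and "f a = 0" "f' a = 0"
  shows "f t = 0"
proof -
  have "f t * y' t - f' t * y t = 0" "f t * v' t - f' t * v t = 0"
    using wronskian_const[OF f y, of t a] wronskian_const[OF f v, of t a] assms by auto
  moreover have "y t * v' t - y' t * v t = 1"
    using wronskian_const[OF y v, of t 0] W by simp
  ultimately have "f t * (y t * v' t - y' t * v t) = 0" by algebra
  then show ?thesis using \<open>y t * v' t - y' t * v t = 1\<close> by simp
qed

text \<open>Reflection in a symmetry point \<open>a\<close> of \<open>q\<close> maps solutions to
  solutions, so the difference or the sum of \<open>f\<close> and its reflection has zero initial
  data at \<open>a\<close>. The pair \<open>y\<close>, \<open>v\<close> supplies the fundamental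
  system for uniqueness.\<close>

lemma even_of_odd_critical:
  fixes y y' v v' q :: "real \<Rightarrow> real"
  assumes y: "\<And>t. (y has_real_derivative y' t) (at t)" "\<And>t. (y' has_real_derivative q t * y t) (at t)"
    and v: "\<And>t. (v has_real_derivative v' t) (at t)" "\<And>t. (v' has_real_derivative q t * v t) (at t)"
    and W: "y 0 * v' 0 - y' 0 * v 0 = 1"
    and f: "\<And>t. (f has_real_derivative f' t) (at t)" "\<And>t. (f' has_real_derivative q t * f t) (at t)"
    and sym: "\<And>t. q (2 * a - t) = q t"
  shows "f' a = 0 \<Longrightarrow> f (2 * a - t) = f t" "f a = 0 \<Longrightarrow> f (2 * a - t) = - f t"
proof -
  have r: "((\<lambda>t. f (2 * a - t)) has_real_derivative - f' (2 * a - t)) (at t)"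
    "((\<lambda>t. - f' (2 * a - t)) has_real_derivative q t * f (2 * a - t)) (at t)" for t
  proof -
    have g: "((\<lambda>t. 2 * a - t) has_real_derivative - 1) (at t)"
      by (auto intro!: derivative_eq_intros)
    show "((\<lambda>t. f (2 * a - t)) has_real_derivative - f' (2 * a - t)) (at t)"
      using DERIV_chain2[where f = f and g = "\<lambda>t. 2 * a - t", OF f(1) g] by simp
    show "((\<lambda>t. - f' (2 * a - t)) has_real_derivative q t * f (2 * a - t)) (at t)"
      using DERIV_minus[OF DERIV_chain2[where f = f' and g = "\<lambda>t. 2 * a - t", OF f(2) g]] sym[of t] by simp
  qed
  show "f (2 * a - t) = f t" if "f' a = 0"
  proof -
    have "f (2 * a - t) - f t = 0"
      by (rule linear_ode_zero[where f = "\<lambda>t. f (2 * a - t) - f t" and f' = "\<lambda>t. - f' (2 * a - t) - f' t"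
            and a = a, OF DERIV_diff[OF r(1) f(1)] _ y v W])
        (use DERIV_diff[OF r(2) f(2)] that in \<open>auto simp: algebra_simps\<close>)
    then show ?thesis by simp
  qed
  show "f (2 * a - t) = - f t" if "f a = 0"
  proof -
    have "f (2 * a - t) + f t = 0"
      by (rule linear_ode_zero[where f = "\<lambda>t. f (2 * a - t) + f t" and f' = "\<lambda>t. - f' (2 * a - t) + f' t"
            and a = a, OF DERIV_add[OF r(1) f(1)] _ y v W])
        (use DERIV_add[OF r(2) f(2)] that in \<open>auto simp: algebra_simps\<close>)
    then show ?thesis by simp
  qed
qed

section \<open>Polar angles and Pruefer angles\<close>

text \<open>Split the velocity as (x + i y)' = (k + i w) (x + i y). Rotating the curve back by
  \<theta> removes \<open>w\<close>, so both components \<open>A\<close> and \<open>B\<close> of the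
  rotated curve satisfy the same equation f' = k f as the radius, and their quotients by the radius
  are constant.\<close>

lemma polar_lift:
  fixes x y x' y' \<theta> :: "real \<Rightarrow> real"
  assumes x: "\<And>t. (x has_real_derivative x' t) (at t)" and y: "\<And>t. (y has_real_derivative y' t) (at t)"
    and \<theta>: "\<And>t. (\<theta> has_real_derivative (x t * y' t - y t * x' t) / ((x t)\<^sup>2 + (y t)\<^sup>2)) (at t)"
    and nz: "\<And>t. (x t)\<^sup>2 + (y t)\<^sup>2 > 0"
    and init: "x 0 = r0 * cos (\<theta> 0)" "y 0 = r0 * sin (\<theta> 0)" "r0 > 0"
  obtains r where "r > 0" "x t = r * cos (\<theta> t)" "y t = r * sin (\<theta> t)"
proof -
  define r where "r = (\<lambda>t. sqrt ((x t)\<^sup>2 + (y t)\<^sup>2))"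
  define A where "A = (\<lambda>t. x t * cos (\<theta> t) + y t * sin (\<theta> t))"
  define B where "B = (\<lambda>t. y t * cos (\<theta> t) - x t * sin (\<theta> t))"
  define w where "w = (\<lambda>t. (x t * y' t - y t * x' t) / ((x t)\<^sup>2 + (y t)\<^sup>2))"
  define k where "k = (\<lambda>t. (x t * x' t + y t * y' t) / ((x t)\<^sup>2 + (y t)\<^sup>2))"
  have r0: "r t > 0" for t using nz by (simp add: r_def)
  have rsq: "(r t)\<^sup>2 = (x t)\<^sup>2 + (y t)\<^sup>2" for t using nz[of t] by (simp add: r_def)
  have wk: "x' t = k t * x t - w t * y t" "y' t = k t * y t + w t * x t" for t
  proof -
    have aux: "p / n * u - q / n * v = (p * u - q * v) / n"
      and aux': "p / n * u + q / n * v = (p * u + q * v) / n" for p q n u v :: real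
      by (simp_all add: diff_divide_distrib add_divide_distrib)
    have n: "(x t)\<^sup>2 + (y t)\<^sup>2 \<noteq> 0" using nz[of t] by (metis less_irrefl)
    have "k t * x t - w t * y t = ((x t * x' t + y t * y' t) * x t - (x t * y' t - y t * x' t) * y t) / ((x t)\<^sup>2 + (y t)\<^sup>2)"
      unfolding k_def w_def by (rule aux)
    also have "(x t * x' t + y t * y' t) * x t - (x t * y' t - y t * x' t) * y t = x' t * ((x t)\<^sup>2 + (y t)\<^sup>2)"
      by (simp add: algebra_simps power2_eq_square)
    finally show "x' t = k t * x t - w t * y t" using n by auto
    have "k t * y t + w t * x t = ((x t * x' t + y t * y' t) * y t + (x t * y' t - y t * x' t) * x t) / ((x t)\<^sup>2 + (y t)\<^sup>2)"
      unfolding k_def w_def by (rule aux')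
    also have "(x t * x' t + y t * y' t) * y t + (x t * y' t - y t * x' t) * x t = y' t * ((x t)\<^sup>2 + (y t)\<^sup>2)"
      by (simp add: algebra_simps power2_eq_square)
    finally show "y' t = k t * y t + w t * x t" using n by auto
  qed
  have dr: "(r has_real_derivative k t * r t) (at t)" for t
  proof -
    have n: "(x t)\<^sup>2 + (y t)\<^sup>2 \<noteq> 0" using nz[of t] by (metis less_irrefl)
    have "(r has_real_derivative (2 * x t * x' t + 2 * y t * y' t) * inverse (sqrt ((x t)\<^sup>2 + (y t)\<^sup>2)) / 2) (at t)"
      unfolding r_def using nz[of t] x y
      by (auto intro!: derivative_eq_intros simp: field_simps)
    moreover have "(2 * x t * x' t + 2 * y t * y' t) * inverse (sqrt ((x t)\<^sup>2 + (y t)\<^sup>2)) / 2 = k t * r t"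
    proof -
      have "k t * (r t)\<^sup>2 = x t * x' t + y t * y' t"
        using n unfolding k_def rsq by simp
      then have "2 * x t * x' t + 2 * y t * y' t = 2 * (k t * r t) * r t"
        by (simp add: power2_eq_square algebra_simps)
      moreover have "sqrt ((x t)\<^sup>2 + (y t)\<^sup>2) = r t" by (simp add: r_def)
      ultimately show ?thesis using r0[of t] by simp
    qed
    ultimately show ?thesis by simp
  qed
  have \<theta>': "(\<theta> has_real_derivative w t) (at t)" for t using \<theta> by (simp add: w_def)
  have dA: "(A has_real_derivative k t * A t) (at t)" and dB: "(B has_real_derivative k t * B t) (at t)" for t
    unfolding A_def B_def using x[of t] y[of t] \<theta>'[of t]
    by (auto intro!: derivative_eq_intros simp: wk algebra_simps)
  have q: "A t / r t = A 0 / r 0" "B t / r t = B 0 / r 0"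
    by (rule DERIV_zero_const, use dA dB dr r0 in \<open>auto intro!: derivative_eq_intros simp: less_imp_neq[symmetric]\<close>)+
  have "r 0 = r0"
  proof -
    have "(r 0)\<^sup>2 = r0\<^sup>2 * ((cos (\<theta> 0))\<^sup>2 + (sin (\<theta> 0))\<^sup>2)"
      unfolding rsq init(1,2) by (simp only: distrib_left power_mult_distrib)
    then show ?thesis using r0[of 0] init(3) by (simp add: sin_cos_squared_add2)
  qed
  have "A 0 = r0 * ((cos (\<theta> 0))\<^sup>2 + (sin (\<theta> 0))\<^sup>2)"
    unfolding A_def init(1,2) power2_eq_square by (simp only: distrib_left mult.assoc)
  then have "A 0 = r0" by simp
  moreover have "B 0 = 0" unfolding B_def init(1,2) by simp
  ultimately have AB: "A t = r t" "B t = 0"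
    using q r0[of t] r0[of 0] \<open>r 0 = r0\<close> \<open>r0 > 0\<close> by (auto simp: field_simps)
  have "A t * cos (\<theta> t) - B t * sin (\<theta> t) = x t * ((cos (\<theta> t))\<^sup>2 + (sin (\<theta> t))\<^sup>2)"
    "A t * sin (\<theta> t) + B t * cos (\<theta> t) = y t * ((cos (\<theta> t))\<^sup>2 + (sin (\<theta> t))\<^sup>2)"
    unfolding A_def B_def by algebra+
  then have "x t = r t * cos (\<theta> t)" "y t = r t * sin (\<theta> t)" using AB by auto
  then show ?thesis using that r0 by blast
qed

text \<open>The only topological input for angles: a continuous angle that misses two values stays
  in the gap where it starts.\<close>

lemma continuous_avoids_stays:
  fixes D :: "real \<Rightarrow> real"
  assumes cont: "continuous_on UNIV D" and "a < D 0" "D 0 < b"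
    and av: "\<And>t. D t \<noteq> a" "\<And>t. D t \<noteq> b"
  shows "a < D t \<and> D t < b"
proof -
  have "connected (range D)" using cont connected_continuous_image by blast
  then have "x \<in> range D" if "min (D 0) (D t) \<le> x" "x \<le> max (D 0) (D t)" for x
    using that connected_contains_Icc[of "range D" "min (D 0) (D t)" "max (D 0) (D t)"]
    by (auto simp: min_def max_def split: if_splits)
  from this[of a] this[of b] show ?thesis using assms by fastforce
qed

text \<open>The angle is defined as the primitive of the derivative that it must have. This selects
  a global branch, and its continuity in \<open>l\<close> at \<open>h\<close> is that of an integral
  with a parameter.\<close>

lemma pruefer_angle:
  fixes \<rho> :: "real \<Rightarrow> real" and y y' :: "real \<Rightarrow> real \<Rightarrow> real"
  assumes cont\<rho>: "continuous_on UNIV \<rho>" and "h > 0"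
    and y: "\<And>l t. (y l has_real_derivative y' l t) (at t)"
      "\<And>l t. (y' l has_real_derivative - l * \<rho> t * y l t) (at t)"
    and init: "\<And>l. y' l 0 = cos \<alpha>" "\<And>l. y l 0 = sin \<alpha>"
    and cont: "continuous_on UNIV (\<lambda>(l, t). y l t)" "continuous_on UNIV (\<lambda>(l, t). y' l t)"
    and nz: "\<And>l t. (y' l t)\<^sup>2 + (y l t)\<^sup>2 > 0"
  obtains \<Theta> where "\<And>l. \<Theta> l 0 = \<alpha>" "\<And>l. continuous_on UNIV (\<Theta> l)" "continuous_on UNIV (\<lambda>l. \<Theta> l h)"
    "\<And>l t. \<exists>r>0. y' l t = r * cos (\<Theta> l t) \<and> y l t = r * sin (\<Theta> l t)"
proof -
  define F where "F = (\<lambda>l t. ((y' l t)\<^sup>2 + l * \<rho> t * (y l t)\<^sup>2) / ((y' l t)\<^sup>2 + (y l t)\<^sup>2))"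
  have F2: "continuous_on UNIV (\<lambda>(l, t). F l t)"
  proof -
    have "continuous_on UNIV (\<lambda>p::real\<times>real. \<rho> (snd p))"
      by (rule continuous_on_compose2[OF cont\<rho>]) (auto intro!: continuous_intros)
    moreover have "(y' (fst p) (snd p))\<^sup>2 + (y (fst p) (snd p))\<^sup>2 \<noteq> 0" for p
      using nz by (metis less_irrefl)
    ultimately show ?thesis
      using cont unfolding F_def case_prod_beta
      by (intro continuous_intros) blast+
  qed
  have F1: "continuous_on UNIV (F l)" for l
  proof -
    have "continuous_on UNIV (\<lambda>t::real. (l, t))" by (intro continuous_intros)
    from continuous_on_compose2[OF F2 this] show ?thesis by simp
  qed
  define \<Theta> where "\<Theta> = (\<lambda>l t. \<alpha> + prim (F l) t)"
  have d: "(\<Theta> l has_real_derivative F l t) (at t)" for l t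
    unfolding \<Theta>_def using DERIV_prim[OF F1] by (auto intro!: derivative_eq_intros)
  have \<Theta>0: "\<Theta> l 0 = \<alpha>" for l by (simp add: \<Theta>_def)
  moreover have "continuous_on UNIV (\<Theta> l)" for l using d continuous_on_UNIV_if_DERIV by blast
  moreover have "continuous_on UNIV (\<lambda>l. \<Theta> l h)"
  proof -
    have "continuous_on UNIV (\<lambda>l. integral (cbox 0 h) (F l))"
      by (rule integral_continuous_on_param) (use F2 continuous_on_subset in blast)
    then show ?thesis using \<open>h > 0\<close> by (auto simp: \<Theta>_def prim_nonneg_arg intro!: continuous_intros)
  qed
  moreover have "\<exists>r>0. y' l t = r * cos (\<Theta> l t) \<and> y l t = r * sin (\<Theta> l t)" for l t
  proof -
    have "(\<Theta> l has_real_derivative (y' l t * y' l t - y l t * (- l * \<rho> t * y l t)) / ((y' l t)\<^sup>2 + (y l t)\<^sup>2)) (at t)" for t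
      using d[of l t] by (simp add: F_def power2_eq_square algebra_simps)
    from polar_lift[OF y(2) y(1) this nz, of 1 t] init show ?thesis
      by (metis \<Theta>0 mult_1 zero_less_one)
  qed
  ultimately show ?thesis using that by blast
qed

section \<open>Periodic eigenvalues for an even coefficient\<close>

definition hill_solution :: "(real \<Rightarrow> real) \<Rightarrow> real \<Rightarrow> real \<Rightarrow> (real \<Rightarrow> real) \<Rightarrow> bool" where
  "hill_solution \<rho> l k f \<longleftrightarrow>
     (\<exists>f'. (\<forall>t. (f has_real_derivative f' t) (at t)) \<and>
        (\<forall>t. (f' has_real_derivative (k\<^sup>2 - l * \<rho> t) * f t) (at t)))"

definition periodic_solution :: "(real \<Rightarrow> real) \<Rightarrow> real \<Rightarrow> real \<Rightarrow> (real \<Rightarrow> real) \<Rightarrow> bool" where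
  "periodic_solution \<rho> P l f \<longleftrightarrow> hill_solution \<rho> l 0 f \<and> (\<forall>t. f (t + P) = f t)"

text \<open>For even \<open>\<rho>\<close> the periodic problem on \<open>[0, 2 h]\<close> splits into a Neumann and a Dirichlet
  problem on \<open>[0, h]\<close>. Both are solved by the intermediate value theorem for the Pruefer angle
  at \<open>h\<close> as a function of \<open>l\<close>; the given solution \<open>g\<close> at \<open>l0\<close> fixes this angle, because the
  curve \<open>g' + i g\<close> is never opposite to \<open>i exp (i \<zeta>)\<close>.\<close>

theorem hill_even_count:
  fixes \<rho> g g' \<zeta> :: "real \<Rightarrow> real" and N :: nat
  assumes cont\<rho>: "continuous_on UNIV \<rho>" and bd: "\<And>t. \<bar>\<rho> t\<bar> \<le> K"
    and even: "\<And>t. \<rho> (- t) = \<rho> t" and per: "\<And>t. \<rho> (t + 2 * h) = \<rho> t" and "h > 0" "l0 > 0" "N > 0"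
    and g: "\<And>t. (g has_real_derivative g' t) (at t)" "\<And>t. (g' has_real_derivative - l0 * \<rho> t * g t) (at t)"
    and g0: "g 0 > 0" "g' 0 = 0" "g' h = 0"
    and \<zeta>: "continuous_on UNIV \<zeta>" "\<zeta> 0 = 0" "\<zeta> h = real N * pi"
    and not_opp: "\<And>t r. r > 0 \<Longrightarrow> g' t = r * sin (\<zeta> t) \<Longrightarrow> g t = - r * cos (\<zeta> t) \<Longrightarrow> False"
  obtains E D where "finite E" "card E = N" "E \<subseteq> {0..<l0}" "0 \<in> E"
    "\<And>l. l \<in> E \<Longrightarrow> \<exists>f. periodic_solution \<rho> (2 * h) l f \<and> f 0 \<noteq> 0"
    "finite D" "card D = N - 1" "D \<subseteq> {0<..<l0}"
    "\<And>l. l \<in> D \<Longrightarrow> \<exists>f. periodic_solution \<rho> (2 * h) l f \<and> f 0 = 0 \<and> (\<exists>t. f t \<noteq> 0)"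
proof -
  \<comment> \<open>\<open>y\<close> carries the Neumann data at 0 and \<open>v\<close> the
    Dirichlet data.\<close>
  obtain y y' where y: "\<And>l t. (y l has_real_derivative y' l t) (at t)"
      "\<And>l t. (y' l has_real_derivative - l * \<rho> t * y l t) (at t)"
    and y0: "\<And>l. y l 0 = 1" "\<And>l. y' l 0 = 0"
    and yc: "continuous_on UNIV (\<lambda>(l, t). y l t)" "continuous_on UNIV (\<lambda>(l, t). y' l t)"
    using hill_solution_exists[OF cont\<rho> bd, of 1 0] by metis
  obtain v v' where v: "\<And>l t. (v l has_real_derivative v' l t) (at t)"
      "\<And>l t. (v' l has_real_derivative - l * \<rho> t * v l t) (at t)"
    and v0: "\<And>l. v l 0 = 0" "\<And>l. v' l 0 = 1"
    and vc: "continuous_on UNIV (\<lambda>(l, t). v l t)" "continuous_on UNIV (\<lambda>(l, t). v' l t)"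
    using hill_solution_exists[OF cont\<rho> bd, of 0 1] by metis
  have W: "y l t * v' l t - y' l t * v l t = 1" for l t
    using wronskian_const[OF y[of l] v[of l], of t 0] y0 v0 by simp
  have W0: "y l 0 * v' l 0 - y' l 0 * v l 0 = 1" for l using W .
  have ynz: "(y' l t)\<^sup>2 + (y l t)\<^sup>2 > 0" and vnz: "(v' l t)\<^sup>2 + (v l t)\<^sup>2 > 0" for l t
    using W[of l t] by (auto simp: sum_power2_gt_zero_iff)
  have refl: "\<rho> (2 * h - t) = \<rho> t" for t
    using even[of t] per[of "- t"] by (simp add: algebra_simps)
  \<comment> \<open>The reflections in 0 and in \<open>h\<close> compose to the translation by
    \<open>2 * h\<close>.\<close>
  have yp: "periodic_solution \<rho> (2 * h) l (y l)" if "y' l h = 0" for l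
  proof -
    have "y l (t + 2 * h) = y l t" for t
      using even_of_odd_critical(1)[OF y[of l] v[of l] W0 y[of l], where a = h and t = "- t"]
        even_of_odd_critical(1)[OF y[of l] v[of l] W0 y[of l], where a = 0 and t = t] refl even that y0 v0
      by (simp add: algebra_simps)
    then show ?thesis using y[of l] by (auto simp: periodic_solution_def hill_solution_def)
  qed
  have vp: "periodic_solution \<rho> (2 * h) l (v l)" if "v l h = 0" for l
  proof -
    have "v l (t + 2 * h) = v l t" for t
      using even_of_odd_critical(2)[OF y[of l] v[of l] W0 v[of l], where a = h and t = "- t"]
        even_of_odd_critical(2)[OF y[of l] v[of l] W0 v[of l], where a = 0 and t = t] refl even that y0 v0
      by (simp add: algebra_simps)
    then show ?thesis using v[of l] by (auto simp: periodic_solution_def hill_solution_def)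
  qed
  obtain \<Theta> where \<Theta>: "\<And>l. \<Theta> l 0 = pi / 2" "\<And>l. continuous_on UNIV (\<Theta> l)" "continuous_on UNIV (\<lambda>l. \<Theta> l h)"
    "\<And>l t. \<exists>r>0. y' l t = r * cos (\<Theta> l t) \<and> y l t = r * sin (\<Theta> l t)"
    using pruefer_angle[OF cont\<rho> \<open>h > 0\<close> y _ _ yc ynz, of "pi / 2"] y0 by (metis cos_pi_half sin_pi_half)
  obtain \<Psi> where \<Psi>: "\<And>l. \<Psi> l 0 = 0" "\<And>l. continuous_on UNIV (\<Psi> l)" "continuous_on UNIV (\<lambda>l. \<Psi> l h)"
    "\<And>l t. \<exists>r>0. v' l t = r * cos (\<Psi> l t) \<and> v l t = r * sin (\<Psi> l t)"
    using pruefer_angle[OF cont\<rho> \<open>h > 0\<close> v _ _ vc vnz, of 0] v0 by (metis cos_zero sin_zero)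
  text \<open>The Wronskian separates the two angles.\<close>
  have sep: "0 < \<Theta> l t - \<Psi> l t \<and> \<Theta> l t - \<Psi> l t < pi" for l t
  proof (rule continuous_avoids_stays[where D = "\<lambda>t. \<Theta> l t - \<Psi> l t"])
    show "continuous_on UNIV (\<lambda>t. \<Theta> l t - \<Psi> l t)" by (intro continuous_intros \<Theta> \<Psi>)
    have s: "sin (\<Theta> l t - \<Psi> l t) \<noteq> 0" for t
    proof -
      obtain r s where "y' l t = r * cos (\<Theta> l t)" "y l t = r * sin (\<Theta> l t)"
        "v' l t = s * cos (\<Psi> l t)" "v l t = s * sin (\<Psi> l t)"
        using \<Theta>(4) \<Psi>(4) by metis
      then have "r * s * sin (\<Theta> l t - \<Psi> l t) = 1"
        using W[of l t] by (simp add: sin_diff algebra_simps)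
      then show ?thesis by auto
    qed
    show "\<Theta> l t - \<Psi> l t \<noteq> 0" "\<Theta> l t - \<Psi> l t \<noteq> pi" for t
      using s[of t] by auto
  qed (simp_all add: \<Theta> \<Psi>)
  have gy: "g t = g 0 * y l0 t" for t
  proof -
    have d: "((\<lambda>t. g' t - g 0 * y' l0 t) has_real_derivative - l0 * \<rho> t * (g t - g 0 * y l0 t)) (at t)" for t
      using DERIV_diff[OF g(2)[of t] DERIV_cmult[OF y(2)[of l0 t], of "g 0"]] by (simp add: algebra_simps)
    have "g t - g 0 * y l0 t = 0"
      by (rule linear_ode_zero[where a = 0, OF DERIV_diff[OF g(1) DERIV_cmult[OF y(1)]] d y[of l0] v[of l0] W0])
        (use g0 y0 in auto)
    then show ?thesis by simp
  qed
  have gy': "g' t = g 0 * y' l0 t" for t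
  proof -
    have "(g has_real_derivative g 0 * y' l0 t) (at t)"
      using DERIV_cmult[OF y(1), of "g 0" l0 t] gy by (metis (no_types, lifting) ext)
    then show ?thesis using g(1) DERIV_unique by blast
  qed
  have \<Theta>l0: "\<Theta> l0 h = pi / 2 + real N * pi"
  proof -
    \<comment> \<open>The values \<pi> and - \<pi> of \<open>d\<close> are what
      \<open>not_opp\<close> forbids. At \<open>h\<close> the Neumann condition gives sin d = 0,
      which leaves only d = 0.\<close>
    define d where "d = (\<lambda>t. \<Theta> l0 t - pi / 2 - \<zeta> t)"
    have shift: "cos (z + pi / 2 + pi) = sin z" "cos (z + pi / 2 - pi) = sin z"
      "sin (z + pi / 2 + pi) = - cos z" "sin (z + pi / 2 - pi) = - cos z" for z
      unfolding cos_add cos_diff sin_add sin_diff by simp_all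
    have av: "d t \<noteq> pi \<and> d t \<noteq> - pi" for t
    proof -
      obtain r where r: "r > 0" "y' l0 t = r * cos (\<Theta> l0 t)" "y l0 t = r * sin (\<Theta> l0 t)" using \<Theta>(4) by metis
      have "\<not> (cos (\<Theta> l0 t) = sin (\<zeta> t) \<and> sin (\<Theta> l0 t) = - cos (\<zeta> t))"
        using not_opp[of "g 0 * r" t] r g0 gy[of t] gy'[of t] by auto
      moreover have "cos (\<Theta> l0 t) = sin (\<zeta> t)" "sin (\<Theta> l0 t) = - cos (\<zeta> t)" if "d t = pi \<or> d t = - pi"
      proof -
        have "\<Theta> l0 t = \<zeta> t + pi / 2 + pi \<or> \<Theta> l0 t = \<zeta> t + pi / 2 - pi"
          using that by (auto simp: d_def)
        then show "cos (\<Theta> l0 t) = sin (\<zeta> t)" "sin (\<Theta> l0 t) = - cos (\<zeta> t)"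
          using shift by metis+
      qed
      ultimately show ?thesis by blast
    qed
    have "continuous_on UNIV d" unfolding d_def by (intro continuous_intros \<Theta> \<zeta>)
    moreover have "d 0 = 0" by (simp add: d_def \<Theta> \<zeta>)
    ultimately have "- pi < d h \<and> d h < pi"
      by (intro continuous_avoids_stays[where D = d]) (use av in auto)
    moreover have "sin (d h) = 0"
    proof -
      have "cos (\<Theta> l0 h) = 0" using \<Theta>(4)[of l0 h] gy'[of h] g0 by auto
      moreover have "\<Theta> l0 h = d h + (pi / 2 + real N * pi)" by (simp add: d_def \<zeta>)
      moreover have "sin (pi / 2 + real N * pi) \<noteq> 0" "cos (pi / 2 + real N * pi) = 0"
        by (auto simp: sin_add cos_add)
      ultimately show ?thesis by (simp add: cos_add)
    qed
    ultimately have "d h = 0" by (metis sin_eq_0_pi)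
    then show ?thesis by (simp add: d_def \<zeta>)
  qed
  \<comment> \<open>At \<open>l = 0\<close> the solutions are 1 and t, so both angles at
    \<open>h\<close> start below the first target of the shooting.\<close>
  have \<Theta>0: "\<Theta> 0 h < pi / 2 + pi"
  proof -
    have y1: "y' 0 t = 0" for t
      using DERIV_zero_const[of "y' 0" t 0] y(2)[of 0] y0 by simp
    have "y 0 t = 1" for t
      using DERIV_zero_const[of "y 0" t 0] y(1)[of 0] y1 y0 by simp
    then have "\<Theta> 0 t \<noteq> 0 \<and> \<Theta> 0 t \<noteq> pi" for t using \<Theta>(4)[of 0 t] by auto
    then have "0 < \<Theta> 0 h \<and> \<Theta> 0 h < pi"
      by (intro continuous_avoids_stays[where D = "\<Theta> 0"]) (auto simp: \<Theta>(1) intro!: \<Theta>(2))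
    then show ?thesis by simp
  qed
  have \<Psi>0: "\<Psi> 0 h < pi" and v0h: "v 0 h \<noteq> 0"
  proof -
    have v1: "v' 0 t = 1" for t
      using DERIV_zero_const[of "v' 0" t 0] v(2)[of 0] v0 by simp
    have "v 0 t = t" for t
    proof -
      have "((\<lambda>t. v 0 t - t) has_real_derivative 0) (at t)" for t
        using DERIV_diff[OF v(1)[of 0 t] DERIV_ident] v1 by simp
      from DERIV_zero_const[OF this, of t 0] show ?thesis using v0 by simp
    qed
    then show "v 0 h \<noteq> 0" using \<open>h > 0\<close> by simp
    have "\<Psi> 0 t \<noteq> - pi \<and> \<Psi> 0 t \<noteq> pi" for t using \<Psi>(4)[of 0 t] v1[of t] by auto
    then have "- pi < \<Psi> 0 h \<and> \<Psi> 0 h < pi"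
      by (intro continuous_avoids_stays[where D = "\<Psi> 0"]) (auto simp: \<Psi>(1) intro!: \<Psi>(2))
    then show "\<Psi> 0 h < pi" by simp
  qed
  have jpi: "pi \<le> real (Suc j) * pi" for j by (simp add: algebra_simps)
  have "\<exists>l. 0 \<le> l \<and> l \<le> l0 \<and> \<Theta> l h = pi / 2 + real (Suc j) * pi" if "Suc j < N" for j
  proof (rule IVT')
    show "\<Theta> 0 h \<le> pi / 2 + real (Suc j) * pi" using \<Theta>0 jpi[of j] by linarith
    show "pi / 2 + real (Suc j) * pi \<le> \<Theta> l0 h" using that by (simp add: \<Theta>l0)
  qed (use \<open>l0 > 0\<close> \<Theta>(3) continuous_on_subset in auto)
  then obtain e where e: "0 \<le> e j" "e j \<le> l0" "\<Theta> (e j) h = pi / 2 + real (Suc j) * pi" if "j < N - 1" for j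
    by (metis less_diff_conv Suc_eq_plus1)
  \<comment> \<open>By \<open>sep\<close>, the Dirichlet angle at \<open>l0\<close> exceeds the
    Neumann angle minus \<pi>, that is (N - 1/2) \<pi>. So the targets \<pi>, ..., (N - 1) \<pi> are
    all reached before \<open>l0\<close>; the even problem has N - 1 targets too, besides the
    constant solution.\<close>
  have "\<exists>l. 0 \<le> l \<and> l \<le> l0 \<and> \<Psi> l h = real (Suc j) * pi" if "Suc j < N" for j
  proof (rule IVT')
    show "\<Psi> 0 h \<le> real (Suc j) * pi" using \<Psi>0 jpi[of j] by linarith
    have "real (Suc j) + 1 \<le> real N" using that by linarith
    then have "real (Suc j) * pi + pi \<le> real N * pi"
      by (metis distrib_right mult_1 mult_right_mono pi_ge_zero)
    then show "real (Suc j) * pi \<le> \<Psi> l0 h" using sep[of l0 h] \<Theta>l0 by linarith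
  qed (use \<open>l0 > 0\<close> \<Psi>(3) continuous_on_subset in auto)
  then obtain d where d: "0 \<le> d j" "d j \<le> l0" "\<Psi> (d j) h = real (Suc j) * pi" if "j < N - 1" for j
    by (metis less_diff_conv Suc_eq_plus1)
  have e_ne: "e j \<noteq> l0" "e j \<noteq> 0" if "j < N - 1" for j
  proof -
    have "real (Suc j) * pi < real N * pi" using that by (intro mult_strict_right_mono) auto
    then show "e j \<noteq> l0" using e(3)[OF that] \<Theta>l0 by auto
    show "e j \<noteq> 0" using e(3)[OF that] \<Theta>0 jpi[of j] by force
  qed
  have d_ne: "d j \<noteq> l0" "d j \<noteq> 0" if "j < N - 1" for j
  proof -
    have "real (Suc j) + 1 \<le> real N" using that by linarith
    then have "real (Suc j) * pi + pi \<le> real N * pi"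
      by (metis distrib_right mult_1 mult_right_mono pi_ge_zero)
    then show "d j \<noteq> l0" using d(3)[OF that] sep[of l0 h] \<Theta>l0 by auto
    show "d j \<noteq> 0" using d(3)[OF that] \<Psi>0 jpi[of j] by force
  qed
  have inj: "inj_on e {..<N - 1}" "inj_on d {..<N - 1}"
    using e(3) d(3) by (auto intro!: inj_onI simp del: of_nat_Suc) (metis Suc_inject mult_cancel_right of_nat_eq_iff pi_neq_zero add_left_cancel lessThan_iff)+
  have el: "0 \<le> e j" "e j < l0" and dl: "0 < d j" "d j < l0" if "j < N - 1" for j
    using e(1,2)[OF that] e_ne[OF that] d(1,2)[OF that] d_ne[OF that] by linarith+
  show ?thesis
  proof (rule that[of "insert 0 (e ` {..<N - 1})" "d ` {..<N - 1}"])
    have "0 \<notin> e ` {..<N - 1}" using e_ne by auto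
    then show "card (insert 0 (e ` {..<N - 1})) = N" using inj \<open>N > 0\<close> by (simp add: card_image)
    show "card (d ` {..<N - 1}) = N - 1" using inj by (simp add: card_image)
    show "insert 0 (e ` {..<N - 1}) \<subseteq> {0..<l0}" using el \<open>l0 > 0\<close> by auto
    show "d ` {..<N - 1} \<subseteq> {0<..<l0}" using dl by auto
    show "\<exists>f. periodic_solution \<rho> (2 * h) l f \<and> f 0 \<noteq> 0" if l: "l \<in> insert 0 (e ` {..<N - 1})" for l
    proof (cases "l = 0")
      case True
      then show ?thesis by (intro exI[of _ "\<lambda>_. 1"]) (auto simp: periodic_solution_def hill_solution_def intro!: exI[of _ "\<lambda>_. 0"])
    next
      case False
      then obtain j where j: "j < N - 1" "l = e j" using l by auto
      have "cos (\<Theta> l h) = 0" using e(3)[OF j(1)] j(2) by (simp add: cos_add del: of_nat_Suc)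
      then have "y' l h = 0" using \<Theta>(4)[of l h] by auto
      then show ?thesis using yp y0 by (intro exI[of _ "y l"]) auto
    qed
    show "\<exists>f. periodic_solution \<rho> (2 * h) l f \<and> f 0 = 0 \<and> (\<exists>t. f t \<noteq> 0)" if l: "l \<in> d ` {..<N - 1}" for l
    proof -
      obtain j where j: "j < N - 1" "l = d j" using l by auto
      have "sin (\<Psi> l h) = 0" using d(3)[OF j(1)] j(2) by (simp del: of_nat_Suc)
      then have "v l h = 0" using \<Psi>(4)[of l h] by auto
      moreover have "\<exists>t. v l t \<noteq> 0"
      proof (rule ccontr)
        assume "\<nexists>t. v l t \<noteq> 0"
        then have "v l = (\<lambda>_. 0)" by auto
        then have "v' l 0 = 0" using v(1)[of l 0] DERIV_unique[OF _ DERIV_const] by metis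
        then show False using v0 by simp
      qed
      ultimately show ?thesis using vp v0 by (intro exI[of _ "v l"]) auto
    qed
  qed auto
qed

section \<open>The periodic profile\<close>

text \<open>\<theta> is the polar angle of the point (a cos (\<phi>/2), b sin (\<phi>/2)) of an
  ellipse. This point always has positive scalar product with (cos (\<phi>/2), sin (\<phi>/2)), so
  \<theta> stays within \<pi>/2 of \<phi>/2; at \<phi> = 2 \<pi> the point is on the horizontal axis
  and the two angles agree.\<close>

lemma ellipse_angle:
  fixes \<phi> p \<theta> :: "real \<Rightarrow> real"
  assumes ab: "a > 0" "b > 0"
    and \<phi>: "\<And>t. (\<phi> has_real_derivative p t) (at t)" "\<phi> 0 = 0" "\<phi> T = 2 * pi"
    and \<theta>: "\<And>t. (\<theta> has_real_derivative a * b * (p t / 2) / (a\<^sup>2 * (cos (\<phi> t / 2))\<^sup>2 + b\<^sup>2 * (sin (\<phi> t / 2))\<^sup>2)) (at t)"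
      "\<theta> 0 = 0"
  shows "\<theta> T = pi"
proof -
  define x where "x = (\<lambda>t. a * cos (\<phi> t / 2))"
  define y where "y = (\<lambda>t. b * sin (\<phi> t / 2))"
  define x' where "x' = (\<lambda>t. - a * sin (\<phi> t / 2) * (p t / 2))"
  define y' where "y' = (\<lambda>t. b * cos (\<phi> t / 2) * (p t / 2))"
  have dx: "(x has_real_derivative x' t) (at t)" for t
    unfolding x_def x'_def using \<phi>(1)[of t] by (auto intro!: derivative_eq_intros)
  have dy: "(y has_real_derivative y' t) (at t)" for t
    unfolding y_def y'_def using \<phi>(1)[of t] by (auto intro!: derivative_eq_intros)
  have nz: "(x t)\<^sup>2 + (y t)\<^sup>2 > 0" for t
  proof -
    have "cos (\<phi> t / 2) \<noteq> 0 \<or> sin (\<phi> t / 2) \<noteq> 0" 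
      by (metis sin_cos_squared_add zero_neq_one add_0 power_zero_numeral)
    then show ?thesis using ab by (auto simp: x_def y_def sum_power2_gt_zero_iff)
  qed
  have "a * C * (b * C * m) - b * S * (- a * S * m) = a * b * m" if "C\<^sup>2 + S\<^sup>2 = 1" for C S m :: real
    using that by algebra
  then have xy: "x t * y' t - y t * x' t = a * b * (p t / 2)" for t
    unfolding x_def y_def x'_def y'_def by (metis sin_cos_squared_add2)
  have d\<theta>: "(\<theta> has_real_derivative (x t * y' t - y t * x' t) / ((x t)\<^sup>2 + (y t)\<^sup>2)) (at t)" for t
    using \<theta>(1)[of t] unfolding xy by (simp add: x_def y_def power_mult_distrib)
  have pol: "\<exists>r>0. x t = r * cos (\<theta> t) \<and> y t = r * sin (\<theta> t)" for t
    using polar_lift[OF dx dy d\<theta> nz, of a t] ab \<theta>(2) \<phi>(2) by (auto simp: x_def y_def)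
  define d where "d = (\<lambda>t. \<theta> t - \<phi> t / 2)"
  have dpos: "cos (d t) > 0" for t
  proof -
    obtain r where r: "r > 0" "x t = r * cos (\<theta> t)" "y t = r * sin (\<theta> t)" using pol by blast
    have "r * cos (d t) = x t * cos (\<phi> t / 2) + y t * sin (\<phi> t / 2)"
      unfolding d_def cos_diff r by (simp add: algebra_simps)
    also have "\<dots> = a * (cos (\<phi> t / 2))\<^sup>2 + b * (sin (\<phi> t / 2))\<^sup>2"
      by (simp add: x_def y_def power2_eq_square)
    also have "\<dots> > 0"
    proof -
      have "min a b * 1 \<le> a * (cos (\<phi> t / 2))\<^sup>2 + b * (sin (\<phi> t / 2))\<^sup>2"
        unfolding sin_cos_squared_add2[of "\<phi> t / 2", symmetric] distrib_left
        by (intro add_mono mult_right_mono) auto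
      then show ?thesis using ab by linarith
    qed
    finally show ?thesis using r(1) by (simp add: zero_less_mult_iff)
  qed
  have "continuous_on UNIV d"
    unfolding d_def using continuous_on_UNIV_if_DERIV[OF \<phi>(1)] continuous_on_UNIV_if_DERIV[OF \<theta>(1)]
    by (intro continuous_intros) auto
  moreover have "d t \<noteq> - (pi / 2) \<and> d t \<noteq> pi / 2" for t
    using dpos[of t] by (metis cos_minus cos_pi_half less_irrefl)
  ultimately have bd: "- (pi / 2) < d T \<and> d T < pi / 2"
    by (intro continuous_avoids_stays[where D = d]) (auto simp: d_def \<theta>(2) \<phi>(2))
  have "sin (d T) = 0"
  proof -
    obtain r where r: "r > 0" "y T = r * sin (\<theta> T)" using pol by blast
    then have "sin (\<theta> T) = 0" by (simp add: y_def \<phi>(3))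
    then show ?thesis by (simp add: d_def \<phi>(3))
  qed
  moreover have "- pi < d T" "d T < pi" using bd pi_gt_zero by linarith+
  ultimately have "d T = 0" by (rule sin_eq_0_pi[rotated -1])
  then show ?thesis by (simp add: d_def \<phi>(3))
qed

lemma quasi_periodic_shift:
  fixes f :: "real \<Rightarrow> real"
  assumes "\<And>t. f (t + T) = f t + c"
  shows "f (t + of_int k * T) = f t + of_int k * c"
proof (induction k rule: int_induct[where k = 0])
  case (step1 i)
  then show ?case using assms[of "t + of_int i * T"] by (simp add: algebra_simps)
next
  case (step2 i)
  then show ?case using assms[of "t + of_int (i - 1) * T"] by (simp add: algebra_simps)
qed simp

text \<open>Shift by \<open>k\<close> periods starting at minus half of the way. The boundary
  conditions are imposed at \<open>n * T / 2\<close>, where \<open>n\<close> may be odd.\<close>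

lemma odd_quasi_periodic:
  fixes f :: "real \<Rightarrow> real"
  assumes "\<And>t. f (t + T) = f t + c" "\<And>t. f (- t) = - f t"
  shows "f (of_int k * T / 2) = of_int k * c / 2"
proof -
  have "- (of_int k * T / 2) + of_int k * T = of_int k * T / 2" by simp
  then show ?thesis
    using quasi_periodic_shift[of f T c "- (of_int k * T / 2)" k, OF assms(1)] assms(2)[of "of_int k * T / 2"]
    by (simp only:)
qed

text \<open>The curve \<open>sqrt p exp (i \<psi>)\<close> solves a real linear equation as soon as its angular momentum
  \<open>c\<close> is conserved.\<close>

lemma polar_solution:
  fixes p p' p'' \<psi> q :: "real \<Rightarrow> real"
  assumes p: "\<And>t. (p has_real_derivative p' t) (at t)" "\<And>t. (p' has_real_derivative p'' t) (at t)"
    and pos: "\<And>t. p t > 0"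
    and \<psi>: "\<And>t. (\<psi> has_real_derivative c / p t) (at t)"
    and q: "\<And>t. 2 * p t * p'' t - (p' t)\<^sup>2 - 4 * c\<^sup>2 = 4 * q t * (p t)\<^sup>2"
  defines "a \<equiv> \<lambda>t. p' t / (2 * p t)" and "b \<equiv> \<lambda>t. c / p t"
    and "x \<equiv> \<lambda>t. sqrt (p t) * cos (\<psi> t)" and "y \<equiv> \<lambda>t. sqrt (p t) * sin (\<psi> t)"
  shows "(x has_real_derivative a t * x t - b t * y t) (at t)"
    and "((\<lambda>t. a t * x t - b t * y t) has_real_derivative q t * x t) (at t)"
    and "(y has_real_derivative a t * y t + b t * x t) (at t)"
    and "((\<lambda>t. a t * y t + b t * x t) has_real_derivative q t * y t) (at t)"
proof -
  have s: "((\<lambda>t. sqrt (p t)) has_real_derivative a t * sqrt (p t)) (at t)" for t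
  proof -
    have "((\<lambda>t. sqrt (p t)) has_real_derivative inverse (sqrt (p t)) / 2 * p' t) (at t)"
      using DERIV_chain2[OF DERIV_real_sqrt p(1)] pos by blast
    moreover have "inverse (sqrt (p t)) / 2 * p' t = a t * sqrt (p t)"
    proof -
      have "p t = sqrt (p t) * sqrt (p t)" using pos[of t] by simp
      then have "p' t / (2 * p t) * sqrt (p t) = p' t / (2 * (sqrt (p t) * sqrt (p t))) * sqrt (p t)" by simp
      also have "\<dots> = inverse (sqrt (p t)) / 2 * p' t" using pos[of t] by (simp add: field_simps)
      finally show ?thesis by (simp add: a_def)
    qed
    ultimately show ?thesis by simp
  qed
  show x: "(x has_real_derivative a t * x t - b t * y t) (at t)" for t
    unfolding x_def y_def using DERIV_mult[OF s DERIV_chain2[OF DERIV_cos \<psi>], of t]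
    by (rule DERIV_cong) (simp add: b_def algebra_simps)
  show y: "(y has_real_derivative a t * y t + b t * x t) (at t)" for t
    unfolding x_def y_def using DERIV_mult[OF s DERIV_chain2[OF DERIV_sin \<psi>], of t]
    by (rule DERIV_cong) (simp add: b_def algebra_simps)
  \<comment> \<open>a + i b is the logarithmic derivative of x + i y, so the linear equation amounts
    to the Riccati equation (a + i b)' = q - (a + i b)^2. The hypothesis on \<open>q\<close> is its
    real part; conservation of \<open>c\<close> gives the imaginary part.\<close>
  have a: "(a has_real_derivative (q t - (a t)\<^sup>2 + (b t)\<^sup>2)) (at t)" for t
  proof -
    have n: "p t \<noteq> 0" using pos[of t] by simp
    have "(a has_real_derivative (p'' t * (2 * p t) - p' t * (2 * p' t)) / ((2 * p t) * (2 * p t))) (at t)"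
      unfolding a_def using DERIV_divide[OF p(2) DERIV_cmult[OF p(1), of 2]] n by auto
    moreover have "(p'' t * (2 * p t) - p' t * (2 * p' t)) / ((2 * p t) * (2 * p t)) = q t - (a t)\<^sup>2 + (b t)\<^sup>2"
    proof -
      have "p'' t * (2 * p t) - p' t * (2 * p' t) = 4 * q t * (p t)\<^sup>2 - (p' t)\<^sup>2 + 4 * c\<^sup>2"
        using q[of t] by (simp add: power2_eq_square algebra_simps)
      then show ?thesis using n by (simp add: a_def b_def field_simps power2_eq_square)
    qed
    ultimately show ?thesis by simp
  qed
  have b: "(b has_real_derivative - 2 * a t * b t) (at t)" for t
  proof -
    have n: "p t \<noteq> 0" using pos[of t] by simp
    have "(b has_real_derivative (0 * p t - c * p' t) / (p t * p t)) (at t)"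
      unfolding b_def using DERIV_divide[OF DERIV_const p(1)] n by blast
    then show ?thesis using n by (simp add: a_def b_def field_simps)
  qed
  show "((\<lambda>t. a t * x t - b t * y t) has_real_derivative q t * x t) (at t)"
    using DERIV_diff[OF DERIV_mult[OF a x] DERIV_mult[OF b y], of t]
    by (rule DERIV_cong) (simp add: power2_eq_square algebra_simps)
  show "((\<lambda>t. a t * y t + b t * x t) has_real_derivative q t * y t) (at t)"
    using DERIV_add[OF DERIV_mult[OF a y] DERIV_mult[OF b x], of t]
    by (rule DERIV_cong) (simp add: power2_eq_square algebra_simps)
qed

locale legendrian_profile =
  fixes J T :: real and \<gamma> \<theta>1 \<theta>2 :: "real \<Rightarrow> real"
  assumes J_pos: "0 < J" and J_less: "J < 1 / (3 * sqrt 3)"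
    and profile: "profile J \<gamma>" and period: "basic_period \<gamma> T" and phases: "phases J \<gamma> \<theta>1 \<theta>2"
begin

lemma J_square: "27 * J\<^sup>2 < 1"
proof -
  have "J * (3 * sqrt 3) < 1" using J_less by (simp add: field_simps)
  then have "(J * (3 * sqrt 3))\<^sup>2 < 1\<^sup>2" using J_pos by (intro power_strict_mono) auto
  then show ?thesis by (simp add: power_mult_distrib)
qed

lemma T_pos: "T > 0" and \<gamma>_period: "\<gamma> (t + T) = \<gamma> t"
  and T_least: "0 < S \<Longrightarrow> S < T \<Longrightarrow> \<not> (\<forall>t. \<gamma> (t + S) = \<gamma> t)"
  using period by (auto simp: basic_period_def)

lemma \<gamma>_min: "\<gamma> 0 \<le> \<gamma> t" and \<gamma>_not_const: "\<not> (\<forall>t. \<gamma> t = \<gamma> 0)"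
  using profile by (auto simp: profile_def constant_on_def)

lemma energy: "(deriv \<gamma> t)\<^sup>2 / 4 + J\<^sup>2 = 2 * \<gamma> t ^ 3 - (\<gamma> t)\<^sup>2 + 1 / 27"
  using profile by (simp add: profile_def)

lemma DERIV_iterated: "((deriv ^^ k) \<gamma> has_real_derivative (deriv ^^ Suc k) \<gamma> t) (at t)"
proof -
  have "(deriv ^^ k) \<gamma> differentiable (at t)"
    using profile by (simp add: profile_def differentiable_on_def)
  then show ?thesis by (simp add: DERIV_deriv_iff_real_differentiable)
qed

lemma DERIV_\<gamma>: "(\<gamma> has_real_derivative deriv \<gamma> t) (at t)"
  and DERIV_\<gamma>': "(deriv \<gamma> has_real_derivative deriv (deriv \<gamma>) t) (at t)"
  and DERIV_\<gamma>'': "(deriv (deriv \<gamma>) has_real_derivative deriv (deriv (deriv \<gamma>)) t) (at t)"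
  using DERIV_iterated[of 0 t] DERIV_iterated[of 1 t] DERIV_iterated[of 2 t] by (simp_all add: numeral_2_eq_2)

text \<open>Differentiating the energy identity only gives the equation where \<open>\<gamma>' \<noteq> 0\<close>. The bad set is
  open, and it is the closed set \<open>\<gamma>' = \<gamma>'' = 0\<close> because the energy polynomial has simple roots.\<close>

lemma \<gamma>_second: "deriv (deriv \<gamma>) t = 12 * (\<gamma> t)\<^sup>2 - 4 * \<gamma> t"
proof -
  define h where "h = (\<lambda>t. deriv (deriv \<gamma>) t - (12 * (\<gamma> t)\<^sup>2 - 4 * \<gamma> t))"
  define U where "U = {t. h t \<noteq> 0}"
  have c: "continuous_on UNIV \<gamma>" "continuous_on UNIV (deriv \<gamma>)" "continuous_on UNIV (deriv (deriv \<gamma>))"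
    by (rule continuous_on_UNIV_if_DERIV[OF DERIV_\<gamma>] continuous_on_UNIV_if_DERIV[OF DERIV_\<gamma>']
        continuous_on_UNIV_if_DERIV[OF DERIV_\<gamma>''])+
  have ch: "continuous_on UNIV h" unfolding h_def using c by (intro continuous_intros)
  have prod: "deriv \<gamma> t * h t = 0" for t
  proof -
    have "((\<lambda>t. (deriv \<gamma> t)\<^sup>2 / 4 + J\<^sup>2) has_real_derivative deriv \<gamma> t * deriv (deriv \<gamma>) t / 2) (at t)"
      using DERIV_\<gamma>'[of t] by (auto intro!: derivative_eq_intros)
    moreover have "((\<lambda>t. (deriv \<gamma> t)\<^sup>2 / 4 + J\<^sup>2) has_real_derivative (6 * (\<gamma> t)\<^sup>2 - 2 * \<gamma> t) * deriv \<gamma> t) (at t)"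
      unfolding energy using DERIV_\<gamma>[of t]
      by (auto intro!: derivative_eq_intros simp: algebra_simps)
    ultimately have "deriv \<gamma> t * deriv (deriv \<gamma>) t / 2 = (6 * (\<gamma> t)\<^sup>2 - 2 * \<gamma> t) * deriv \<gamma> t"
      by (rule DERIV_unique)
    then show ?thesis by (simp add: h_def algebra_simps)
  qed
  have openU: "open U"
    unfolding U_def using open_Collect_neq[OF ch continuous_on_const] by simp
  have U: "U = {t. deriv \<gamma> t = 0 \<and> deriv (deriv \<gamma>) t = 0}"
  proof (intro set_eqI iffI)
    fix t assume t: "t \<in> U"
    have z: "deriv \<gamma> s = 0" if "s \<in> U" for s using prod[of s] that by (simp add: U_def)
    have "(deriv \<gamma> has_real_derivative 0) (at t)"
      by (rule has_field_derivative_transform_within_open[OF DERIV_const openU t]) (simp add: z)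
    then have "deriv (deriv \<gamma>) t = 0" using DERIV_\<gamma>' DERIV_unique by blast
    then show "t \<in> {t. deriv \<gamma> t = 0 \<and> deriv (deriv \<gamma>) t = 0}" using z t by simp
  next
    fix t assume t: "t \<in> {t. deriv \<gamma> t = 0 \<and> deriv (deriv \<gamma>) t = 0}"
    then have e: "J\<^sup>2 = 2 * \<gamma> t ^ 3 - (\<gamma> t)\<^sup>2 + 1 / 27" using energy[of t] by simp
    have "\<gamma> t \<noteq> 0" using e J_square by auto
    moreover have "\<gamma> t \<noteq> 1 / 3"
    proof
      assume "\<gamma> t = 1 / 3"
      then have "J\<^sup>2 = 0" using e by (simp only:) (simp add: power_divide)
      then show False using J_pos by simp
    qed
    ultimately have "4 * \<gamma> t * (3 * \<gamma> t - 1) \<noteq> 0" by auto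
    then show "t \<in> U" using t by (simp add: U_def h_def algebra_simps power2_eq_square)
  qed
  have "closed U"
    unfolding U using c by (intro closed_Collect_conj closed_Collect_eq continuous_on_const)
  then have "U = {} \<or> U = UNIV" using openU clopen by blast
  moreover have "U \<noteq> UNIV"
  proof
    assume "U = UNIV"
    then have "deriv \<gamma> t = 0" for t using U by blast
    then have "(\<gamma> has_real_derivative 0) (at t)" for t using DERIV_\<gamma>[of t] by simp
    then show False using DERIV_zero_const \<gamma>_not_const by blast
  qed
  ultimately show ?thesis by (auto simp: U_def h_def)
qed

subsection \<open>The cubic\<close>

text \<open>The squared modulus of the second coordinate of u. Its complement 1 - w is twice the
  squared modulus of the first, and it will be the conformal factor.\<close>

definition w :: "real \<Rightarrow> real" where "w t = 1 / 3 + 2 * \<gamma> t"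
definition w' :: "real \<Rightarrow> real" where "w' t = 2 * deriv \<gamma> t"

lemma DERIV_w: "(w has_real_derivative w' t) (at t)"
  unfolding w_def w'_def using DERIV_\<gamma>[of t] by (auto intro!: derivative_eq_intros)

lemma DERIV_w': "(w' has_real_derivative 2 * (1 - w t) * (1 - 3 * w t)) (at t)"
proof -
  have "(w' has_real_derivative 2 * deriv (deriv \<gamma>) t) (at t)"
    unfolding w'_def using DERIV_\<gamma>'[of t] by (auto intro!: derivative_eq_intros)
  moreover have "2 * deriv (deriv \<gamma>) t = 2 * (1 - w t) * (1 - 3 * w t)"
    unfolding \<gamma>_second w_def by (simp add: power2_eq_square algebra_simps)
  ultimately show ?thesis by simp
qed

lemma w_energy: "(w' t)\<^sup>2 = 4 * w t * (1 - w t)\<^sup>2 - 16 * J\<^sup>2"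
proof -
  have "(w' t)\<^sup>2 = 16 * ((deriv \<gamma> t)\<^sup>2 / 4)" by (simp add: w'_def power2_eq_square)
  also have "(deriv \<gamma> t)\<^sup>2 / 4 = 2 * \<gamma> t ^ 3 - (\<gamma> t)\<^sup>2 + 1 / 27 - J\<^sup>2" using energy[of t] by simp
  also have "16 * \<dots> = 4 * w t * (1 - w t)\<^sup>2 - 16 * J\<^sup>2"
    by (simp add: w_def power2_eq_square power3_eq_cube algebra_simps)
  finally show ?thesis .
qed

text \<open>Putting w = 1 + m into w (1 - w)^2 = 4 J^2 gives this equation, so 1 + \<mu> is the
  largest root. The excluded ends 0 and 1/3 correspond to J = 0 and 27 J^2 = 1.\<close>

definition \<mu> :: real where "\<mu> = (SOME m. 0 < m \<and> m < 1 / 3 \<and> m\<^sup>2 * (1 + m) = 4 * J\<^sup>2)"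

lemma \<mu>: "0 < \<mu>" "\<mu> < 1 / 3" "\<mu>\<^sup>2 * (1 + \<mu>) = 4 * J\<^sup>2"
proof -
  have "\<exists>m. 0 \<le> m \<and> m \<le> 1 / 3 \<and> m\<^sup>2 * (1 + m) = 4 * J\<^sup>2"
    by (rule IVT') (use J_square in \<open>auto intro!: continuous_intros simp: power2_eq_square\<close>)
  then obtain m where m: "0 \<le> m" "m \<le> 1 / 3" "m\<^sup>2 * (1 + m) = 4 * J\<^sup>2" by blast
  moreover have "m \<noteq> 0" using m J_pos by auto
  moreover have "m \<noteq> 1 / 3"
  proof
    assume "m = 1 / 3"
    then have "4 / 27 = 4 * J\<^sup>2" using m(3) by (simp only:) (simp add: power2_eq_square)
    then show False using J_square by simp
  qed
  ultimately have "\<exists>m. 0 < m \<and> m < 1 / 3 \<and> m\<^sup>2 * (1 + m) = 4 * J\<^sup>2" by (auto simp: less_le)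
  from someI_ex[OF this] show "0 < \<mu>" "\<mu> < 1 / 3" "\<mu>\<^sup>2 * (1 + \<mu>) = 4 * J\<^sup>2" by (auto simp: \<mu>_def)
qed

text \<open>The roots of \<open>w (1 - w)\<^sup>2 - 4 J\<^sup>2\<close> are \<open>M - A < M + A < 1 + \<mu>\<close>.\<close>

definition M :: real where "M = (1 - \<mu>) / 2"
definition A :: real where "A = sqrt (M\<^sup>2 - \<mu>\<^sup>2)"

lemma A_square: "A\<^sup>2 = M\<^sup>2 - \<mu>\<^sup>2" and A_pos: "A > 0"
proof -
  have "\<mu> < M" using \<mu> by (simp add: M_def)
  then have "\<mu>\<^sup>2 < M\<^sup>2" using \<mu> by (intro power_strict_mono) auto
  then show "A\<^sup>2 = M\<^sup>2 - \<mu>\<^sup>2" "A > 0" by (auto simp: A_def)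
qed

lemma roots_pos: "0 < M - A"
proof -
  have "A\<^sup>2 < M\<^sup>2" using A_square \<mu> by simp
  then have "A < M" by (rule power_less_imp_less_base) (use \<mu> in \<open>simp add: M_def\<close>)
  then show ?thesis by simp
qed

lemma roots_less: "M + A < 1 + \<mu>" "M + A < 1"
proof -
  have "A < M" using roots_pos by simp
  moreover have "M < 1 / 2" using \<mu> by (simp add: M_def)
  ultimately show "M + A < 1" by linarith
  then show "M + A < 1 + \<mu>" using \<mu> by simp
qed

lemma w_factor: "(w' t)\<^sup>2 = 4 * ((1 + \<mu> - w t) * (A\<^sup>2 - (w t - M)\<^sup>2))"
proof -
  have "(w' t)\<^sup>2 = 4 * w t * (1 - w t)\<^sup>2 - 4 * (\<mu>\<^sup>2 * (1 + \<mu>))" using w_energy \<mu>(3) by simp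
  also have "\<dots> = 4 * ((1 + \<mu> - w t) * (A\<^sup>2 - (w t - M)\<^sup>2))"
    unfolding A_square by (simp add: M_def power2_eq_square algebra_simps)
  finally show ?thesis .
qed

lemma w_cont: "continuous_on UNIV w"
  by (rule continuous_on_UNIV_if_DERIV[OF DERIV_w])

lemma w'_0: "w' 0 = 0" "w' T = 0"
proof -
  have *: "w' s = 0" if "w s = w 0" for s
    by (rule DERIV_local_min[OF DERIV_w[of s], of 1]) (use \<gamma>_min that in \<open>auto simp: w_def\<close>)
  show "w' 0 = 0" by (rule *) simp
  show "w' T = 0" by (rule *) (use \<gamma>_period[of 0] in \<open>simp add: w_def\<close>)
qed

lemma w_alt: "M - A \<le> w t \<and> w t \<le> M + A \<or> 1 + \<mu> \<le> w t"
proof (rule ccontr)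
  assume n: "\<not> ?thesis"
  then have "A < \<bar>w t - M\<bar>" by auto
  then have "A\<^sup>2 < \<bar>w t - M\<bar>\<^sup>2" using A_pos by (intro power_strict_mono) auto
  then have "A\<^sup>2 - (w t - M)\<^sup>2 < 0" by simp
  moreover have "0 < 1 + \<mu> - w t" using n by auto
  ultimately have "(w' t)\<^sup>2 < 0" unfolding w_factor by (simp add: mult_pos_neg)
  then show False by (simp add: not_less[symmetric])
qed

lemma w_ge_0: "w 0 \<le> w t" using \<gamma>_min by (simp add: w_def)

text \<open>On the unbounded branch w > 1 the function is strictly convex, which contradicts the
  vanishing of \<open>w'\<close> at both 0 and \<open>T\<close>.\<close>

lemma w_0_le: "w 0 \<le> M + A"
proof (rule ccontr)
  assume "\<not> ?thesis"
  then have "1 + \<mu> \<le> w 0" using w_alt[of 0] by auto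
  then have g: "1 < w t" for t using w_ge_0[of t] \<mu>(1) by linarith
  have "w' 0 < w' T"
  proof (rule DERIV_pos_imp_increasing[OF T_pos])
    fix t
    have "0 < 2 * (1 - w t) * (1 - 3 * w t)" using g[of t] by (intro mult_neg_neg) auto
    then show "\<exists>y. (w' has_real_derivative y) (at t) \<and> 0 < y" using DERIV_w' by blast
  qed
  then show False using w'_0 by simp
qed

text \<open>The values of \<open>w\<close> form an interval that contains \<open>w 0\<close> and
  cannot enter the gap between the two larger roots.\<close>

lemma w_le: "w t \<le> M + A"
proof (rule ccontr)
  assume "\<not> ?thesis"
  then have t: "1 + \<mu> \<le> w t" using w_alt[of t] by auto
  define c where "c = (M + A + 1 + \<mu>) / 2"
  have c: "M + A < c" "c < 1 + \<mu>" using roots_less by (auto simp: c_def)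
  have "w 0 \<le> c" "c \<le> w t" using w_0_le c t by linarith+
  moreover have "connected (range w)" using w_cont connected_continuous_image by blast
  ultimately have "c \<in> range w" using connected_contains_Icc[of "range w" "w 0" "w t"] by auto
  then show False using w_alt c by (auto simp: not_le[symmetric]) 
qed

lemma w_ge: "M - A \<le> w t"
  using w_alt[of t] w_le[of t] roots_less by linarith

lemma w_0: "w 0 = M - A"
proof -
  have "(1 + \<mu> - w 0) * (A\<^sup>2 - (w 0 - M)\<^sup>2) = 0" using w_factor[of 0] w'_0 by simp
  moreover have "1 + \<mu> - w 0 \<noteq> 0" using w_le[of 0] roots_less by linarith
  ultimately have "(w 0 - M)\<^sup>2 = A\<^sup>2" by simp
  then have "w 0 - M = A \<or> w 0 - M = - A" by (simp add: power2_eq_iff)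
  moreover have "w 0 \<noteq> M + A"
  proof
    assume "w 0 = M + A"
    then have "w t = w 0" for t using w_ge_0[of t] w_le[of t] by simp
    then show False using \<gamma>_not_const by (simp add: w_def)
  qed
  ultimately show ?thesis by auto
qed

lemma w_pos: "0 < w t" and w_less_1: "w t < 1" and w_less_root: "w t < 1 + \<mu>"
  using w_ge[of t] w_le[of t] roots_pos roots_less by linarith+

subsection \<open>The angle of the orbit in the phase plane\<close>

text \<open>The factored energy reads w'^2 = speed^2 (A^2 - (w - M)^2): (M - w) / A is the cosine of
  an angle that moves with this speed. As the speed is positive, the angle passes smoothly through
  the turning points of \<open>w\<close>.\<close>

definition speed :: "real \<Rightarrow> real" where "speed t = 2 * sqrt (1 + \<mu> - w t)"
definition \<phi> :: "real \<Rightarrow> real" where "\<phi> = prim speed"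

lemma speed_pos: "speed t > 0" and speed_square: "(speed t)\<^sup>2 = 4 * (1 + \<mu> - w t)"
  using w_less_root[of t] by (auto simp: speed_def power_mult_distrib)

lemma DERIV_\<phi>: "(\<phi> has_real_derivative speed t) (at t)"
  unfolding \<phi>_def
  by (rule DERIV_prim) (auto simp: speed_def intro!: continuous_intros w_cont)

lemma \<phi>_0 [simp]: "\<phi> 0 = 0" by (simp add: \<phi>_def)

lemma DERIV_speed: "(speed has_real_derivative - 2 * w' t / speed t) (at t)"
proof -
  have "((\<lambda>t. sqrt (1 + \<mu> - w t)) has_real_derivative inverse (sqrt (1 + \<mu> - w t)) / 2 * (0 - w' t)) (at t)"
    using w_less_root[of t] by (intro DERIV_chain2[OF DERIV_real_sqrt DERIV_diff[OF DERIV_const DERIV_w]]) simp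
  from DERIV_cmult[OF this, of 2] show ?thesis
    unfolding speed_def by (rule DERIV_cong) (simp add: field_simps)
qed

text \<open>(C, S) obeys the same rotation equation C' = - S speed, S' = C speed as (cos \<phi>, sin
  \<phi>), so its components in the rotating frame are constant.\<close>

lemma w_cos: "w t = M - A * cos (\<phi> t)"
proof -
  define C where "C = (\<lambda>t. (M - w t) / A)"
  define S where "S = (\<lambda>t. w' t / (A * speed t))"
  have dC: "(C has_real_derivative - S t * speed t) (at t)" for t
  proof -
    have "(C has_real_derivative (0 - w' t) / A) (at t)"
      unfolding C_def by (intro DERIV_cdivide DERIV_diff DERIV_const DERIV_w)
    then show ?thesis using speed_pos[of t] by (simp add: S_def)
  qed
  have dS: "(S has_real_derivative C t * speed t) (at t)" for t
  proof -
    have n: "A * speed t \<noteq> 0" "speed t \<noteq> 0" "A \<noteq> 0" using A_pos speed_pos[of t] by auto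
    have "(S has_real_derivative (2 * (1 - w t) * (1 - 3 * w t) * (A * speed t) - w' t * (A * (- 2 * w' t / speed t)))
        / (A * speed t * (A * speed t))) (at t)"
      unfolding S_def by (rule DERIV_divide[OF DERIV_w' DERIV_cmult[OF DERIV_speed] n(1)])
    moreover have "(2 * (1 - w t) * (1 - 3 * w t) * (A * speed t) - w' t * (A * (- 2 * w' t / speed t)))
        / (A * speed t * (A * speed t)) = C t * speed t"
    proof -
      define s where "s = speed t"
      have e: "2 * (1 - w t) * (1 - 3 * w t) * s\<^sup>2 + 2 * (w' t)\<^sup>2 = (M - w t) * (s\<^sup>2 * s\<^sup>2)"
      proof -
        have "2 * (1 - w t) * (1 - 3 * w t) + 2 * (A\<^sup>2 - (w t - M)\<^sup>2) = (M - w t) * (4 * (1 + \<mu> - w t))"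
        proof -
          have "2 * M = 1 - \<mu>" by (simp add: M_def)
          then show ?thesis unfolding A_square by algebra
        qed
        then have "(2 * (1 - w t) * (1 - 3 * w t) + 2 * (A\<^sup>2 - (w t - M)\<^sup>2)) * s\<^sup>2 = (M - w t) * s\<^sup>2 * s\<^sup>2"
          unfolding s_def speed_square by simp
        moreover have "(w' t)\<^sup>2 = s\<^sup>2 * (A\<^sup>2 - (w t - M)\<^sup>2)"
          unfolding w_factor s_def speed_square by simp
        ultimately show ?thesis by (simp add: algebra_simps)
      qed
      have "2 * (1 - w t) * (1 - 3 * w t) * (A * s) - w' t * (A * (- 2 * w' t / s))
        = A * (2 * (1 - w t) * (1 - 3 * w t) * s\<^sup>2 + 2 * (w' t)\<^sup>2) / s"
        using n by (simp add: s_def power2_eq_square field_simps)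
      also have "\<dots> = A * ((M - w t) * (s\<^sup>2 * s\<^sup>2)) / s" unfolding e ..
      also have "\<dots> / (A * s * (A * s)) = C t * s"
        using n unfolding C_def s_def[symmetric] by (simp add: power2_eq_square)
      finally show ?thesis by (simp add: s_def)
    qed
    ultimately show ?thesis by simp
  qed
  have c: "((\<lambda>t. cos (\<phi> t)) has_real_derivative - sin (\<phi> t) * speed t) (at t)"
    and s: "((\<lambda>t. sin (\<phi> t)) has_real_derivative cos (\<phi> t) * speed t) (at t)" for t
    by (rule DERIV_chain2[OF DERIV_cos DERIV_\<phi>] DERIV_chain2[OF DERIV_sin DERIV_\<phi>])+
  have "((\<lambda>t. C t * cos (\<phi> t) + S t * sin (\<phi> t)) has_real_derivative 0) (at t)" for t
    using DERIV_add[OF DERIV_mult[OF dC c] DERIV_mult[OF dS s], of t] by (rule DERIV_cong) (simp add: algebra_simps)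
  from DERIV_zero_const[OF this, of t 0] have 1: "C t * cos (\<phi> t) + S t * sin (\<phi> t) = 1"
    using w_0 w'_0 A_pos by (simp add: C_def S_def)
  have "((\<lambda>t. S t * cos (\<phi> t) - C t * sin (\<phi> t)) has_real_derivative 0) (at t)" for t
    using DERIV_diff[OF DERIV_mult[OF dS c] DERIV_mult[OF dC s], of t] by (rule DERIV_cong) (simp add: algebra_simps)
  from DERIV_zero_const[OF this, of t 0] have 2: "S t * cos (\<phi> t) - C t * sin (\<phi> t) = 0"
    using w'_0 by (simp add: S_def)
  have "C t = cos (\<phi> t)" using 1 2 sin_cos_squared_add[of "\<phi> t"] by algebra
  then show ?thesis using A_pos by (simp add: C_def field_simps)
qed

lemma w'_sin: "w' t = A * speed t * sin (\<phi> t)"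
proof -
  have "((\<lambda>t. M - A * cos (\<phi> t)) has_real_derivative A * speed t * sin (\<phi> t)) (at t)"
    using DERIV_diff[OF DERIV_const DERIV_cmult[OF DERIV_chain2[OF DERIV_cos DERIV_\<phi>]], of M A t]
    by (rule DERIV_cong) simp
  moreover have "(\<lambda>t. M - A * cos (\<phi> t)) = w" using w_cos by auto
  ultimately show ?thesis using DERIV_w DERIV_unique by metis
qed

text \<open>Since \<open>\<phi>\<close> solves the autonomous equation \<open>\<phi>' = F \<phi>\<close>, its inverse is a primitive of \<open>1 / F\<close>.\<close>

definition F :: "real \<Rightarrow> real" where "F x = 2 * sqrt (1 + \<mu> - M + A * cos x)"
definition G :: "real \<Rightarrow> real" where "G = prim (\<lambda>x. 1 / F x)"

lemma F_\<phi>: "F (\<phi> t) = speed t"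
  unfolding F_def speed_def w_cos by (simp add: algebra_simps)

lemma F_pos: "F x > 0"
proof -
  have "- cos x \<le> 1" using cos_ge_minus_one[of x] by linarith
  then have "A * (- cos x) \<le> A * 1" using A_pos by (intro mult_left_mono) auto
  then have "0 < 1 + \<mu> - M + A * cos x" using roots_less by simp
  then show ?thesis by (simp add: F_def)
qed

lemma DERIV_G: "(G has_real_derivative 1 / F x) (at x)"
  unfolding G_def
proof (rule DERIV_prim)
  have "F x \<noteq> 0" for x using F_pos[of x] by simp
  then show "continuous_on UNIV (\<lambda>x. 1 / F x)"
    by (intro continuous_intros) (auto simp: F_def intro!: continuous_intros)
qed

lemma G_0 [simp]: "G 0 = 0" by (simp add: G_def)

lemma G_\<phi>: "G (\<phi> t) = t"
proof -
  have "((\<lambda>t. G (\<phi> t) - t) has_real_derivative 0) (at t)" for t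
    using DERIV_diff[OF DERIV_chain2[OF DERIV_G DERIV_\<phi>] DERIV_ident, of t] speed_pos[of t]
    by (simp add: F_\<phi>)
  from DERIV_zero_const[OF this, of t 0] show ?thesis by simp
qed

lemma G_strict_mono: "x < y \<Longrightarrow> G x < G y"
  by (rule DERIV_pos_imp_increasing) (use DERIV_G F_pos in force)+

lemma G_inj: "G x = G y \<longleftrightarrow> x = y"
  by (metis G_strict_mono less_irrefl linorder_neqE_linordered_idom)

lemma \<phi>_G: "\<phi> (G x) = x"
  using G_\<phi> G_inj by blast

lemma G_add: "G (x + 2 * pi) = G x + G (2 * pi)"
proof -
  have "((\<lambda>x. G (x + 2 * pi) - G x) has_real_derivative 0) (at x)" for x
  proof -
    have "((\<lambda>x. x + 2 * pi) has_real_derivative 1) (at x)" by (auto intro!: derivative_eq_intros)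
    from DERIV_diff[OF DERIV_chain2[OF DERIV_G this] DERIV_G[of x]] show ?thesis by (simp add: F_def)
  qed
  from DERIV_zero_const[OF this, of x 0] show ?thesis by simp
qed

lemma G_minus: "G (- x) = - G x"
proof -
  have "((\<lambda>x. G (- x) + G x) has_real_derivative 0) (at x)" for x
  proof -
    have "((\<lambda>x. - x) has_real_derivative - 1) (at x)" by (auto intro!: derivative_eq_intros)
    from DERIV_add[OF DERIV_chain2[where g = "\<lambda>x. - x", OF DERIV_G this] DERIV_G[of x]] show ?thesis by (simp add: F_def)
  qed
  from DERIV_zero_const[OF this, of x 0] show ?thesis by simp
qed

lemma \<phi>_strict_mono: "x < y \<Longrightarrow> \<phi> x < \<phi> y"
  by (rule DERIV_pos_imp_increasing) (use DERIV_\<phi> speed_pos in blast)+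

lemma \<phi>_add: "\<phi> (t + G (2 * pi)) = \<phi> t + 2 * pi"
  using G_add[of "\<phi> t"] by (metis G_\<phi> \<phi>_G)

lemma \<phi>_minus: "\<phi> (- t) = - \<phi> t"
  using G_minus[of "\<phi> t"] by (metis G_\<phi> \<phi>_G)

lemma w_minus: "w (- t) = w t"
  by (simp add: w_cos \<phi>_minus)

lemma w_eq_w_0: "w t = w 0 \<longleftrightarrow> (\<exists>k::int. \<phi> t = of_int k * (2 * pi))"
proof -
  have "w t = w 0 \<longleftrightarrow> cos (\<phi> t) = 1" using A_pos by (simp add: w_cos)
  then show ?thesis by (simp add: cos_one_2pi_int mult.assoc)
qed

lemma w_period: "w (t + T) = w t"
  using \<gamma>_period by (simp add: w_def)

text \<open>\<open>w\<close> takes its minimum only where \<phi> is a multiple of 2 \<pi>. If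
  \<open>\<phi> T\<close> were more than one full turn, the time of the first turn would be a
  smaller period.\<close>

lemma T_eq: "G (2 * pi) = T"
proof -
  obtain k :: int where k: "\<phi> T = of_int k * (2 * pi)"
    using w_eq_w_0[of T] w_period[of 0] by auto
  have "0 < \<phi> T" using \<phi>_strict_mono[OF T_pos] by simp
  then have "0 < k" using k by (simp add: zero_less_mult_iff)
  have "\<phi> (G (2 * pi)) = 2 * pi" by (rule \<phi>_G)
  have "k = 1"
  proof (rule ccontr)
    assume "k \<noteq> 1"
    then have "2 * pi < \<phi> T" using \<open>0 < k\<close> k by (simp add: mult_less_cancel_right)
    then have "G (2 * pi) < T" using G_strict_mono G_\<phi> by metis
    moreover have "0 < G (2 * pi)" using G_strict_mono[of 0 "2 * pi"] by simp
    moreover have "\<gamma> (t + G (2 * pi)) = \<gamma> t" for t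
    proof -
      have "w (t + G (2 * pi)) = w t" by (simp add: w_cos \<phi>_add)
      then show ?thesis by (simp add: w_def)
    qed
    ultimately show False using T_least by blast
  qed
  then show ?thesis using k G_\<phi>[of T] by simp
qed

lemma \<phi>_T: "\<phi> T = 2 * pi" using T_eq \<phi>_G by metis

lemma \<phi>_half: "\<phi> (of_int k * T / 2) = of_int k * pi"
  using odd_quasi_periodic[of \<phi> T "2 * pi" k] \<phi>_add \<phi>_minus T_eq by simp

lemma w_return: "w t = w 0 \<Longrightarrow> \<exists>k::int. t = of_int k * T"
proof -
  assume "w t = w 0"
  then obtain k :: int where "\<phi> t = of_int k * (2 * pi)" using w_eq_w_0 by auto
  then have "\<phi> t = \<phi> (of_int k * T)"
    using quasi_periodic_shift[of \<phi> T "2 * pi" 0 k] \<phi>_add T_eq by simp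
  then show ?thesis by (metis G_\<phi>)
qed

subsection \<open>The phases\<close>

lemma DERIV_\<theta>2: "(\<theta>2 has_real_derivative 2 * J / w t) (at t)"
  and DERIV_\<theta>1: "(\<theta>1 has_real_derivative - J / ((1 - w t) / 2)) (at t)"
  and \<theta>_0: "\<theta>1 0 = 0" "\<theta>2 0 = 0"
proof -
  have "(R2 \<gamma> t)\<^sup>2 = w t" "(R1 \<gamma> t)\<^sup>2 = (1 - w t) / 2"
    using w_pos[of t] w_less_1[of t] by (auto simp: R1_def R2_def w_def field_simps)
  then show "(\<theta>2 has_real_derivative 2 * J / w t) (at t)" "(\<theta>1 has_real_derivative - J / ((1 - w t) / 2)) (at t)"
    "\<theta>1 0 = 0" "\<theta>2 0 = 0"
    using phases unfolding phases_def by metis+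
qed

lemma \<theta>2_add: "\<theta>2 (t + T) = \<theta>2 t + \<theta>2 T"
proof -
  have "((\<lambda>t. \<theta>2 (t + T) - \<theta>2 t) has_real_derivative 0) (at t)" for t
  proof -
    have "((\<lambda>x. x + T) has_real_derivative 1) (at t)" by (auto intro!: derivative_eq_intros)
    from DERIV_diff[OF DERIV_chain2[OF DERIV_\<theta>2 this] DERIV_\<theta>2[of t]] show ?thesis by (simp add: w_period)
  qed
  from DERIV_zero_const[OF this, of t 0] show ?thesis by (simp add: \<theta>_0)
qed

lemma \<theta>2_minus: "\<theta>2 (- t) = - \<theta>2 t"
proof -
  have "((\<lambda>x. \<theta>2 (- x) + \<theta>2 x) has_real_derivative 0) (at x)" for x
  proof -
    have "((\<lambda>x. - x) has_real_derivative - 1) (at x)" by (auto intro!: derivative_eq_intros)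
    from DERIV_add[OF DERIV_chain2[where g = "\<lambda>x. - x", OF DERIV_\<theta>2 this] DERIV_\<theta>2[of x]]
    show ?thesis by (simp add: w_minus)
  qed
  from DERIV_zero_const[OF this, of t 0] show ?thesis by (simp add: \<theta>_0)
qed

lemma \<theta>2_half: "\<theta>2 (of_int k * T / 2) = of_int k * \<theta>2 T / 2"
  by (rule odd_quasi_periodic) (simp_all only: \<theta>2_add \<theta>2_minus)

lemma two_J: "2 * J = \<mu> * sqrt (1 + \<mu>)"
proof -
  have "(2 * J)\<^sup>2 = (\<mu> * sqrt (1 + \<mu>))\<^sup>2" using \<mu> by (simp add: power_mult_distrib)
  then show ?thesis by (rule power2_eq_imp_eq) (use J_pos \<mu> in auto)
qed

text \<open>Two comparison angles that advance by \<open>\<pi>\<close> over a period. The ratio \<open>\<theta>2 T / \<pi>\<close> is the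
  average of \<open>sqrt (w3 / (w3 - w))\<close>, \<open>w3 = 1 + \<mu>\<close>, against the first of them.\<close>

definition \<alpha> :: "real \<Rightarrow> real" where "\<alpha> = prim (\<lambda>t. \<mu> * (speed t / 2) / w t)"
definition \<kappa> :: real where "\<kappa> = sqrt (2 * \<mu> + 3 * \<mu>\<^sup>2)"
definition \<beta> :: "real \<Rightarrow> real" where "\<beta> = prim (\<lambda>t. \<kappa> * (speed t / 2) / (1 + \<mu> - w t))"

lemma speed_cont: "continuous_on UNIV speed"
  by (rule continuous_on_UNIV_if_DERIV[OF DERIV_speed])

lemma DERIV_\<alpha>: "(\<alpha> has_real_derivative \<mu> * (speed t / 2) / w t) (at t)"
  unfolding \<alpha>_def
proof (rule DERIV_prim)
  have "w t \<noteq> 0" for t using w_pos[of t] by simp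
  then show "continuous_on UNIV (\<lambda>t. \<mu> * (speed t / 2) / w t)"
    by (intro continuous_intros speed_cont w_cont) auto
qed

lemma DERIV_\<beta>: "(\<beta> has_real_derivative \<kappa> * (speed t / 2) / (1 + \<mu> - w t)) (at t)"
  unfolding \<beta>_def
proof (rule DERIV_prim)
  have "1 + \<mu> - w t \<noteq> 0" for t using w_less_root[of t] by simp
  then show "continuous_on UNIV (\<lambda>t. \<kappa> * (speed t / 2) / (1 + \<mu> - w t))"
    by (intro continuous_intros speed_cont w_cont) auto
qed

lemma w_half_angle: "w t = (M - A) * (cos (\<phi> t / 2))\<^sup>2 + (M + A) * (sin (\<phi> t / 2))\<^sup>2"
proof -
  have "cos (\<phi> t) = (cos (\<phi> t / 2))\<^sup>2 - (sin (\<phi> t / 2))\<^sup>2"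
    using cos_double[of "\<phi> t / 2"] by simp
  then have "w t = M * ((cos (\<phi> t / 2))\<^sup>2 + (sin (\<phi> t / 2))\<^sup>2) - A * ((cos (\<phi> t / 2))\<^sup>2 - (sin (\<phi> t / 2))\<^sup>2)"
    by (simp add: w_cos)
  then show ?thesis by (simp only: algebra_simps)
qed

text \<open>In half angles \<open>w\<close> is the squared radius of the ellipse whose squared
  semi-axes are the two smaller roots. The product of the semi-axes is \<mu> because M^2 - A^2 =
  \<mu>^2.\<close>

lemma \<alpha>_T: "\<alpha> T = pi"
proof (rule ellipse_angle[where T = T and \<theta> = \<alpha> and a = "sqrt (M - A)" and b = "sqrt (M + A)" and \<phi> = \<phi> and p = speed])
  show "0 < sqrt (M - A)" "0 < sqrt (M + A)" using roots_pos A_pos by auto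
  have "sqrt (M - A) * sqrt (M + A) = sqrt (M\<^sup>2 - A\<^sup>2)"
    by (simp add: real_sqrt_mult[symmetric] power2_eq_square algebra_simps)
  also have "\<dots> = \<mu>" using \<mu> by (simp add: A_square)
  finally show "(\<alpha> has_real_derivative sqrt (M - A) * sqrt (M + A) * (speed t / 2) /
      ((sqrt (M - A))\<^sup>2 * (cos (\<phi> t / 2))\<^sup>2 + (sqrt (M + A))\<^sup>2 * (sin (\<phi> t / 2))\<^sup>2)) (at t)" for t
    using DERIV_\<alpha>[of t] roots_pos A_pos w_half_angle[of t] by simp
qed (auto simp: DERIV_\<phi> \<phi>_T \<alpha>_def)

lemma \<kappa>_square: "\<kappa>\<^sup>2 = 2 * \<mu> + 3 * \<mu>\<^sup>2" and \<kappa>_pos: "\<kappa> > 0"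
  using \<mu> by (auto simp: \<kappa>_def add_pos_pos)

text \<open>The same with the ellipse for 1 + \<mu> - w: its squared semi-axes are the distances
  from the largest root to the other two, and \<kappa> is the product of the semi-axes.\<close>

lemma \<beta>_T: "\<beta> T = pi"
proof (rule ellipse_angle[where T = T and \<theta> = \<beta> and a = "sqrt (1 + \<mu> - (M - A))" and b = "sqrt (1 + \<mu> - (M + A))" and \<phi> = \<phi> and p = speed])
  show "0 < sqrt (1 + \<mu> - (M - A))" "0 < sqrt (1 + \<mu> - (M + A))" using roots_less A_pos by auto
  have "(1 + \<mu> - (M - A)) * (1 + \<mu> - (M + A)) = (1 + \<mu> - M)\<^sup>2 - A\<^sup>2"
    by (simp add: power2_eq_square algebra_simps)
  also have "\<dots> = 2 * \<mu> + 3 * \<mu>\<^sup>2"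
    unfolding A_square by (simp add: M_def power2_eq_square algebra_simps)
  finally have "sqrt (1 + \<mu> - (M - A)) * sqrt (1 + \<mu> - (M + A)) = \<kappa>"
    by (simp add: real_sqrt_mult[symmetric] \<kappa>_def)
  moreover have "1 + \<mu> - w t = (1 + \<mu> - (M - A)) * (cos (\<phi> t / 2))\<^sup>2 + (1 + \<mu> - (M + A)) * (sin (\<phi> t / 2))\<^sup>2" for t
  proof -
    have "1 + \<mu> - w t = (1 + \<mu>) * ((cos (\<phi> t / 2))\<^sup>2 + (sin (\<phi> t / 2))\<^sup>2) - w t" by simp
    then show ?thesis unfolding w_half_angle by (simp only: algebra_simps)
  qed
  moreover have "0 \<le> 1 + \<mu> - (M - A)" "0 \<le> 1 + \<mu> - (M + A)" using roots_less A_pos by linarith+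
  ultimately show "(\<beta> has_real_derivative sqrt (1 + \<mu> - (M - A)) * sqrt (1 + \<mu> - (M + A)) * (speed t / 2) /
      ((sqrt (1 + \<mu> - (M - A)))\<^sup>2 * (cos (\<phi> t / 2))\<^sup>2 + (sqrt (1 + \<mu> - (M + A)))\<^sup>2 * (sin (\<phi> t / 2))\<^sup>2)) (at t)" for t
    using DERIV_\<beta>[of t] by simp
qed (auto simp: DERIV_\<phi> \<phi>_T \<beta>_def)

text \<open>The quotient of the derivatives of \<open>\<theta>2\<close> and \<alpha> is sqrt (w3 /
  (w3 - w)) with w3 = 1 + \<mu>, and this exceeds 1 as w > 0.\<close>

lemma \<theta>2_T_lower: "pi < \<theta>2 T"
proof -
  have "(\<lambda>t. \<theta>2 t - \<alpha> t) 0 < (\<lambda>t. \<theta>2 t - \<alpha> t) T"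
  proof (rule DERIV_pos_imp_increasing[OF T_pos])
    fix t
    have "speed t / 2 < sqrt (1 + \<mu>)" using w_pos[of t] by (simp add: speed_def)
    then have "\<mu> * (speed t / 2) / w t < 2 * J / w t"
      unfolding two_J using \<mu> w_pos[of t] by (intro divide_strict_right_mono mult_strict_left_mono)
    then show "\<exists>y. ((\<lambda>t. \<theta>2 t - \<alpha> t) has_real_derivative y) (at t) \<and> 0 < y"
      using DERIV_diff[OF DERIV_\<theta>2 DERIV_\<alpha>, of t] by (intro exI conjI) auto
  qed
  then show ?thesis by (simp add: \<theta>_0 \<alpha>_T) (simp add: \<alpha>_def)
qed

text \<open>With X = w3 / (w3 - w) = 1 + w / (w3 - w), the average of X against \<alpha> is 1 +
  \<mu> / \<kappa>, so this says that it is at most 4/3. Squared, the claim is 6 \<mu>^2 \<le> 2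
  \<mu>, that is \<mu> \<le> 1/3.\<close>

lemma \<mu>_\<kappa>: "\<mu> / \<kappa> \<le> 1 / 3"
proof -
  have "(3 * \<mu>)\<^sup>2 \<le> \<kappa>\<^sup>2"
  proof -
    have "6 * (\<mu> * \<mu>) \<le> 2 * \<mu>" using \<mu> by simp
    then show ?thesis unfolding \<kappa>_square by (simp add: power2_eq_square)
  qed
  then have "3 * \<mu> \<le> \<kappa>" by (rule power2_le_imp_le) (use \<kappa>_pos in simp)
  then show ?thesis using \<kappa>_pos by (simp add: divide_le_eq)
qed

text \<open>AM-GM replaces the square root by \<open>(5/6 X + 6/5) / 2\<close>, whose average is explicit; \<open>6/5\<close> is a
  rational close to the optimal weight \<open>2 / sqrt 3\<close>.\<close>

lemma \<theta>2_T_upper: "\<theta>2 T < 6 / 5 * pi"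
proof -
  \<comment> \<open>The derivative of \<open>\<alpha> + \<mu> / \<kappa> * \<beta>\<close> is X
    times that of \<alpha>, where X = w3 / (w3 - w). Hence D' is the derivative of \<alpha> times
    the AM-GM gap.\<close>
  define D where "D = (\<lambda>t. 1 / 2 * (5 / 6 * (\<alpha> t + \<mu> / \<kappa> * \<beta> t) + 6 / 5 * \<alpha> t) - \<theta>2 t)"
  define D' where "D' = (\<lambda>t. 1 / 2 * (5 / 6 * (\<mu> * (speed t / 2) / w t + \<mu> / \<kappa> * (\<kappa> * (speed t / 2) / (1 + \<mu> - w t)))
      + 6 / 5 * (\<mu> * (speed t / 2) / w t)) - 2 * J / w t)"
  have D: "(D has_real_derivative D' t) (at t)" for t
    unfolding D_def D'_def using DERIV_\<alpha> DERIV_\<beta> DERIV_\<theta>2 by (intro DERIV_diff DERIV_add DERIV_cmult)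
  have D'_nonneg: "0 \<le> D' t" for t
  proof -
    define s where "s = speed t / 2"
    have s: "s > 0" "s\<^sup>2 = 1 + \<mu> - w t" using speed_pos[of t] speed_square[of t] by (auto simp: s_def power_divide)
    have w: "w t > 0" "w t = 1 + \<mu> - s\<^sup>2" using w_pos[of t] s by auto
    have "D' t = \<mu> / w t * (1 / 2 * (5 / 6 * (s + w t / s) + 6 / 5 * s) - sqrt (1 + \<mu>))"
    proof -
      have "\<mu> / \<kappa> * (\<kappa> * s / (1 + \<mu> - w t)) = \<mu> / w t * (w t / s)"
        unfolding s(2)[symmetric] using \<kappa>_pos s(1) w(1) by (simp add: power2_eq_square)
      then have "D' t = 1 / 2 * (5 / 6 * (\<mu> / w t * s + \<mu> / w t * (w t / s)) + 6 / 5 * (\<mu> / w t * s)) - \<mu> / w t * sqrt (1 + \<mu>)"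
        unfolding D'_def two_J s_def[symmetric] by (simp only: times_divide_eq_left)
      moreover have "1 / 2 * (5 / 6 * (m * s + m * X) + 6 / 5 * (m * s)) - m * r = m * (1 / 2 * (5 / 6 * (s + X) + 6 / 5 * s) - r)"
        for m X r :: real by (simp add: field_simps)
      ultimately show ?thesis by metis
    qed
    moreover have "s + w t / s = (1 + \<mu>) / s"
      using s(1) w(2) by (simp add: power2_eq_square field_simps)
    moreover have "sqrt (1 + \<mu>) \<le> 1 / 2 * (5 / 6 * ((1 + \<mu>) / s) + 6 / 5 * s)"
    proof -
      have "sqrt (5 / 6 * ((1 + \<mu>) / s) * (6 / 5 * s)) \<le> (5 / 6 * ((1 + \<mu>) / s) + 6 / 5 * s) / 2"
        by (rule arith_geo_mean_sqrt) (use s \<mu> in auto)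
      moreover have "5 / 6 * ((1 + \<mu>) / s) * (6 / 5 * s) = 1 + \<mu>" using s(1) by (simp add: field_simps)
      ultimately show ?thesis by (simp only: times_divide_eq_left mult_1)
    qed
    ultimately show ?thesis using \<mu> w(1) by simp
  qed
  have "D 0 \<le> D T"
    by (rule DERIV_nonneg_imp_nondecreasing) (use T_pos D D'_nonneg in \<open>auto intro: less_imp_le\<close>)
  moreover have "D 0 = 0" by (simp add: D_def \<alpha>_def \<beta>_def \<theta>_0)
  ultimately have "\<theta>2 T \<le> 1 / 2 * (5 / 6 * (pi + \<mu> / \<kappa> * pi) + 6 / 5 * pi)"
    by (simp add: D_def \<alpha>_T \<beta>_T)
  also have "\<mu> / \<kappa> * pi \<le> 1 / 3 * pi" using \<mu>_\<kappa> by (intro mult_right_mono) auto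
  \<comment> \<open>The left side is 52/45 \<pi>.\<close>
  also have "1 / 2 * (5 / 6 * (pi + 1 / 3 * pi) + 6 / 5 * pi) < 6 / 5 * pi" using pi_gt_zero by simp
  finally show ?thesis by simp
qed

end

section \<open>The Laplacian of the immersion\<close>

lemma has_vector_derivative_vec:
  fixes f :: "real \<Rightarrow> complex^3"
  assumes "\<And>k. ((\<lambda>h. f h $ k) has_vector_derivative D $ k) (at x)"
  shows "(f has_vector_derivative D) (at x)"
proof -
  have bl: "bounded_linear (axis k :: complex \<Rightarrow> complex^3)" for k
    by (intro linear_conv_bounded_linear[THEN iffD1] linearI) (auto simp: vec_eq_iff axis_def)
  have e: "v = (\<Sum>k\<in>UNIV. axis k (v $ k))" for v :: "complex^3"
    by (simp add: vec_eq_iff sum_3 forall_3 axis_def)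
  have "((\<lambda>h. \<Sum>k\<in>UNIV. axis k (f h $ k)) has_vector_derivative (\<Sum>k\<in>UNIV. axis k (D $ k))) (at x)"
    by (intro has_vector_derivative_sum bounded_linear.has_vector_derivative[OF bl] assms)
  then show ?thesis using e by simp
qed

lemma mat_matrix_mult: "(mat r :: real^2^2) ** B = r *\<^sub>R B"
  by (simp add: vec_eq_iff forall_2 matrix_matrix_mult_def sum_2 mat_def)

lemma matrix_inv_scalar:
  assumes "r \<noteq> 0"
  shows "matrix_inv (mat r :: real^2^2) = mat (1 / r)"
proof -
  have ex: "\<exists>B. (mat r :: real^2^2) ** B = mat 1 \<and> B ** mat r = mat 1"
    using assms by (intro exI[of _ "mat (1 / r)"]) (simp only: mat_matrix_mult, auto simp: vec_eq_iff mat_def)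
  have "mat r ** matrix_inv (mat r :: real^2^2) = mat 1"
    unfolding matrix_inv_def using someI_ex[OF ex] by blast
  then have "r *\<^sub>R matrix_inv (mat r :: real^2^2) = mat 1" by (simp only: mat_matrix_mult)
  moreover have "matrix_inv (mat r :: real^2^2) = (1 / r) *\<^sub>R (r *\<^sub>R matrix_inv (mat r :: real^2^2))"
    using assms by simp
  ultimately have "matrix_inv (mat r :: real^2^2) = (1 / r) *\<^sub>R mat 1" by (simp only:)
  also have "\<dots> = mat (1 / r)" by (simp add: vec_eq_iff mat_def)
  finally show ?thesis .
qed

lemma pd_separated:
  fixes c g :: "real \<Rightarrow> real"
  assumes "(c has_real_derivative c') (at (p $ 1))" "(g has_real_derivative g') (at (p $ 2))"
  shows "pd 1 (\<lambda>q. c (q $ 1) * g (q $ 2)) p = c' * g (p $ 2)"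
    and "pd 2 (\<lambda>q. c (q $ 1) * g (q $ 2)) p = c (p $ 1) * g'"
proof -
  have c: "((\<lambda>h. c (p $ 1 + h)) has_real_derivative c') (at 0)"
    and g: "((\<lambda>h. g (p $ 2 + h)) has_real_derivative g') (at 0)"
    using assms DERIV_shift[of c c' 0 "p $ 1"] DERIV_shift[of g g' 0 "p $ 2"] by (simp_all add: add.commute)
  have "((\<lambda>h. c (p $ 1 + h) * g (p $ 2)) has_real_derivative c' * g (p $ 2)) (at 0)"
    using DERIV_cmult_right[OF c] by blast
  then have "((\<lambda>h. c (p $ 1 + h) * g (p $ 2)) has_vector_derivative c' * g (p $ 2)) (at 0)"
    by (simp add: has_real_derivative_iff_has_vector_derivative)
  then show "pd 1 (\<lambda>q. c (q $ 1) * g (q $ 2)) p = c' * g (p $ 2)"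
    unfolding pd_def by (simp add: axis_def vector_derivative_at)
  have "((\<lambda>h. c (p $ 1) * g (p $ 2 + h)) has_real_derivative c (p $ 1) * g') (at 0)"
    using DERIV_cmult[OF g] by blast
  then have "((\<lambda>h. c (p $ 1) * g (p $ 2 + h)) has_vector_derivative c (p $ 1) * g') (at 0)"
    by (simp add: has_real_derivative_iff_has_vector_derivative)
  then show "pd 2 (\<lambda>q. c (q $ 1) * g (q $ 2)) p = c (p $ 1) * g'"
    unfolding pd_def by (simp add: axis_def vector_derivative_at)
qed

lemma differentiable_separated:
  fixes c g :: "real \<Rightarrow> real"
  assumes "\<And>t. (c has_real_derivative c' t) (at t)" "\<And>t. (g has_real_derivative g' t) (at t)"
  shows "(\<lambda>q::real^2. c (q $ 1) * g (q $ 2)) differentiable_on UNIV"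
proof -
  have "(\<lambda>q::real^2. h (q $ i)) differentiable (at q)"
    if "\<And>t. (h has_real_derivative h' t) (at t)" for h h' :: "real \<Rightarrow> real" and q :: "real^2" and i
    by (rule differentiableI, rule DERIV_compose_FDERIV[OF that])
      (rule bounded_linear_imp_has_derivative, rule bounded_linear_vec_nth)
  then show ?thesis using assms by (auto simp: differentiable_on_def intro!: differentiable_mult)
qed

text \<open>In dimension two the factor sqrt (det g) cancels against the inverse metric, so the
  conformal factor survives only in the outer denominator.\<close>

lemma laplacian_conformal:
  assumes "\<And>p. induced_metric u p = mat (r p)" and pos: "\<And>p. r p > 0"
  shows "laplacian u f p = - (pd 1 (pd 1 f) p + pd 2 (pd 2 f) p) / r p"
proof -
  have d: "sqrt (det (induced_metric u q)) = r q" for q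
    using pos[of q] by (simp add: assms(1) det_2 mat_def)
  have i: "matrix_inv (induced_metric u q) = mat (1 / r q)" for q
    unfolding assms(1) by (rule matrix_inv_scalar) (use pos[of q] in simp)
  have "(\<lambda>q. r q * (\<Sum>j\<in>UNIV. (mat (1 / r q) :: real^2^2) $ k $ j * pd j f q)) = pd k f" for k
  proof
    fix q
    have n: "r q \<noteq> 0" using pos[of q] by simp
    have "k = 1 \<or> k = 2" using exhaust_2 by blast
    then show "r q * (\<Sum>j\<in>UNIV. (mat (1 / r q) :: real^2^2) $ k $ j * pd j f q) = pd k f q"
      using n by (auto simp: sum_2 mat_def)
  qed
  then show ?thesis unfolding laplacian_def d i by (simp add: sum_2)
qed

lemma inner_complex_mult: "inner (x * z) (y * z :: complex) = inner x y * (norm z)\<^sup>2"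
  unfolding inner_complex_def cmod_power2 by (simp add: power2_eq_square algebra_simps)

context legendrian_profile
begin

definition \<rho> :: "real \<Rightarrow> real" where "\<rho> t = 1 - w t"

lemma \<rho>_pos: "\<rho> t > 0" using w_less_1[of t] by (simp add: \<rho>_def)

definition U :: "real^2 \<Rightarrow> complex^3" where "U = u0 \<gamma> \<theta>1 \<theta>2"

lemma R1_eq: "R1 \<gamma> t = sqrt (\<rho> t / 2)" and R2_eq: "R2 \<gamma> t = sqrt (w t)"
  by (simp_all add: R1_def R2_def \<rho>_def w_def)

definition z1 :: "real \<Rightarrow> complex" where "z1 t = of_real (sqrt (\<rho> t / 2)) * cis (\<theta>1 t)"
definition z2 :: "real \<Rightarrow> complex" where "z2 t = of_real (sqrt (w t)) * cis (\<theta>2 t)"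

lemma U_nth: "U p $ 1 = cis (p $ 1) * z1 (p $ 2)" "U p $ 2 = z2 (p $ 2)" "U p $ 3 = cis (- (p $ 1)) * z1 (p $ 2)"
  by (simp_all add: U_def u0_def R1_eq R2_eq z1_def z2_def)

lemma norm_z: "(norm (z1 t))\<^sup>2 = \<rho> t / 2" "(norm (z2 t))\<^sup>2 = w t"
  using \<rho>_pos[of t] w_pos[of t] by (auto simp: z1_def z2_def norm_mult)

lemma DERIV_\<rho>: "(\<rho> has_real_derivative - w' t) (at t)"
  unfolding \<rho>_def using DERIV_diff[OF DERIV_const DERIV_w, of 1 t] by simp

text \<open>\<open>polar_solution\<close> for the squared modulus \<rho>/2 with angular momentum -
  J. The result is the separated equation for k = 1 and eigenvalue 2.\<close>

lemma polar1:
  defines "a \<equiv> \<lambda>t. - w' t / 2 / (2 * (\<rho> t / 2))" and "b \<equiv> \<lambda>t. - J / (\<rho> t / 2)"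
    and "x \<equiv> \<lambda>t. sqrt (\<rho> t / 2) * cos (\<theta>1 t)" and "y \<equiv> \<lambda>t. sqrt (\<rho> t / 2) * sin (\<theta>1 t)"
  shows "(x has_real_derivative a t * x t - b t * y t) (at t)"
    and "((\<lambda>t. a t * x t - b t * y t) has_real_derivative (1 - 2 * \<rho> t) * x t) (at t)"
    and "(y has_real_derivative a t * y t + b t * x t) (at t)"
    and "((\<lambda>t. a t * y t + b t * x t) has_real_derivative (1 - 2 * \<rho> t) * y t) (at t)"
proof -
  have 1: "((\<lambda>t. \<rho> t / 2) has_real_derivative - w' t / 2) (at t)" for t
    by (rule DERIV_cdivide[OF DERIV_\<rho>])
  have 2: "((\<lambda>t. - w' t / 2) has_real_derivative - (2 * (1 - w t) * (1 - 3 * w t)) / 2) (at t)" for t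
    by (rule DERIV_cdivide[OF DERIV_minus[OF DERIV_w']])
  have 3: "0 < \<rho> t / 2" for t using \<rho>_pos[of t] by simp
  have 4: "(\<theta>1 has_real_derivative - J / (\<rho> t / 2)) (at t)" for t
    using DERIV_\<theta>1 by (simp add: \<rho>_def)
  have 5: "2 * (\<rho> t / 2) * (- (2 * (1 - w t) * (1 - 3 * w t)) / 2) - (- w' t / 2)\<^sup>2 - 4 * (- J)\<^sup>2
      = 4 * (1 - 2 * \<rho> t) * (\<rho> t / 2)\<^sup>2" for t
  proof -
    have "(- w' t / 2)\<^sup>2 = w t * (1 - w t)\<^sup>2 - 4 * J\<^sup>2" using w_energy[of t] by (simp add: power_divide)
    then show ?thesis unfolding \<rho>_def by (simp only:) (simp add: power2_eq_square field_simps)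
  qed
  note p = polar_solution[OF 1 2 3 4 5]
  show "(x has_real_derivative a t * x t - b t * y t) (at t)"
    "((\<lambda>t. a t * x t - b t * y t) has_real_derivative (1 - 2 * \<rho> t) * x t) (at t)"
    "(y has_real_derivative a t * y t + b t * x t) (at t)"
    "((\<lambda>t. a t * y t + b t * x t) has_real_derivative (1 - 2 * \<rho> t) * y t) (at t)"
    unfolding x_def y_def a_def b_def by (rule p)+
qed

text \<open>The squared modulus is \<open>w\<close> and the angular momentum is 2 J; the separated
  equation has k = 0 and eigenvalue 2.\<close>

lemma polar2:
  defines "a \<equiv> \<lambda>t. w' t / (2 * w t)" and "b \<equiv> \<lambda>t. 2 * J / w t"
    and "x \<equiv> \<lambda>t. sqrt (w t) * cos (\<theta>2 t)" and "y \<equiv> \<lambda>t. sqrt (w t) * sin (\<theta>2 t)"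
  shows "(x has_real_derivative a t * x t - b t * y t) (at t)"
    and "((\<lambda>t. a t * x t - b t * y t) has_real_derivative (- 2 * \<rho> t) * x t) (at t)"
    and "(y has_real_derivative a t * y t + b t * x t) (at t)"
    and "((\<lambda>t. a t * y t + b t * x t) has_real_derivative (- 2 * \<rho> t) * y t) (at t)"
proof -
  have 5: "2 * w t * (2 * (1 - w t) * (1 - 3 * w t)) - (w' t)\<^sup>2 - 4 * (2 * J)\<^sup>2 = 4 * (- 2 * \<rho> t) * (w t)\<^sup>2" for t
    unfolding w_energy by (simp add: \<rho>_def power2_eq_square algebra_simps)
  note p = polar_solution[OF DERIV_w DERIV_w' w_pos DERIV_\<theta>2 5]
  show "(x has_real_derivative a t * x t - b t * y t) (at t)"
    "((\<lambda>t. a t * x t - b t * y t) has_real_derivative (- 2 * \<rho> t) * x t) (at t)"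
    "(y has_real_derivative a t * y t + b t * x t) (at t)"
    "((\<lambda>t. a t * y t + b t * x t) has_real_derivative (- 2 * \<rho> t) * y t) (at t)"
    unfolding x_def y_def a_def b_def by (rule p)+
qed

text \<open>The product of z1 with the conjugate of z2 has squared modulus w \<rho> / 2 and again a
  conserved angular momentum: it is - J w - J \<rho> = - J because w + \<rho> = 1. The resulting
  equation is the case k = 1 of eigenvalue 6.\<close>

lemma polar3:
  defines "p \<equiv> \<lambda>t. w t * \<rho> t / 2" and "p' \<equiv> \<lambda>t. w' t * (1 - 2 * w t) / 2"
  defines "a \<equiv> \<lambda>t. p' t / (2 * p t)" and "b \<equiv> \<lambda>t. - J / p t"
    and "x \<equiv> \<lambda>t. sqrt (p t) * cos (\<theta>1 t - \<theta>2 t)" and "y \<equiv> \<lambda>t. sqrt (p t) * sin (\<theta>1 t - \<theta>2 t)"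
  shows "(x has_real_derivative a t * x t - b t * y t) (at t)"
    and "((\<lambda>t. a t * x t - b t * y t) has_real_derivative (1 - 6 * \<rho> t) * x t) (at t)"
    and "(y has_real_derivative a t * y t + b t * x t) (at t)"
    and "((\<lambda>t. a t * y t + b t * x t) has_real_derivative (1 - 6 * \<rho> t) * y t) (at t)"
proof -
  define p'' where "p'' = (\<lambda>t. ((2 * (1 - w t) * (1 - 3 * w t)) * (1 - 2 * w t) - 2 * (w' t)\<^sup>2) / 2)"
  have 1: "(p has_real_derivative p' t) (at t)" for t
    unfolding p_def p'_def using DERIV_cdivide[OF DERIV_mult[OF DERIV_w[of t] DERIV_\<rho>[of t]], of 2]
    by (rule DERIV_cong) (simp add: \<rho>_def algebra_simps)
  have 2: "(p' has_real_derivative p'' t) (at t)" for t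
    unfolding p'_def p''_def
    using DERIV_cdivide[OF DERIV_mult[OF DERIV_w'[of t] DERIV_diff[OF DERIV_const DERIV_cmult[OF DERIV_w[of t], of 2], of 1]], of 2]
    by (rule DERIV_cong) (simp add: power2_eq_square algebra_simps)
  have 3: "0 < p t" for t using \<rho>_pos[of t] w_pos[of t] by (simp add: p_def)
  have 4: "((\<lambda>t. \<theta>1 t - \<theta>2 t) has_real_derivative - J / p t) (at t)" for t
  proof -
    have "(1 - w t) * w t \<noteq> 0" using \<rho>_pos[of t] w_pos[of t] by (simp add: \<rho>_def)
    then have "- J / ((1 - w t) / 2) - 2 * J / w t = - J / p t"
      by (simp add: p_def \<rho>_def field_simps)
    then show ?thesis using DERIV_diff[OF DERIV_\<theta>1 DERIV_\<theta>2, of t] by simp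
  qed
  have 5: "2 * p t * p'' t - (p' t)\<^sup>2 - 4 * (- J)\<^sup>2 = 4 * (1 - 6 * \<rho> t) * (p t)\<^sup>2" for t
  proof -
    have e: "w' t * w' t = 4 * w t * ((1 - w t) * (1 - w t)) - 16 * (J * J)"
      using w_energy[of t] by (simp add: power2_eq_square)
    show ?thesis
      using e by (simp add: p_def p'_def p''_def \<rho>_def power2_eq_square field_simps)
  qed
  note s = polar_solution[OF 1 2 3 4 5]
  show "(x has_real_derivative a t * x t - b t * y t) (at t)"
    "((\<lambda>t. a t * x t - b t * y t) has_real_derivative (1 - 6 * \<rho> t) * x t) (at t)"
    "(y has_real_derivative a t * y t + b t * x t) (at t)"
    "((\<lambda>t. a t * y t + b t * x t) has_real_derivative (1 - 6 * \<rho> t) * y t) (at t)"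
    unfolding x_def y_def a_def b_def by (rule s)+
qed

lemma polar_vector_derivative:
  fixes r :: "real \<Rightarrow> real"
  assumes "((\<lambda>t. r t * cos (\<psi> t)) has_real_derivative a * (r t * cos (\<psi> t)) - b * (r t * sin (\<psi> t))) (at t)"
    and "((\<lambda>t. r t * sin (\<psi> t)) has_real_derivative a * (r t * sin (\<psi> t)) + b * (r t * cos (\<psi> t))) (at t)"
  shows "((\<lambda>t. of_real (r t) * cis (\<psi> t)) has_vector_derivative Complex a b * (of_real (r t) * cis (\<psi> t))) (at t)"
  using assms by (simp add: has_vector_derivative_complex_iff has_real_derivative_iff_has_vector_derivative algebra_simps)

lemma DERIV_z1: "(z1 has_vector_derivative Complex (- w' t / 2 / (2 * (\<rho> t / 2))) (- J / (\<rho> t / 2)) * z1 t) (at t)"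
  unfolding z1_def by (rule polar_vector_derivative[OF polar1(1,3)])

lemma DERIV_z2: "(z2 has_vector_derivative Complex (w' t / (2 * w t)) (2 * J / w t) * z2 t) (at t)"
  unfolding z2_def by (rule polar_vector_derivative[OF polar2(1,3)])

text \<open>The energy identity w'^2 + 16 J^2 = 4 w \<rho>^2 makes the squared length of the
  t-derivative w \<rho> + \<rho>^2 = \<rho>. The mixed term cancels because the first and third
  coordinates rotate in opposite directions with s but have the same logarithmic derivative in
  t.\<close>

lemma induced_metric_U: "induced_metric U p = mat (\<rho> (p $ 2))"
proof -
  define s where "s = p $ 1"
  define t where "t = p $ 2"
  define d1 where "d1 = Complex (- w' t / 2 / (2 * (\<rho> t / 2))) (- J / (\<rho> t / 2))"
  define d2 where "d2 = Complex (w' t / (2 * w t)) (2 * J / w t)"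
  have sh: "((\<lambda>h. z (t + h)) has_vector_derivative z') (at 0)"
    if "(z has_vector_derivative z') (at t)" for z :: "real \<Rightarrow> complex" and z'
  proof -
    have "((\<lambda>h. t + h) has_vector_derivative 1) (at 0)"
      unfolding has_real_derivative_iff_has_vector_derivative[symmetric] by (auto intro!: derivative_eq_intros)
    from vector_diff_chain_at[OF this, of z z'] that show ?thesis by (simp add: o_def)
  qed
  have ci: "((\<lambda>h. cis (e * (s + h)) * z) has_vector_derivative Complex 0 e * (cis (e * s) * z)) (at 0)"
    for e :: real and z
  proof -
    have "((\<lambda>h. cis (e * (s + h))) has_vector_derivative Complex 0 e * cis (e * s)) (at 0)"
      by (auto simp: has_vector_derivative_complex_iff intro!: derivative_eq_intros)
    from has_vector_derivative_mult_left[OF this, of z] show ?thesis by (simp add: mult.assoc)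
  qed
  have e1: "((\<lambda>h. c * z1 (t + h)) has_vector_derivative d1 * (c * z1 t)) (at 0)" for c
    using has_vector_derivative_mult_right[OF sh[OF DERIV_z1[of t, folded d1_def]], of c]
    by (simp only: mult.left_commute)
  have e2: "((\<lambda>h. z2 (t + h)) has_vector_derivative d2 * z2 t) (at 0)"
    using sh[OF DERIV_z2[of t, folded d2_def]] .
  have p2: "pd 2 U p = vector [d1 * (cis s * z1 t), d2 * z2 t, d1 * (cis (- s) * z1 t)]"
    unfolding pd_def
  proof (rule vector_derivative_at, rule has_vector_derivative_vec)
    fix k :: 3
    have "k = 1 \<or> k = 2 \<or> k = 3" using exhaust_3 by blast
    then show "((\<lambda>h. U (p + h *\<^sub>R axis 2 1) $ k) has_vector_derivative
        vector [d1 * (cis s * z1 t), d2 * z2 t, d1 * (cis (- s) * z1 t)] $ k) (at 0)"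
      using e1[of "cis s"] e1[of "cis (- s)"] e2
      by (auto simp: U_nth axis_def s_def[symmetric] t_def[symmetric])
  qed
  have p1: "pd 1 U p = vector [Complex 0 1 * (cis s * z1 t), 0 * z2 t, Complex 0 (- 1) * (cis (- s) * z1 t)]"
    unfolding pd_def
  proof (rule vector_derivative_at, rule has_vector_derivative_vec)
    fix k :: 3
    have "k = 1 \<or> k = 2 \<or> k = 3" using exhaust_3 by blast
    then show "((\<lambda>h. U (p + h *\<^sub>R axis 1 1) $ k) has_vector_derivative
        vector [Complex 0 1 * (cis s * z1 t), 0 * z2 t, Complex 0 (- 1) * (cis (- s) * z1 t)] $ k) (at 0)"
      using ci[of 1 "z1 t"] ci[of "- 1" "z1 t"]
      by (auto simp: U_nth axis_def s_def[symmetric] t_def[symmetric])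
  qed
  have n: "(norm (cis x * z1 t))\<^sup>2 = \<rho> t / 2" for x using norm_z by (simp add: norm_mult)
  have ne: "\<rho> t \<noteq> 0" "w t \<noteq> 0" using \<rho>_pos[of t] w_pos[of t] by auto
  have W: "(w' t)\<^sup>2 + 16 * J\<^sup>2 = 4 * w t * (\<rho> t)\<^sup>2" by (simp add: w_energy \<rho>_def)
  have i22: "inner (pd 2 U p) (pd 2 U p) = \<rho> t"
  proof -
    have "inner (pd 2 U p) (pd 2 U p) = inner d1 d1 * \<rho> t + inner d2 d2 * w t"
      unfolding p2 inner_vec_def by (simp add: sum_3 inner_complex_mult n norm_z)
    also have "inner d1 d1 * \<rho> t = ((w' t)\<^sup>2 + 16 * J\<^sup>2) / (4 * \<rho> t)"
      using ne by (simp add: d1_def inner_complex_def power2_eq_square field_simps)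
    also have "\<dots> = w t * \<rho> t" unfolding W using ne by (simp add: power2_eq_square)
    also have "inner d2 d2 * w t = ((w' t)\<^sup>2 + 16 * J\<^sup>2) / (4 * w t)"
      using ne by (simp add: d2_def inner_complex_def power2_eq_square field_simps)
    also have "\<dots> = (\<rho> t)\<^sup>2" unfolding W using ne by simp
    also have "w t * \<rho> t + (\<rho> t)\<^sup>2 = \<rho> t" by (simp add: \<rho>_def power2_eq_square algebra_simps)
    finally show ?thesis .
  qed
  have i11: "inner (pd 1 U p) (pd 1 U p) = \<rho> t"
    unfolding p1 inner_vec_def by (simp add: sum_3 inner_complex_mult n, simp add: inner_complex_def)
  have i12: "inner (pd 1 U p) (pd 2 U p) = 0"
    unfolding p1 p2 inner_vec_def by (simp add: sum_3 inner_complex_mult n, simp add: inner_complex_def d1_def)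
  show ?thesis
    unfolding induced_metric_def
    using i11 i12 i22 by (simp add: vec_eq_iff forall_2 mat_def t_def[symmetric] inner_commute)
qed

subsection \<open>Separated eigenfunctions\<close>

text \<open>The polynomials in \<gamma> and its derivative. They are closed under differentiation
  since the second derivative of \<gamma> is a polynomial in \<gamma>.\<close>

inductive_set coeffs :: "(real \<Rightarrow> real) set" where
  const: "(\<lambda>_. c) \<in> coeffs"
| \<gamma>: "\<gamma> \<in> coeffs"
| \<gamma>': "deriv \<gamma> \<in> coeffs"
| add: "f \<in> coeffs \<Longrightarrow> g \<in> coeffs \<Longrightarrow> (\<lambda>t. f t + g t) \<in> coeffs"
| mult: "f \<in> coeffs \<Longrightarrow> g \<in> coeffs \<Longrightarrow> (\<lambda>t. f t * g t) \<in> coeffs"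

lemma coeffs_DERIV: "f \<in> coeffs \<Longrightarrow> \<exists>f'\<in>coeffs. \<forall>t. (f has_real_derivative f' t) (at t)"
proof (induction rule: coeffs.induct)
  case (const c)
  then show ?case using coeffs.const[of 0] by (intro bexI[of _ "\<lambda>_. 0"]) auto
next
  case \<gamma>
  then show ?case using DERIV_\<gamma> coeffs.\<gamma>' by blast
next
  case \<gamma>'
  have "(\<lambda>t. (\<lambda>_. 12) t * (\<gamma> t * \<gamma> t) + (\<lambda>_. - 4) t * \<gamma> t) \<in> coeffs"
    by (intro coeffs.intros)
  then show ?case
    using DERIV_\<gamma>' unfolding \<gamma>_second
    by (rule_tac bexI) (auto simp: power2_eq_square)
next
  case (add f g)
  then obtain f' g' where "f' \<in> coeffs" "g' \<in> coeffs" "\<And>t. (f has_real_derivative f' t) (at t)"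
    "\<And>t. (g has_real_derivative g' t) (at t)" by blast
  then show ?case by (intro bexI[of _ "\<lambda>t. f' t + g' t"]) (auto intro!: coeffs.add DERIV_add)
next
  case (mult f g)
  then obtain f' g' where "f' \<in> coeffs" "g' \<in> coeffs" "\<And>t. (f has_real_derivative f' t) (at t)"
    "\<And>t. (g has_real_derivative g' t) (at t)" by blast
  then show ?case using mult(1,2)
    by (intro bexI[of _ "\<lambda>t. f' t * g t + g' t * f t"]) (auto intro!: coeffs.add coeffs.mult DERIV_mult)
qed

lemma smooth_separated:
  assumes "hill_solution \<rho> l k g"
  shows "smooth (\<lambda>p. cos (k * p $ 1 + b) * g (p $ 2))"
proof -
  obtain g' where g: "\<And>t. (g has_real_derivative g' t) (at t)"
    "\<And>t. (g' has_real_derivative (k\<^sup>2 - l * \<rho> t) * g t) (at t)"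
    using assms by (auto simp: hill_solution_def)
  \<comment> \<open>This class is closed under both partial derivatives: the one in s shifts the
    phase by \<pi>/2, the one in t removes g'' by Hill's equation. Smoothness is then an induction
    on the list of derivatives.\<close>
  define S where "S = {(\<lambda>p::real^2. cos (k * p $ 1 + b) * (a1 (p $ 2) * g (p $ 2) + a2 (p $ 2) * g' (p $ 2))) | b a1 a2.
    a1 \<in> coeffs \<and> a2 \<in> coeffs}"
  have q: "(\<lambda>t. k\<^sup>2 - l * \<rho> t) \<in> coeffs"
  proof -
    have "(\<lambda>t. (\<lambda>_. k\<^sup>2 - 2 / 3 * l) t + (\<lambda>_. 2 * l) t * \<gamma> t) \<in> coeffs" by (intro coeffs.intros)
    then show ?thesis by (simp add: \<rho>_def w_def algebra_simps)
  qed
  have step: "f differentiable_on UNIV \<and> pd i f \<in> S" if f: "f \<in> S" for f i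
  proof -
    obtain b a1 a2 where f: "f = (\<lambda>p. cos (k * p $ 1 + b) * (a1 (p $ 2) * g (p $ 2) + a2 (p $ 2) * g' (p $ 2)))"
      and a: "a1 \<in> coeffs" "a2 \<in> coeffs" using f by (auto simp: S_def)
    obtain a1' a2' where a': "a1' \<in> coeffs" "a2' \<in> coeffs" "\<And>t. (a1 has_real_derivative a1' t) (at t)"
      "\<And>t. (a2 has_real_derivative a2' t) (at t)" using coeffs_DERIV a by metis
    define h where "h = (\<lambda>t. a1 t * g t + a2 t * g' t)"
    define h' where "h' = (\<lambda>t. (a1' t + a2 t * (k\<^sup>2 - l * \<rho> t)) * g t + (a1 t + a2' t) * g' t)"
    have dh: "(h has_real_derivative h' t) (at t)" for t
      unfolding h_def h'_def using DERIV_add[OF DERIV_mult[OF a'(3) g(1)] DERIV_mult[OF a'(4) g(2)], of t]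
      by (rule DERIV_cong) (simp add: algebra_simps)
    have dc: "((\<lambda>s. cos (k * s + b)) has_real_derivative k * cos (k * s + (b + pi / 2))) (at s)" for s
    proof -
      have "cos (k * s + (b + pi / 2)) = - sin (k * s + b)"
        using cos_add[of "k * s + b" "pi / 2"] by (simp add: add.assoc)
      then show ?thesis by (auto intro!: derivative_eq_intros)
    qed
    have f': "f = (\<lambda>p. cos (k * p $ 1 + b) * h (p $ 2))" by (simp add: f h_def)
    have "f differentiable_on UNIV" unfolding f' by (rule differentiable_separated[OF dc dh])
    moreover have "pd 1 f = (\<lambda>p. cos (k * p $ 1 + (b + pi / 2)) *
        (((\<lambda>_. k) (p $ 2) * a1 (p $ 2)) * g (p $ 2) + ((\<lambda>_. k) (p $ 2) * a2 (p $ 2)) * g' (p $ 2)))"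
      unfolding f' using pd_separated(1)[OF dc dh] by (auto simp: fun_eq_iff h_def algebra_simps)
    then have "pd 1 f \<in> S"
      unfolding S_def using coeffs.mult[OF coeffs.const[of k] a(1)] coeffs.mult[OF coeffs.const[of k] a(2)]
      by (intro CollectI exI[of _ "b + pi / 2"] exI[of _ "\<lambda>t. k * a1 t"] exI[of _ "\<lambda>t. k * a2 t"]) auto
    moreover have "pd 2 f = (\<lambda>p. cos (k * p $ 1 + b) *
        ((a1' (p $ 2) + a2 (p $ 2) * (k\<^sup>2 - l * \<rho> (p $ 2))) * g (p $ 2) + (a1 (p $ 2) + a2' (p $ 2)) * g' (p $ 2)))"
      unfolding f' using pd_separated(2)[OF dc dh] by (simp add: fun_eq_iff h'_def)
    then have "pd 2 f \<in> S"
      unfolding S_def using coeffs.add[OF a'(1) coeffs.mult[OF a(2) q]] coeffs.add[OF a(1) a'(2)]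
      by (intro CollectI exI[of _ b] exI[of _ "\<lambda>t. a1' t + a2 t * (k\<^sup>2 - l * \<rho> t)"]
          exI[of _ "\<lambda>t. a1 t + a2' t"]) auto
    moreover have "i = 1 \<or> i = 2" using exhaust_2 by blast
    ultimately show ?thesis by auto
  qed
  have "foldr pd is f \<in> S" if "f \<in> S" for "is" f
    using that step by (induction "is") auto
  moreover have "(\<lambda>p. cos (k * p $ 1 + b) * g (p $ 2)) \<in> S"
  proof -
    have "(\<lambda>p::real^2. cos (k * p $ 1 + b) * g (p $ 2)) =
      (\<lambda>p. cos (k * p $ 1 + b) * ((\<lambda>_. 1) (p $ 2) * g (p $ 2) + (\<lambda>_. 0) (p $ 2) * g' (p $ 2)))" by simp
    then show ?thesis unfolding S_def using coeffs.const[of 1] coeffs.const[of 0]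
      by (intro CollectI exI[of _ b] exI[of _ "\<lambda>_. 1"] exI[of _ "\<lambda>_. 0"]) auto
  qed
  ultimately show ?thesis unfolding smooth_def using step by blast
qed

lemma separated_eigenfunction:
  assumes h: "hill_solution \<rho> l k g"
    and per: "\<And>v p. v \<in> period_lattice U \<Longrightarrow> cos (k * (p + v) $ 1 + b) * g ((p + v) $ 2) = cos (k * p $ 1 + b) * g (p $ 2)"
  shows "(\<lambda>p. cos (k * p $ 1 + b) * g (p $ 2)) \<in> eigenspace U l"
proof -
  obtain g' where g: "\<And>t. (g has_real_derivative g' t) (at t)"
    "\<And>t. (g' has_real_derivative (k\<^sup>2 - l * \<rho> t) * g t) (at t)"
    using h by (auto simp: hill_solution_def)
  let ?f = "\<lambda>p::real^2. cos (k * p $ 1 + b) * g (p $ 2)"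
  have c: "((\<lambda>s. cos (k * s + b)) has_real_derivative - k * sin (k * s + b)) (at s)"
    and s: "((\<lambda>s. - k * sin (k * s + b)) has_real_derivative - k\<^sup>2 * cos (k * s + b)) (at s)" for s
    by (auto intro!: derivative_eq_intros simp: power2_eq_square)
  have p1: "pd 1 ?f = (\<lambda>p. - k * sin (k * p $ 1 + b) * g (p $ 2))"
    using pd_separated(1)[OF c g(1)] by auto
  have p2: "pd 2 ?f = (\<lambda>p. cos (k * p $ 1 + b) * g' (p $ 2))"
    using pd_separated(2)[OF c g(1)] by auto
  have "laplacian U ?f p = l * ?f p" for p
  proof -
    have "laplacian U ?f p = - (pd 1 (pd 1 ?f) p + pd 2 (pd 2 ?f) p) / \<rho> (p $ 2)"
      by (rule laplacian_conformal) (rule induced_metric_U, rule \<rho>_pos)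
    also have "pd 1 (pd 1 ?f) p = - k\<^sup>2 * cos (k * p $ 1 + b) * g (p $ 2)"
      unfolding p1 by (rule pd_separated(1)[OF s g(1)])
    also have "pd 2 (pd 2 ?f) p = cos (k * p $ 1 + b) * ((k\<^sup>2 - l * \<rho> (p $ 2)) * g (p $ 2))"
      unfolding p2 by (rule pd_separated(2)[OF c g(2)])
    also have "- (- k\<^sup>2 * cos (k * p $ 1 + b) * g (p $ 2) + cos (k * p $ 1 + b) * ((k\<^sup>2 - l * \<rho> (p $ 2)) * g (p $ 2)))
        = l * ?f p * \<rho> (p $ 2)" by (simp add: algebra_simps)
    finally show ?thesis using \<rho>_pos[of "p $ 2"] by simp
  qed
  then show ?thesis
    using per smooth_separated[OF h] by (auto simp: eigenspace_def)
qed

end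

section \<open>Counting eigenvalues\<close>

text \<open>Every sum in \<open>enat\<close> converges, so finitely many eigenvalues already bound
  the count from below.\<close>

lemma sum_le_eigenvalue_count:
  assumes "finite F" "F \<subseteq> I"
  shows "(\<Sum>ev\<in>F. multiplicity u ev) \<le> eigenvalue_count u I"
proof -
  have s: "multiplicity u summable_on X" for X
    by (rule nonneg_summable_on_complete) simp
  have "(\<Sum>ev\<in>F. multiplicity u ev) = (\<Sum>\<^sub>\<infinity>ev\<in>F. multiplicity u ev)"
    using assms by simp
  also have "\<dots> \<le> eigenvalue_count u I"
    unfolding eigenvalue_count_def
    by (rule infsum_mono_neutral[OF s s]) (use assms in auto)
  finally show ?thesis .
qed

lemma sum_function_apply: "(\<Sum>i\<in>A. f i) p = (\<Sum>i\<in>A. f i p)"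
  by (induction A rule: infinite_finite_induct) auto

lemma multiplicity_ge:
  fixes f :: "nat \<Rightarrow> real^2 \<Rightarrow> real"
  assumes es: "\<And>i. i < N \<Longrightarrow> f i \<in> eigenspace u ev"
    and ind: "\<And>c i. (\<And>p. (\<Sum>i<N. c i * f i p) = 0) \<Longrightarrow> i < N \<Longrightarrow> c i = 0"
  shows "enat N \<le> multiplicity u ev"
proof -
  have inj: "inj_on f {..<N}"
  proof (rule inj_onI, rule ccontr)
    fix i j assume ij: "i \<in> {..<N}" "j \<in> {..<N}" "f i = f j" "i \<noteq> j"
    define c where "c = (\<lambda>k. if k = i then 1 else if k = j then - 1 else 0 :: real)"
    have "(\<Sum>k<N. c k * f k p) = 0" for p
    proof -
      have "(\<Sum>k<N. c k * f k p) = (\<Sum>k<N. (if k = i then f i p else 0) - (if k = j then f j p else 0))"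
        using ij by (intro sum.cong) (auto simp: c_def)
      then show ?thesis using ij by (simp add: sum_subtractf)
    qed
    then have "c i = 0" using ind ij by blast
    then show False by (simp add: c_def)
  qed
  let ?B = "f ` {..<N}"
  have "fun_vs.independent ?B"
  proof
    assume "fun_vs.dependent ?B"
    then obtain c b where b: "b \<in> ?B" "c b \<noteq> 0" and s: "(\<Sum>v\<in>?B. (\<lambda>p. c v * v p)) = 0"
      unfolding fun_vs.dependent_finite[OF finite_imageI[OF finite_lessThan]] by blast
    have "(\<Sum>i<N. c (f i) * f i p) = 0" for p
    proof -
      have "(\<Sum>v\<in>?B. (\<lambda>p. c v * v p)) p = 0" using s by (simp add: zero_fun_def)
      then show ?thesis by (simp add: sum_function_apply sum.reindex[OF inj])
    qed
    then have "c (f i) = 0" if "i < N" for i using ind[of "\<lambda>i. c (f i)"] that by blast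
    then show False using b by auto
  qed
  then have "?B \<in> {B. finite B \<and> B \<subseteq> eigenspace u ev \<and> fun_vs.independent B}" using es by auto
  moreover have "card ?B = N" using inj by (simp add: card_image)
  ultimately show ?thesis unfolding multiplicity_def by (metis (mono_tags, lifting) SUP_upper)
qed

section \<open>Diagonal one-parameter groups\<close>

definition diagonal :: "complex^3 \<Rightarrow> complex^3^3" where
  "diagonal d = (\<chi> i j. if i = j then d $ i else 0)"

lemma diagonal_mult: "diagonal d ** diagonal e = diagonal (\<chi> i. d $ i * e $ i)"
  by (simp add: vec_eq_iff forall_3 matrix_matrix_mult_def sum_3 diagonal_def)

lemma diagonal_mult_vector: "diagonal d *v x = (\<chi> i. d $ i * x $ i)"
  by (simp add: vec_eq_iff forall_3 matrix_vector_mult_def sum_3 diagonal_def)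

lemma matrix_exp_diagonal: "matrix_exp (diagonal d) = diagonal (\<chi> i. exp (d $ i))"
proof -
  have pow: "((\<lambda>B. diagonal d ** B) ^^ k) (mat 1) = diagonal (\<chi> i. (d $ i) ^ k)" for k
  proof (induction k)
    case 0
    show ?case by (simp add: vec_eq_iff diagonal_def mat_def)
  next
    case (Suc k)
    then show ?case by (simp add: diagonal_mult)
  qed
  have "(\<lambda>k. (1 / fact k) *\<^sub>R ((\<lambda>B. diagonal d ** B) ^^ k) (mat 1)) sums diagonal (\<chi> i. exp (d $ i))"
    unfolding sums_def
  proof (intro vec_tendstoI)
    fix i j
    have "(\<lambda>k. (1 / fact k) *\<^sub>R (d $ i) ^ k) sums exp (d $ i)"
      using exp_converges[of "d $ i"] by (simp add: divide_inverse)
    then have "(\<lambda>k. if i = j then (1 / fact k) *\<^sub>R (d $ i) ^ k else 0) sums (if i = j then exp (d $ i) else 0)"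
      by auto
    then show "(\<lambda>n. (\<Sum>k<n. (1 / fact k) *\<^sub>R ((\<lambda>B. diagonal d ** B) ^^ k) (mat 1)) $ i $ j) \<longlonglongrightarrow>
        diagonal (\<chi> i. exp (d $ i)) $ i $ j"
      unfolding sums_def pow by (simp add: diagonal_def if_distrib cong: if_cong)
  qed
  then show ?thesis unfolding matrix_exp_def by (rule sums_unique[symmetric])
qed

lemma diagonal_SU3:
  assumes "\<And>i. norm (d $ i) = 1" "d $ 1 * d $ 2 * d $ 3 = 1"
  shows "diagonal d \<in> SU3"
proof -
  have "d $ i * cnj (d $ i) = 1" for i
    using assms(1)[of i] by (simp add: complex_norm_square[symmetric])
  then have "diagonal d ** (\<chi> i j. cnj (diagonal d $ j $ i)) = mat 1"
    by (simp add: vec_eq_iff forall_3 matrix_matrix_mult_def sum_3 diagonal_def mat_def)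
  moreover have "det (diagonal d) = 1"
    using assms(2) by (simp add: det_3 diagonal_def)
  ultimately show ?thesis by (simp add: SU3_def)
qed

section \<open>Separating the coefficients of trigonometric sums\<close>

lemma sin_nonzero_near_0:
  fixes f :: "real \<Rightarrow> real"
  assumes "isCont f 0" "f 0 = 0" "\<And>t. t > 0 \<Longrightarrow> f t \<noteq> 0"
  obtains d where "d > 0" "\<And>t. 0 < t \<Longrightarrow> t < d \<Longrightarrow> sin (f t) \<noteq> 0"
proof -
  obtain d where d: "d > 0" "\<And>t. \<bar>t\<bar> < d \<Longrightarrow> \<bar>f t\<bar> < pi"
  proof -
    obtain d where "d > 0" "\<And>t. dist t 0 < d \<Longrightarrow> dist (f t) (f 0) < pi"
      using assms(1) pi_gt_zero unfolding continuous_at_eps_delta by blast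
    then show ?thesis using that assms(2) by (simp add: dist_real_def)
  qed
  have "sin (f t) \<noteq> 0" if "0 < t" "t < d" for t
  proof
    assume "sin (f t) = 0"
    moreover have "- pi < f t" "f t < pi" using d(2)[of t] that by (auto simp: abs_less_iff)
    ultimately have "f t = 0" by (rule sin_eq_0_pi[rotated -1])
    then show False using assms(3) that by blast
  qed
  then show ?thesis using that d by blast
qed

lemma trig_independent:
  fixes a b c A B :: real
  assumes "\<And>s. a * A + (b * cos s + c * sin s) * B = 0" "A \<noteq> 0" "B \<noteq> 0"
  shows "a = 0" "b = 0" "c = 0"
proof -
  have "a * A + b * B = 0" "a * A - b * B = 0" "a * A + c * B = 0"
    using assms(1)[of 0] assms(1)[of pi] assms(1)[of "pi / 2"] by auto
  then have "2 * (a * A) = 0" "2 * (b * B) = 0" "c * B = - (a * A)" by linarith+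
  then show "a = 0" "b = 0" "c = 0" using assms(2,3) by auto
qed

lemma trig_independent2:
  fixes a b c d e A B C :: real
  assumes h: "\<And>s. a * A + (b * cos (2 * s) + c * sin (2 * s)) * B + (d * cos s + e * sin s) * C = 0"
    and "A \<noteq> 0" "B \<noteq> 0" "C \<noteq> 0"
  shows "a = 0" "b = 0" "c = 0" "d = 0" "e = 0"
proof -
  have 1: "a * A + b * B + d * C = 0" using h[of 0] by simp
  have 2: "a * A + b * B - d * C = 0" using h[of pi] by simp
  have 3: "a * A - b * B + e * C = 0" using h[of "pi / 2"] by simp
  have 4: "a * A - b * B - e * C = 0" using h[of "- (pi / 2)"] by simp
  have "2 * (d * C) = 0" "2 * (e * C) = 0" "2 * (a * A) = 0" "2 * (b * B) = 0" using 1 2 3 4 by linarith+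
  then show z: "a = 0" "b = 0" "d = 0" "e = 0" using assms(2-) by auto
  have "c * B = 0" using h[of "pi / 4"] z by simp
  then show "c = 0" using assms(3) by simp
qed

context legendrian_profile
begin

section \<open>Periods of the immersion\<close>

text \<open>The first and third coordinates turn oppositely in s, so a period forces cis (v $ 1) to
  equal its own inverse. The sign \<open>e\<close> left over appears both in cos s and in z1, and
  cancels in the products of the two.\<close>

lemma period_lattice_cases:
  assumes "v \<in> period_lattice U"
  obtains e :: real where "e * e = 1" "\<And>x. cos (x + v $ 1) = e * cos x"
    "\<And>t. z1 (t + v $ 2) = of_real e * z1 t" "\<And>t. z2 (t + v $ 2) = z2 t"
proof -
  have per: "U (p + v) = U p" for p using assms by (simp add: period_lattice_def)
  have z2: "z2 (t + v $ 2) = z2 t" for t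
    using arg_cong[OF per[of "vector [0, t]"], of "\<lambda>x. x $ 2"] by (simp add: U_nth)
  have a: "cis (v $ 1) * z1 (t + v $ 2) = z1 t" for t
    using arg_cong[OF per[of "vector [0, t]"], of "\<lambda>x. x $ 1"] by (simp add: U_nth)
  have b: "cis (- (v $ 1)) * z1 (t + v $ 2) = z1 t" for t
    using arg_cong[OF per[of "vector [0, t]"], of "\<lambda>x. x $ 3"] by (simp add: U_nth)
  have nz: "z1 t \<noteq> 0" for t using norm_z(1)[of t] \<rho>_pos[of t] by auto
  have "cis (v $ 1) = cis (- (v $ 1))" using a[of 0] b[of 0] nz[of "0 + v $ 2"] by (metis mult_cancel_right)
  then have s: "sin (v $ 1) = 0" by (simp add: complex_eq_iff)
  define e where "e = cos (v $ 1)"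
  have e: "e * e = 1" using sin_cos_squared_add[of "v $ 1"] s by (simp add: e_def power2_eq_square)
  have "cis (v $ 1) = of_real e" using s by (simp add: complex_eq_iff e_def)
  then have "of_real e * (of_real e * z1 (t + v $ 2)) = of_real e * z1 t" for t using a[of t] by simp
  then have "of_real (e * e) * z1 (t + v $ 2) = of_real e * z1 t" for t by (simp add: mult.assoc)
  then have "z1 (t + v $ 2) = of_real e * z1 t" for t using e by simp
  moreover have "cos (x + v $ 1) = e * cos x" for x by (simp add: cos_add s e_def)
  ultimately show ?thesis using that e z2 by blast
qed

text \<open>The modulus of z2 returns to its minimum only at multiples of \<open>T\<close>; the
  phase of z2 then has to return as well.\<close>

lemma period_lattice_second:
  assumes "v \<in> period_lattice U"
  obtains k j :: int where "v $ 2 = of_int k * T" "of_int k * \<theta>2 T = of_int j * (2 * pi)"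
proof -
  obtain z2: "\<And>t. z2 (t + v $ 2) = z2 t" using period_lattice_cases[OF assms] by metis
  have "w (v $ 2) = w 0" using z2[of 0] norm_z(2)[of "v $ 2"] norm_z(2)[of 0] by simp
  then obtain k :: int where k: "v $ 2 = of_int k * T" using w_return by blast
  have \<theta>: "\<theta>2 (v $ 2) = of_int k * \<theta>2 T"
    unfolding k using quasi_periodic_shift[of \<theta>2 T "\<theta>2 T" 0 k] \<theta>2_add \<theta>_0 by simp
  have "cis (\<theta>2 (v $ 2)) = 1"
    using z2[of 0] \<open>w (v $ 2) = w 0\<close> w_pos[of 0] by (simp add: z2_def \<theta>_0)
  then have "cos (\<theta>2 (v $ 2)) = 1" by (simp add: complex_eq_iff)
  then obtain j :: int where "\<theta>2 (v $ 2) = of_int j * (2 * pi)"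
    by (auto simp: cos_one_2pi_int)
  then have "of_int k * \<theta>2 T = of_int j * (2 * pi)" using \<theta> by (simp only:)
  then show ?thesis by (rule that[OF k])
qed

lemma \<rho>_props: "continuous_on UNIV \<rho>" "\<bar>\<rho> t\<bar> \<le> 1" "\<rho> (- t) = \<rho> t" "\<rho> (t + of_int k * T) = \<rho> t"
proof -
  show "continuous_on UNIV \<rho>" by (rule continuous_on_UNIV_if_DERIV[OF DERIV_\<rho>])
  show "\<bar>\<rho> t\<bar> \<le> 1" using \<rho>_pos[of t] w_pos[of t] by (simp add: \<rho>_def)
  show "\<rho> (- t) = \<rho> t" by (simp add: \<rho>_def w_minus)
  show "\<rho> (t + of_int k * T) = \<rho> t"
    using quasi_periodic_shift[of \<rho> T 0 t k] by (simp add: \<rho>_def w_period)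
qed

lemma \<gamma>_eq: "\<gamma> t = (w t - 1 / 3) / 2" by (simp add: w_def)

text \<open>1/3 is the local maximum of w (1 - w)^2, so it lies strictly between the two smaller
  roots. Consequently \<gamma> changes sign.\<close>

lemma root_bounds: "M - A < 1 / 3" "1 / 3 < M + A"
proof -
  have M: "1 / 3 < M" using \<mu> by (simp add: M_def)
  then show "1 / 3 < M + A" using A_pos by simp
  \<comment> \<open>The product equals A^2 - (M - 1/3)^2.\<close>
  have "0 < (1 / 3 - \<mu>) * (\<mu> + 2 / 3)" using \<mu> by simp
  then have "(M - 1 / 3)\<^sup>2 < A\<^sup>2"
    unfolding A_square by (simp add: M_def power2_eq_square field_simps)
  then have "M - 1 / 3 < A" by (rule power_less_imp_less_base) (use A_pos in simp)
  then show "M - A < 1 / 3" by simp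
qed

section \<open>Explicit eigenfunctions for 2 and 6\<close>

lemma solution_\<gamma>: "hill_solution \<rho> 6 0 \<gamma>"
proof -
  have "12 * (\<gamma> t)\<^sup>2 - 4 * \<gamma> t = (0\<^sup>2 - 6 * \<rho> t) * \<gamma> t" for t
    by (simp add: \<rho>_def w_def power2_eq_square algebra_simps)
  then show ?thesis unfolding hill_solution_def using DERIV_\<gamma> DERIV_\<gamma>'[unfolded \<gamma>_second] by metis
qed

lemma solution_R1_square: "hill_solution \<rho> 6 2 (\<lambda>t. \<rho> t / 2)"
  unfolding hill_solution_def
proof (intro exI conjI allI)
  show "((\<lambda>t. \<rho> t / 2) has_real_derivative - w' t / 2) (at t)" for t
    by (rule DERIV_cdivide[OF DERIV_\<rho>])
  show "((\<lambda>t. - w' t / 2) has_real_derivative (2\<^sup>2 - 6 * \<rho> t) * (\<rho> t / 2)) (at t)" for t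
    using DERIV_cdivide[OF DERIV_minus[OF DERIV_w'[of t]], of 2]
    by (rule DERIV_cong) (simp add: \<rho>_def field_simps)
qed

lemma hill_solutionI:
  assumes "\<And>t. (f has_real_derivative f' t) (at t)" "\<And>t. (f' has_real_derivative q t * f t) (at t)"
    and "\<And>t. q t = k\<^sup>2 - l * r t"
  shows "hill_solution r l k f"
  using assms unfolding hill_solution_def by (intro exI[of _ f']) simp

lemma solution_z1: "hill_solution \<rho> 2 1 (\<lambda>t. Re (z1 t))" "hill_solution \<rho> 2 1 (\<lambda>t. Im (z1 t))"
proof -
  have "(\<lambda>t. Re (z1 t)) = (\<lambda>t. sqrt (\<rho> t / 2) * cos (\<theta>1 t))" "(\<lambda>t. Im (z1 t)) = (\<lambda>t. sqrt (\<rho> t / 2) * sin (\<theta>1 t))"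
    by (simp_all add: z1_def)
  then show "hill_solution \<rho> 2 1 (\<lambda>t. Re (z1 t))" "hill_solution \<rho> 2 1 (\<lambda>t. Im (z1 t))"
    using hill_solutionI[OF polar1(1,2), of 1 2 \<rho>] hill_solutionI[OF polar1(3,4), of 1 2 \<rho>] by simp_all
qed

lemma solution_z2: "hill_solution \<rho> 2 0 (\<lambda>t. Re (z2 t))" "hill_solution \<rho> 2 0 (\<lambda>t. Im (z2 t))"
proof -
  have "(\<lambda>t. Re (z2 t)) = (\<lambda>t. sqrt (w t) * cos (\<theta>2 t))" "(\<lambda>t. Im (z2 t)) = (\<lambda>t. sqrt (w t) * sin (\<theta>2 t))"
    by (simp_all add: z2_def)
  then show "hill_solution \<rho> 2 0 (\<lambda>t. Re (z2 t))" "hill_solution \<rho> 2 0 (\<lambda>t. Im (z2 t))"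
    using hill_solutionI[OF polar2(1,2), of 0 2 \<rho>] hill_solutionI[OF polar2(3,4), of 0 2 \<rho>] by simp_all
qed

lemma z12: "Re (z1 t * cnj (z2 t)) = sqrt (w t * \<rho> t / 2) * cos (\<theta>1 t - \<theta>2 t)"
  "Im (z1 t * cnj (z2 t)) = sqrt (w t * \<rho> t / 2) * sin (\<theta>1 t - \<theta>2 t)"
proof -
  have "sqrt (w t * \<rho> t / 2) = sqrt (\<rho> t / 2) * sqrt (w t)" by (simp add: real_sqrt_mult[symmetric] mult.commute)
  then show "Re (z1 t * cnj (z2 t)) = sqrt (w t * \<rho> t / 2) * cos (\<theta>1 t - \<theta>2 t)"
    "Im (z1 t * cnj (z2 t)) = sqrt (w t * \<rho> t / 2) * sin (\<theta>1 t - \<theta>2 t)"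
    unfolding cos_diff sin_diff by (simp_all add: z1_def z2_def algebra_simps)
qed

lemma solution_z12: "hill_solution \<rho> 6 1 (\<lambda>t. Re (z1 t * cnj (z2 t)))" "hill_solution \<rho> 6 1 (\<lambda>t. Im (z1 t * cnj (z2 t)))"
  unfolding z12 using hill_solutionI[OF polar3(1,2), of 1 6 \<rho>] hill_solutionI[OF polar3(3,4), of 1 6 \<rho>] by simp_all

text \<open>At t = 0 all phases vanish, so evaluation there isolates the real parts. A time at which
  no sine vanishes is then needed to isolate the imaginary parts.\<close>

lemma common_time:
  obtains t where "t > 0" "sin (\<theta>1 t) \<noteq> 0" "sin (\<theta>2 t) \<noteq> 0" "sin (\<theta>1 t - \<theta>2 t) \<noteq> 0"
proof -
  have c: "isCont \<theta>1 0" "isCont \<theta>2 0" "isCont (\<lambda>t. \<theta>1 t - \<theta>2 t) 0"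
    using DERIV_isCont[OF DERIV_\<theta>1] DERIV_isCont[OF DERIV_\<theta>2] by (auto intro!: continuous_intros)
  have 1: "\<theta>1 t < 0" if "t > 0" for t
  proof -
    have "\<theta>1 t < \<theta>1 0"
    proof (rule DERIV_neg_imp_decreasing[OF that])
      fix x show "\<exists>y. (\<theta>1 has_real_derivative y) (at x) \<and> y < 0"
        using DERIV_\<theta>1[of x] J_pos w_less_1[of x] by (intro exI conjI) (auto simp: divide_less_0_iff)
    qed
    then show ?thesis by (simp add: \<theta>_0)
  qed
  have 2: "\<theta>2 t > 0" if "t > 0" for t
  proof -
    have "\<theta>2 0 < \<theta>2 t"
    proof (rule DERIV_pos_imp_increasing[OF that])
      fix x show "\<exists>y. (\<theta>2 has_real_derivative y) (at x) \<and> y > 0"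
        using DERIV_\<theta>2[of x] J_pos w_pos[of x] by (intro exI[of _ "2 * J / w x"]) auto
    qed
    then show ?thesis by (simp add: \<theta>_0)
  qed
  obtain d1 where d1: "d1 > 0" "\<And>t. 0 < t \<Longrightarrow> t < d1 \<Longrightarrow> sin (\<theta>1 t) \<noteq> 0"
    using sin_nonzero_near_0[OF c(1) \<theta>_0(1)] 1 by (metis less_irrefl)
  obtain d2 where d2: "d2 > 0" "\<And>t. 0 < t \<Longrightarrow> t < d2 \<Longrightarrow> sin (\<theta>2 t) \<noteq> 0"
    using sin_nonzero_near_0[OF c(2) \<theta>_0(2)] 2 by (metis less_irrefl)
  have "\<theta>1 t - \<theta>2 t \<noteq> 0" if "t > 0" for t using 1[OF that] 2[OF that] by simp
  then obtain d3 where d3: "d3 > 0" "\<And>t. 0 < t \<Longrightarrow> t < d3 \<Longrightarrow> sin (\<theta>1 t - \<theta>2 t) \<noteq> 0"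
    using sin_nonzero_near_0[OF c(3)] \<theta>_0 by (metis diff_self)
  define t where "t = min d1 (min d2 d3) / 2"
  have "0 < t" "t < d1" "t < d2" "t < d3" using d1 d2 d3 by (auto simp: t_def)
  then show ?thesis using that d1 d2 d3 by blast
qed

lemma nat_sum_6: "(\<Sum>i<6. f i) = f 0 + f 1 + f 2 + f 3 + f 4 + (f (5::nat) :: real)"
  and nat_sum_7: "(\<Sum>i<7. f i) = f 0 + f 1 + f 2 + f 3 + f 4 + f (5::nat) + (f 6 :: real)"
  by (simp_all add: eval_nat_numeral)

text \<open>The real and imaginary parts of the first and third coordinates span the products of cos
  s and sin s with Re z1 and Im z1; the sine is the cosine with phase - \<pi>/2.\<close>

lemma multiplicity_2: "6 \<le> multiplicity U 2"
proof -
  define F where "F = (\<lambda>(k::real, b::real, g::real \<Rightarrow> real) (p::real^2). cos (k * p $ 1 + b) * g (p $ 2))"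
  define d where "d = [(0 :: real, 0 :: real, \<lambda>t. Re (z2 t)), (0, 0, \<lambda>t. Im (z2 t)), (1, 0, \<lambda>t. Re (z1 t)),
    (1, - (pi / 2), \<lambda>t. Re (z1 t)), (1, 0, \<lambda>t. Im (z1 t)), (1, - (pi / 2), \<lambda>t. Im (z1 t))]"
  have shift1: "cos (1 * (p + v) $ 1 + b) = cos (p $ 1 + b + v $ 1)" for p v :: "real^2" and b
    by (simp add: algebra_simps)
  have es0: "F (0, b, g) \<in> eigenspace U 2" if "hill_solution \<rho> 2 0 g" "\<And>v t. (\<And>t. z2 (t + v) = z2 t) \<Longrightarrow> g (t + v) = g t" for b g
    unfolding F_def split
  proof (rule separated_eigenfunction[OF that(1)])
    fix v p assume "v \<in> period_lattice U"
    then obtain "\<And>t. z2 (t + v $ 2) = z2 t" using period_lattice_cases by metis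
    then show "cos (0 * (p + v) $ 1 + b) * g ((p + v) $ 2) = cos (0 * p $ 1 + b) * g (p $ 2)" using that(2) by simp
  qed
  have es1: "F (1, b, g) \<in> eigenspace U 2"
    if "hill_solution \<rho> 2 1 g" "\<And>v e t. (\<And>t. z1 (t + v) = of_real e * z1 t) \<Longrightarrow> g (t + v) = e * g t" for b g
    unfolding F_def split
  proof (rule separated_eigenfunction[OF that(1)])
    fix v p assume "v \<in> period_lattice U"
    then obtain e :: real where e: "e * e = 1" "\<And>x. cos (x + v $ 1) = e * cos x" "\<And>t. z1 (t + v $ 2) = of_real e * z1 t"
      using period_lattice_cases by metis
    have c: "cos (1 * (p + v) $ 1 + b) = e * cos (p $ 1 + b)" using e(2) shift1 by metis
    have "g ((p + v) $ 2) = e * g (p $ 2)" using that(2)[OF e(3)] by simp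
    then have "cos (1 * (p + v) $ 1 + b) * g ((p + v) $ 2) = (e * e) * (cos (1 * p $ 1 + b) * g (p $ 2))"
      unfolding c by simp
    then show "cos (1 * (p + v) $ 1 + b) * g ((p + v) $ 2) = cos (1 * p $ 1 + b) * g (p $ 2)" using e(1) by simp
  qed
  have "enat 6 \<le> multiplicity U 2"
  proof (rule multiplicity_ge[where f = "\<lambda>i. F (d ! i)"])
    fix i :: nat assume "i < 6"
    then have "i = 0 \<or> i = 1 \<or> i = 2 \<or> i = 3 \<or> i = 4 \<or> i = 5" by auto
    then show "F (d ! i) \<in> eigenspace U 2"
      by (elim disjE) (auto simp: d_def intro!: es0 es1 solution_z1 solution_z2)
  next
    fix c :: "nat \<Rightarrow> real" and i :: nat
    assume s: "\<And>p. (\<Sum>i<6. c i * F (d ! i) p) = 0" and i: "i < 6"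
    have sum: "c 0 * Re (z2 t) + c 1 * Im (z2 t) + (c 2 * cos x + c 3 * sin x) * Re (z1 t)
        + (c 4 * cos x + c 5 * sin x) * Im (z1 t) = 0" for x t
      using s[of "vector [x, t]"] unfolding nat_sum_6
      by (simp add: F_def d_def cos_diff algebra_simps)
    have 0: "Re (z2 0) \<noteq> 0" "Im (z2 0) = 0" "Re (z1 0) \<noteq> 0" "Im (z1 0) = 0"
      using w_pos[of 0] \<rho>_pos[of 0] by (auto simp: z1_def z2_def \<theta>_0)
    have "c 0 * Re (z2 0) + (c 2 * cos x + c 3 * sin x) * Re (z1 0) = 0" for x
      using sum[of 0 x] 0 by simp
    note c1 = trig_independent[OF this 0(1,3)]
    obtain t where t: "sin (\<theta>1 t) \<noteq> 0" "sin (\<theta>2 t) \<noteq> 0" using common_time by metis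
    have t': "Im (z2 t) \<noteq> 0" "Im (z1 t) \<noteq> 0"
      using w_pos[of t] \<rho>_pos[of t] t by (auto simp: z1_def z2_def)
    have "c 1 * Im (z2 t) + (c 4 * cos x + c 5 * sin x) * Im (z1 t) = 0" for x
      using sum[of t x] c1 by simp
    note c2 = trig_independent[OF this t']
    have "i = 0 \<or> i = 1 \<or> i = 2 \<or> i = 3 \<or> i = 4 \<or> i = 5" using i by auto
    then show "c i = 0" using c1 c2 by auto
  qed
  then show ?thesis by (simp add: numeral_eq_enat)
qed

text \<open>These are the traceless Hermitian forms evaluated on u: |u_2|^2 - 1/3 gives \<gamma>,
  u_1 cnj u_3 gives frequency 2, and u_1 cnj u_2, u_3 cnj u_2 give frequency 1. Of the eight
  dimensions one is lost, since |u_1|^2 - |u_3|^2 vanishes identically.\<close>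

lemma multiplicity_6: "7 \<le> multiplicity U 6"
proof -
  define F where "F = (\<lambda>(k::real, b::real, g::real \<Rightarrow> real) (p::real^2). cos (k * p $ 1 + b) * g (p $ 2))"
  define d where "d = [(0 :: real, 0 :: real, \<gamma>), (2, 0, \<lambda>t. \<rho> t / 2), (2, - (pi / 2), \<lambda>t. \<rho> t / 2),
    (1, 0, \<lambda>t. Re (z1 t * cnj (z2 t))), (1, - (pi / 2), \<lambda>t. Re (z1 t * cnj (z2 t))),
    (1, 0, \<lambda>t. Im (z1 t * cnj (z2 t))), (1, - (pi / 2), \<lambda>t. Im (z1 t * cnj (z2 t)))]"
  have shift1: "cos (1 * (p + v) $ 1 + b) = cos (p $ 1 + b + v $ 1)" for p v :: "real^2" and b
    by (simp add: algebra_simps)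
  have shift2: "cos (2 * (p + v) $ 1 + b) = cos (2 * p $ 1 + b + v $ 1 + v $ 1)" for p v :: "real^2" and b
    by (simp add: algebra_simps)
  have w_shift: "w (t + v) = w t" if "\<And>t. z2 (t + v) = z2 t" for t v
    using that[of t] norm_z(2)[of "t + v"] norm_z(2)[of t] by simp
  have es0: "F (0, 0, \<gamma>) \<in> eigenspace U 6"
    unfolding F_def split
  proof (rule separated_eigenfunction[OF solution_\<gamma>])
    fix v p assume "v \<in> period_lattice U"
    then obtain "\<And>t. z2 (t + v $ 2) = z2 t" using period_lattice_cases by metis
    then show "cos (0 * (p + v) $ 1 + 0) * \<gamma> ((p + v) $ 2) = cos (0 * p $ 1 + 0) * \<gamma> (p $ 2)"
      using w_shift by (simp add: \<gamma>_eq)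
  qed
  have es2: "F (2, b, \<lambda>t. \<rho> t / 2) \<in> eigenspace U 6" for b
    unfolding F_def split
  proof (rule separated_eigenfunction[OF solution_R1_square])
    fix v p assume "v \<in> period_lattice U"
    then obtain e :: real where e: "e * e = 1" "\<And>x. cos (x + v $ 1) = e * cos x" "\<And>t. z2 (t + v $ 2) = z2 t"
      using period_lattice_cases by metis
    have "cos (2 * (p + v) $ 1 + b) = e * (e * cos (2 * p $ 1 + b))" using e(2) shift2 by metis
    then have "cos (2 * (p + v) $ 1 + b) = (e * e) * cos (2 * p $ 1 + b)" by simp
    then show "cos (2 * (p + v) $ 1 + b) * (\<rho> ((p + v) $ 2) / 2) = cos (2 * p $ 1 + b) * (\<rho> (p $ 2) / 2)"
      using e(1) w_shift[OF e(3)] by (simp add: \<rho>_def)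
  qed
  have es1: "F (1, b, g) \<in> eigenspace U 6"
    if "hill_solution \<rho> 6 1 g"
      "\<And>v e t. (\<And>t. z1 (t + v) = of_real e * z1 t) \<Longrightarrow> (\<And>t. z2 (t + v) = z2 t) \<Longrightarrow> g (t + v) = e * g t" for b g
    unfolding F_def split
  proof (rule separated_eigenfunction[OF that(1)])
    fix v p assume "v \<in> period_lattice U"
    then obtain e :: real where e: "e * e = 1" "\<And>x. cos (x + v $ 1) = e * cos x"
      "\<And>t. z1 (t + v $ 2) = of_real e * z1 t" "\<And>t. z2 (t + v $ 2) = z2 t"
      using period_lattice_cases by metis
    have c: "cos (1 * (p + v) $ 1 + b) = e * cos (p $ 1 + b)" using e(2) shift1 by metis
    have "g ((p + v) $ 2) = e * g (p $ 2)" using that(2)[OF e(3,4)] by simp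
    then have "cos (1 * (p + v) $ 1 + b) * g ((p + v) $ 2) = (e * e) * (cos (1 * p $ 1 + b) * g (p $ 2))"
      unfolding c by simp
    then show "cos (1 * (p + v) $ 1 + b) * g ((p + v) $ 2) = cos (1 * p $ 1 + b) * g (p $ 2)" using e(1) by simp
  qed
  have es1': "F (1, b, \<lambda>t. Re (z1 t * cnj (z2 t))) \<in> eigenspace U 6"
    "F (1, b, \<lambda>t. Im (z1 t * cnj (z2 t))) \<in> eigenspace U 6" for b
    by (rule es1, rule solution_z12, simp add: algebra_simps)+
  have "enat 7 \<le> multiplicity U 6"
  proof (rule multiplicity_ge[where f = "\<lambda>i. F (d ! i)"])
    fix i :: nat assume "i < 7"
    then have "i = 0 \<or> i = 1 \<or> i = 2 \<or> i = 3 \<or> i = 4 \<or> i = 5 \<or> i = 6" by auto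
    then show "F (d ! i) \<in> eigenspace U 6"
      using es0 es2 es1' by (elim disjE) (simp_all only: d_def, simp_all)
  next
    fix c :: "nat \<Rightarrow> real" and i :: nat
    assume s: "\<And>p. (\<Sum>i<7. c i * F (d ! i) p) = 0" and i: "i < 7"
    define X where "X = (\<lambda>t. Re (z1 t * cnj (z2 t)))"
    define Y where "Y = (\<lambda>t. Im (z1 t * cnj (z2 t)))"
    have sum: "c 0 * \<gamma> t + (c 1 * cos (2 * x) + c 2 * sin (2 * x)) * (\<rho> t / 2) + (c 3 * cos x + c 4 * sin x) * X t
        + (c 5 * cos x + c 6 * sin x) * Y t = 0" for x t
      using s[of "vector [x, t]"] unfolding nat_sum_7 d_def X_def[symmetric] Y_def[symmetric]
      by (simp add: F_def cos_diff algebra_simps add_divide_distrib)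
    have p: "sqrt (w t * \<rho> t / 2) > 0" for t using w_pos[of t] \<rho>_pos[of t] by simp
    have 0: "\<gamma> 0 \<noteq> 0" "\<rho> 0 / 2 \<noteq> 0" "X 0 \<noteq> 0" and Y0: "Y 0 = 0"
      using root_bounds w_0 \<rho>_pos[of 0] p[of 0] unfolding X_def Y_def z12 by (auto simp: \<gamma>_eq \<theta>_0)
    have "c 0 * \<gamma> 0 + (c 1 * cos (2 * x) + c 2 * sin (2 * x)) * (\<rho> 0 / 2) + (c 3 * cos x + c 4 * sin x) * X 0 = 0" for x
      using sum[of 0 x] Y0 by simp
    note c1 = trig_independent2[OF this 0]
    obtain t where "sin (\<theta>1 t - \<theta>2 t) \<noteq> 0" using common_time by metis
    then have t: "Y t \<noteq> 0" using w_pos[of t] \<rho>_pos[of t] unfolding Y_def z12 by simp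
    have "0 * 1 + (c 5 * cos x + c 6 * sin x) * Y t = 0" for x
      using sum[of t x] c1 by simp
    note c2 = trig_independent[OF this _ t]
    have "i = 0 \<or> i = 1 \<or> i = 2 \<or> i = 3 \<or> i = 4 \<or> i = 5 \<or> i = 6" using i by auto
    then show "c i = 0" using c1 c2 by auto
  qed
  then show ?thesis by (simp add: numeral_eq_enat)
qed

section \<open>Symmetry of the cone\<close>

text \<open>The diagonal matrix with entries cis t, 1, cis (- t) moves the point of u at s to the
  one at s + t. The generator of this group is a nonzero element of the Lie algebra.\<close>

lemma group_dim_pos: "1 \<le> group_dim (cone_symmetries U)"
proof -
  define X where "X = diagonal (vector [\<i>, 0, - \<i>])"
  define D where "D = (\<lambda>t::real. vector [cis t, 1, cis (- t)] :: complex^3)"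
  have exp: "matrix_exp (t *\<^sub>R X) = diagonal (D t)" for t
  proof -
    have "t *\<^sub>R X = diagonal (\<chi> i. t *\<^sub>R vector [\<i>, 0, - \<i>] $ i)"
      by (simp add: X_def diagonal_def vec_eq_iff)
    moreover have "(\<chi> i. exp (t *\<^sub>R vector [\<i>, 0, - \<i>] $ i)) = D t"
      by (simp add: vec_eq_iff forall_3 D_def cis_conv_exp scaleR_conv_of_real mult.commute)
    ultimately show ?thesis by (simp add: matrix_exp_diagonal)
  qed
  have cis_add: "cis a * cis b = cis (b + a)" "cis a * (cis b * c) = cis (b + a) * c" for a b c
    by (simp_all only: cis_mult add.commute mult.assoc[symmetric])
  have rot: "diagonal (D t) *v (r *\<^sub>R U p) = r *\<^sub>R U (p + t *\<^sub>R axis 1 1)" for t r p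
    by (simp add: vec_eq_iff forall_3 diagonal_mult_vector D_def U_nth axis_def cis_add)
  have sub: "(\<lambda>x. diagonal (D t) *v x) ` cone U \<subseteq> cone U" for t
    unfolding cone_def using rot by blast
  have inv: "diagonal (D t) *v (diagonal (D (- t)) *v x) = x" for t x
    by (simp add: vec_eq_iff forall_3 diagonal_mult_vector D_def mult.assoc[symmetric] cis_mult)
  have "(\<lambda>x. diagonal (D t) *v x) ` cone U = cone U" for t
  proof
    show "cone U \<subseteq> (\<lambda>x. diagonal (D t) *v x) ` cone U"
    proof
      fix x assume "x \<in> cone U"
      then have "diagonal (D (- t)) *v x \<in> cone U" using sub by blast
      then show "x \<in> (\<lambda>x. diagonal (D t) *v x) ` cone U" using inv by (metis imageI)
    qed
  qed (rule sub)
  moreover have "diagonal (D t) \<in> SU3" for t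
  proof (rule diagonal_SU3)
    show "norm (D t $ i) = 1" for i
      using exhaust_3[of i] by (auto simp: D_def)
    show "D t $ 1 * D t $ 2 * D t $ 3 = 1" by (simp add: D_def cis_mult)
  qed
  ultimately have "X \<in> lie_algebra (cone_symmetries U)"
    by (simp add: lie_algebra_def cone_symmetries_def exp)
  moreover have "X \<noteq> 0" 
  proof
    assume "X = 0"
    then have "X $ 1 $ 1 = 0" by simp
    then show False by (simp add: X_def diagonal_def)
  qed
  \<comment> \<open>\<open>dim\<close> is the dimension of the span, so one nonzero element makes it
    positive.\<close>
  ultimately have "\<not> lie_algebra (cone_symmetries U) \<subseteq> {0}" by blast
  then show ?thesis unfolding group_dim_def using dim_eq_0 by (metis less_one not_le)
qed

section \<open>Eigenvalues below 2 and 6\<close>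

text \<open>\<open>E\<close> and \<open>D\<close> may overlap. A common value still counts twice: a
  function that does not vanish at 0 and a nonzero one that does are independent.\<close>

lemma sum_multiplicity_ge:
  assumes "finite E" "finite D"
    and E: "\<And>l. l \<in> E \<Longrightarrow> \<exists>f. f \<in> eigenspace U l \<and> f 0 \<noteq> 0"
    and D: "\<And>l. l \<in> D \<Longrightarrow> \<exists>f. f \<in> eigenspace U l \<and> f 0 = 0 \<and> (\<exists>p. f p \<noteq> 0)"
  shows "enat (card E + card D) \<le> (\<Sum>l\<in>E \<union> D. multiplicity U l)"
proof -
  have one: "1 \<le> multiplicity U l" if "f \<in> eigenspace U l" "f p \<noteq> 0" for l f p
  proof -
    have "enat 1 \<le> multiplicity U l"
    proof (rule multiplicity_ge[where f = "\<lambda>_. f"])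
      fix c :: "nat \<Rightarrow> real" and i :: nat
      assume s: "\<And>p. (\<Sum>i<1. c i * f p) = 0" and "i < 1"
      then show "c i = 0" using s[of p] that(2) by simp
    qed (use that in auto)
    then show ?thesis by (simp add: one_enat_def)
  qed
  have two: "2 \<le> multiplicity U l"
    if "f \<in> eigenspace U l" "f 0 \<noteq> 0" "g \<in> eigenspace U l" "g 0 = 0" "g p \<noteq> 0" for l f g p
  proof -
    have "enat 2 \<le> multiplicity U l"
    proof (rule multiplicity_ge[where f = "\<lambda>i. if i = 0 then f else g"])
      fix c :: "nat \<Rightarrow> real" and i :: nat
      assume s: "\<And>p. (\<Sum>i<2. c i * (if i = 0 then f else g) p) = 0" and i: "i < 2"
      have s': "c 0 * f p + c 1 * g p = 0" for p using s[of p] by (simp add: numeral_2_eq_2)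
      have "c 0 = 0" using s'[of 0] that by simp
      moreover have "c 1 = 0" using s'[of p] that \<open>c 0 = 0\<close> by simp
      moreover have "i = 0 \<or> i = 1" using i by auto
      ultimately show "c i = 0" by auto
    qed (use that in auto)
    then show ?thesis by (simp add: numeral_eq_enat)
  qed
  have pt: "of_bool (l \<in> E) + of_bool (l \<in> D) \<le> multiplicity U l" if "l \<in> E \<union> D" for l
  proof (cases "l \<in> E"; cases "l \<in> D")
    assume "l \<in> E" "l \<in> D"
    then show ?thesis using E D two by (fastforce simp: one_add_one)
  next
    assume "l \<in> E" "l \<notin> D"
    then show ?thesis using E one by fastforce
  next
    assume "l \<notin> E" "l \<in> D"
    then show ?thesis using D one by fastforce
  qed (use that in auto)
  have "(\<Sum>l\<in>E \<union> D. of_bool (l \<in> E) + of_bool (l \<in> D) :: nat) = card E + card D"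
  proof -
    have "(\<Sum>l\<in>E \<union> D. of_bool (l \<in> E) :: nat) = card E" "(\<Sum>l\<in>E \<union> D. of_bool (l \<in> D) :: nat) = card D"
      using assms(1,2) by (simp_all add: sum_of_bool_eq Int_absorb1 Collect_mem_eq Int_absorb2)
    then show ?thesis by (simp add: sum.distrib)
  qed
  moreover have "(\<Sum>l\<in>E \<union> D. of_bool (l \<in> E) + of_bool (l \<in> D) :: enat)
      = enat (\<Sum>l\<in>E \<union> D. of_bool (l \<in> E) + of_bool (l \<in> D))"
    unfolding of_nat_eq_enat[symmetric] of_nat_sum by (intro sum.cong) (auto simp: of_bool_def)
  ultimately have "enat (card E + card D) = (\<Sum>l\<in>E \<union> D. of_bool (l \<in> E) + of_bool (l \<in> D) :: enat)"
    by simp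
  also have "\<dots> \<le> (\<Sum>l\<in>E \<union> D. multiplicity U l)" by (rule sum_mono) (rule pt)
  finally show ?thesis .
qed

text \<open>Periods that span the plane cannot all be parallel to the s-axis, and one with
  t-component \<open>k * T\<close>, k nonzero, turns z2 by a multiple of 2 \<pi>.\<close>

lemma doubly_periodic_rotation:
  assumes "doubly_periodic U"
  obtains m n :: int where "coprime m n" "n > 0" "\<theta>2 T / (2 * pi) = of_int m / of_int n"
proof -
  have "\<exists>v\<in>period_lattice U. v $ 2 \<noteq> 0"
  proof (rule ccontr)
    assume "\<not> ?thesis"
    then have "period_lattice U \<subseteq> {v. v $ 2 = 0}" by auto
    moreover have "subspace {v::real^2. v $ 2 = 0}" by (auto simp: subspace_def)
    ultimately have "span (period_lattice U) \<subseteq> {v. v $ 2 = 0}" by (rule span_minimal)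
    moreover have "(axis 2 1 :: real^2) \<in> span (period_lattice U)" using assms by (simp add: doubly_periodic_def)
    ultimately have "axis 2 1 \<in> {v::real^2. v $ 2 = 0}" by blast
    then show False by (simp add: axis_def)
  qed
  then obtain v where v: "v \<in> period_lattice U" "v $ 2 \<noteq> 0" by blast
  obtain k j :: int where k: "v $ 2 = of_int k * T" "of_int k * \<theta>2 T = of_int j * (2 * pi)"
    using period_lattice_second[OF v(1)] by metis
  have "k \<noteq> 0" using k v by auto
  then have "\<theta>2 T / (2 * pi) = of_int j / of_int k" using k(2) by (simp add: field_simps)
  then have "\<theta>2 T / (2 * pi) \<in> \<rat>" by simp
  then show ?thesis using that by (metis Rats_cases')
qed

text \<open>1/2 and 3/5 are Farey neighbours. With the positive integers a = 2 m - n and b = 3 n - 5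
  m one has m = 3 a + b and n = 5 a + 2 b, so 4/7 is the smallest case.\<close>

lemma rotation_bounds:
  fixes m n :: int
  assumes "n > 0" "\<theta>2 T / (2 * pi) = of_int m / of_int n"
  shows "m \<ge> 4" "n \<ge> 7"
proof -
  have "1 / 2 < \<theta>2 T / (2 * pi)" "\<theta>2 T / (2 * pi) < 3 / 5"
    using \<theta>2_T_lower \<theta>2_T_upper pi_gt_zero by (simp_all add: field_simps)
  then have "1 / 2 < real_of_int m / of_int n" "real_of_int m / of_int n < 3 / 5" unfolding assms(2) .
  then have "real_of_int n < 2 * of_int m" "5 * real_of_int m < 3 * of_int n"
    using assms(1) by (simp_all add: field_simps)
  then have "n < 2 * m" "5 * m < 3 * n" by linarith+
  then show "m \<ge> 4" "n \<ge> 7" by linarith+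
qed

text \<open>A period with t-component \<open>k * T\<close> satisfies k m = j n, and coprimality
  gives n dvd k. So functions of t with period \<open>n * T\<close> descend to the torus.\<close>

lemma lattice_periodic:
  fixes m n :: int
  assumes "coprime m n" "n > 0" "\<theta>2 T / (2 * pi) = of_int m / of_int n"
    and f: "\<And>t. f (t + of_int n * T) = f t" and v: "v \<in> period_lattice U"
  shows "f (t + v $ 2) = f t"
proof -
  obtain k j :: int where k: "v $ 2 = of_int k * T" "of_int k * \<theta>2 T = of_int j * (2 * pi)"
    using period_lattice_second[OF v] by metis
  have "of_int k * real_of_int m = of_int j * of_int n"
  proof -
    have "of_int k * (\<theta>2 T / (2 * pi)) = of_int j" using k(2) by simp
    then show ?thesis unfolding assms(3) using assms(2) by (simp add: field_simps)
  qed
  then have "k * m = j * n" by (metis of_int_mult of_int_eq_iff)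
  then have "n dvd k * m" by simp
  then have "n dvd k" using assms(1) by (simp add: coprime_dvd_mult_left_iff coprime_commute)
  then obtain i where "k = n * i" by blast
  then have "v $ 2 = of_int i * (of_int n * T)" using k by simp
  then show ?thesis
  proof -
    have "f (t + of_int i * (of_int n * T)) = f t"
    proof (induction i arbitrary: t rule: int_induct[where k = 0])
      case (step1 i)
      then show ?case using f[of "t + of_int i * (of_int n * T)"] by (simp add: algebra_simps)
    next
      case (step2 i)
      then show ?case using f[of "t + of_int (i - 1) * (of_int n * T)"] by (simp add: algebra_simps)
    qed simp
    then show ?thesis using \<open>v $ 2 = of_int i * (of_int n * T)\<close> by simp
  qed
qed

text \<open>An angle gaining N \<pi> over half of the period \<open>n * T\<close> yields N even and
  N - 1 odd solutions. Removing \<open>l = 0\<close> costs exactly one of them, because only the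
  even problem lists it; this version serves the open interval of \<open>l_ind\<close>.\<close>

lemma eigenfunctions_below:
  fixes m n :: int and N :: nat
  assumes mn: "coprime m n" "n > 0" "\<theta>2 T / (2 * pi) = of_int m / of_int n"
    and "l0 > 0" "N > 0"
    and g: "\<And>t. (g has_real_derivative g' t) (at t)" "\<And>t. (g' has_real_derivative - l0 * \<rho> t * g t) (at t)"
    and g0: "g 0 > 0" "g' 0 = 0" "g' (of_int n * T / 2) = 0"
    and \<zeta>: "continuous_on UNIV \<zeta>" "\<zeta> 0 = 0" "\<zeta> (of_int n * T / 2) = real N * pi"
    and not_opp: "\<And>t r. r > 0 \<Longrightarrow> g' t = r * sin (\<zeta> t) \<Longrightarrow> g t = - r * cos (\<zeta> t) \<Longrightarrow> False"
  obtains Q where "finite Q" "Q \<subseteq> {0..<l0}" "enat (2 * N - 1) \<le> (\<Sum>l\<in>Q. multiplicity U l)"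
    "enat (2 * N - 2) \<le> (\<Sum>l\<in>Q - {0}. multiplicity U l)"
proof -
  have h: "of_int n * T / 2 > 0" using mn(2) T_pos by simp
  have per: "\<rho> (t + 2 * (of_int n * T / 2)) = \<rho> t" for t using \<rho>_props(4)[of t n] by simp
  have ev: "(\<lambda>p. cos (0 * p $ 1 + 0) * f (p $ 2)) \<in> eigenspace U l"
    if "periodic_solution \<rho> (2 * (of_int n * T / 2)) l f" for l f
  proof (rule separated_eigenfunction)
    show "hill_solution \<rho> l 0 f" using that by (simp add: periodic_solution_def)
    fix v p assume v: "v \<in> period_lattice U"
    have "f (t + of_int n * T) = f t" for t using that by (simp add: periodic_solution_def)
    from lattice_periodic[where f = f and t = "p $ 2", OF mn this v]
    show "cos (0 * (p + v) $ 1 + 0) * f ((p + v) $ 2) = cos (0 * p $ 1 + 0) * f (p $ 2)" by simp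
  qed
  obtain E D where E: "finite E" "card E = N" "E \<subseteq> {0..<l0}" "0 \<in> E"
      "\<And>l. l \<in> E \<Longrightarrow> \<exists>f. periodic_solution \<rho> (2 * (of_int n * T / 2)) l f \<and> f 0 \<noteq> 0"
    and D: "finite D" "card D = N - 1" "D \<subseteq> {0<..<l0}"
      "\<And>l. l \<in> D \<Longrightarrow> \<exists>f. periodic_solution \<rho> (2 * (of_int n * T / 2)) l f \<and> f 0 = 0 \<and> (\<exists>t. f t \<noteq> 0)"
    by (rule hill_even_count[OF \<rho>_props(1,2,3) per h \<open>l0 > 0\<close> \<open>N > 0\<close> g g0 \<zeta>]; (rule not_opp | rule that); assumption)
  have E': "\<exists>f. f \<in> eigenspace U l \<and> f 0 \<noteq> 0" if l: "l \<in> E" for l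
  proof -
    obtain f where f: "periodic_solution \<rho> (2 * (of_int n * T / 2)) l f" "f 0 \<noteq> 0" using E(5)[OF l] by blast
    from ev[OF f(1)] f(2) show ?thesis by (intro exI[of _ "\<lambda>p. cos (0 * p $ 1 + 0) * f (p $ 2)"]) simp
  qed
  have D': "\<exists>f. f \<in> eigenspace U l \<and> f 0 = 0 \<and> (\<exists>p. f p \<noteq> 0)" if l: "l \<in> D" for l
  proof -
    obtain f t where f: "periodic_solution \<rho> (2 * (of_int n * T / 2)) l f" "f 0 = 0" "f t \<noteq> 0" using D(4)[OF l] by blast
    from ev[OF f(1)] f(2,3) show ?thesis
      by (intro exI[of _ "\<lambda>p. cos (0 * p $ 1 + 0) * f (p $ 2)"] conjI exI[of _ "vector [0, t]"]) simp_all
  qed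
  show ?thesis
  proof (rule that[of "E \<union> D"])
    show "finite (E \<union> D)" using E D by simp
    show "E \<union> D \<subseteq> {0..<l0}" using E D by auto
    have "card E + card D = 2 * N - 1" using E D \<open>N > 0\<close> by simp
    then show "enat (2 * N - 1) \<le> (\<Sum>l\<in>E \<union> D. multiplicity U l)"
      using sum_multiplicity_ge[OF E(1) D(1) E' D'] by simp
    have "0 \<notin> D" using D(3) by auto
    then have "E \<union> D - {0} = (E - {0}) \<union> D" by auto
    moreover have "card (E - {0}) + card D = 2 * N - 2" using E D \<open>N > 0\<close> by simp
    moreover have "enat (card (E - {0}) + card D) \<le> (\<Sum>l\<in>(E - {0}) \<union> D. multiplicity U l)"
      by (rule sum_multiplicity_ge) (use E D E' D' in auto)
    ultimately show "enat (2 * N - 2) \<le> (\<Sum>l\<in>E \<union> D - {0}. multiplicity U l)" by simp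
  qed
qed

lemma w'_half: "w' (of_int k * T / 2) = 0"
  unfolding w'_sin \<phi>_half by (simp add: mult.commute)

text \<open>The comparison angle \<phi> gains n \<pi> over \<open>n * T / 2\<close>. Where sin
  \<phi> is nonzero, g' has the opposite sign to it; where sin \<phi> = 0, w is at a root and
  -\<gamma> has the sign of cos \<phi>, by \<open>root_bounds\<close>. Either way the forbidden
  position is excluded.\<close>

lemma spectrum_below_6:
  fixes m n :: int
  assumes mn: "coprime m n" "n > 0" "\<theta>2 T / (2 * pi) = of_int m / of_int n"
  obtains Q where "finite Q" "Q \<subseteq> {0..<6}" "enat (2 * nat n - 1) \<le> (\<Sum>l\<in>Q. multiplicity U l)"
    "enat (2 * nat n - 2) \<le> (\<Sum>l\<in>Q - {0}. multiplicity U l)"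
proof (rule eigenfunctions_below[OF mn, where N = "nat n" and ?l0.0 = 6 and g = "\<lambda>t. - \<gamma> t" and g' = "\<lambda>t. - (w' t / 2)" and \<zeta> = \<phi>])
  show "0 < nat n" using mn(2) by simp
  have \<gamma>': "deriv \<gamma> t = w' t / 2" for t by (simp add: w'_def)
  show "((\<lambda>t. - \<gamma> t) has_real_derivative - (w' t / 2)) (at t)" for t
    using DERIV_minus[OF DERIV_\<gamma>] by (simp add: \<gamma>')
  show "((\<lambda>t. - (w' t / 2)) has_real_derivative - 6 * \<rho> t * - \<gamma> t) (at t)" for t
    using DERIV_minus[OF DERIV_cdivide[OF DERIV_w'[of t], of 2]]
    by (rule DERIV_cong) (simp add: \<rho>_def \<gamma>_eq field_simps)
  show "0 < - \<gamma> 0" using root_bounds(1) w_0 by (simp add: \<gamma>_eq)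
  show "- (w' 0 / 2) = 0" using w'_0 by simp
  show "- (w' (of_int n * T / 2) / 2) = 0" by (simp add: w'_half)
  show "continuous_on UNIV \<phi>" by (rule continuous_on_UNIV_if_DERIV[OF DERIV_\<phi>])
  show "\<phi> (of_int n * T / 2) = real (nat n) * pi" using \<phi>_half[of n] mn(2) by simp
  show False if r: "r > 0" and 1: "- (w' t / 2) = r * sin (\<phi> t)" and 2: "- \<gamma> t = - r * cos (\<phi> t)" for t r
  proof (cases "sin (\<phi> t) = 0")
    case False
    have "- (A * speed t / 2) * sin (\<phi> t) = r * sin (\<phi> t)" using 1 by (simp add: w'_sin)
    then have "- (A * speed t / 2) = r" using False by (metis mult_cancel_right)
    moreover have "A * speed t > 0" using A_pos speed_pos[of t] by simp
    ultimately show False using r by simp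
  next
    case True
    then have "cos (\<phi> t) = 1 \<or> cos (\<phi> t) = - 1"
      using sin_cos_squared_add[of "\<phi> t"] by (simp add: power2_eq_1_iff)
    then show False using 2 r root_bounds by (auto simp: \<gamma>_eq w_cos)
  qed
qed (use that in auto)

text \<open>Here g is the real part of z2 and the comparison angle is its phase, which gains m \<pi>
  over \<open>n * T / 2\<close>. Thus g is a positive multiple of cos \<open>\<theta>2\<close>, and
  where this vanishes g' is a negative multiple of sin \<open>\<theta>2\<close>, by positivity of
  J.\<close>

lemma spectrum_below_2:
  fixes m n :: int
  assumes mn: "coprime m n" "n > 0" "\<theta>2 T / (2 * pi) = of_int m / of_int n"
  obtains Q where "finite Q" "Q \<subseteq> {0..<2}" "enat (2 * nat m - 1) \<le> (\<Sum>l\<in>Q. multiplicity U l)"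
proof -
  define g' where "g' = (\<lambda>t. w' t / (2 * w t) * (sqrt (w t) * cos (\<theta>2 t)) - 2 * J / w t * (sqrt (w t) * sin (\<theta>2 t)))"
  have m: "m > 0" using rotation_bounds[OF mn(2,3)] by simp
  have "\<theta>2 (of_int n * T / 2) = of_int n * \<theta>2 T / 2" by (rule \<theta>2_half)
  also have "\<dots> = of_int m * pi" using mn(2,3) pi_gt_zero by (simp add: field_simps)
  finally have h: "\<theta>2 (of_int n * T / 2) = of_int m * pi" .
  show ?thesis
  proof (rule eigenfunctions_below[OF mn, where N = "nat m" and ?l0.0 = 2 and g = "\<lambda>t. sqrt (w t) * cos (\<theta>2 t)" and g' = g' and \<zeta> = \<theta>2])
    show "0 < nat m" using m by simp
    show "((\<lambda>t. sqrt (w t) * cos (\<theta>2 t)) has_real_derivative g' t) (at t)" for t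
      unfolding g'_def by (rule polar2)
    show "(g' has_real_derivative - 2 * \<rho> t * (sqrt (w t) * cos (\<theta>2 t))) (at t)" for t
      unfolding g'_def by (rule polar2)
    show "0 < sqrt (w 0) * cos (\<theta>2 0)" using w_pos[of 0] by (simp add: \<theta>_0)
    show "g' 0 = 0" by (simp add: g'_def w'_0 \<theta>_0)
    show "g' (of_int n * T / 2) = 0" unfolding g'_def h w'_half by (simp add: sin_zero_iff_int2)
    show "continuous_on UNIV \<theta>2" by (rule continuous_on_UNIV_if_DERIV[OF DERIV_\<theta>2])
    show "\<theta>2 (of_int n * T / 2) = real (nat m) * pi" using h m by simp
    show False if r: "r > 0" and 1: "g' t = r * sin (\<theta>2 t)" and 2: "sqrt (w t) * cos (\<theta>2 t) = - r * cos (\<theta>2 t)" for t r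
    proof (cases "cos (\<theta>2 t) = 0")
      case False
      then have "sqrt (w t) = - r" using 2 by (metis mult_cancel_right)
      moreover have "0 < sqrt (w t)" using w_pos by simp
      ultimately show False using r by simp
    next
      case True
      then have s: "sin (\<theta>2 t) \<noteq> 0" using sin_cos_squared_add[of "\<theta>2 t"] by auto
      have "- (2 * J / w t * sqrt (w t)) * sin (\<theta>2 t) = r * sin (\<theta>2 t)" using 1 True by (simp add: g'_def)
      then have "- (2 * J / w t * sqrt (w t)) = r" using s by (metis mult_cancel_right)
      moreover have "2 * J / w t * sqrt (w t) > 0" using J_pos w_pos[of t] by simp
      ultimately show False using r by simp
    qed
  qed (use that \<theta>_0 in auto)
qed

lemma eigenvalue_count_insert:
  assumes "finite Q" "Q \<subseteq> {0..<b}" "enat K \<le> (\<Sum>l\<in>Q. multiplicity U l)" "enat L \<le> multiplicity U b" "0 \<le> b"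
  shows "enat (K + L) \<le> eigenvalue_count U {0..b}"
proof -
  have "b \<notin> Q" using assms(2) by auto
  then have "(\<Sum>l\<in>insert b Q. multiplicity U l) = multiplicity U b + (\<Sum>l\<in>Q. multiplicity U l)"
    using assms(1) by simp
  moreover have "(\<Sum>l\<in>insert b Q. multiplicity U l) \<le> eigenvalue_count U {0..b}"
    by (rule sum_le_eigenvalue_count) (use assms in auto)
  moreover have "enat L + enat K \<le> multiplicity U b + (\<Sum>l\<in>Q. multiplicity U l)"
    using assms by (intro add_mono)
  ultimately show ?thesis by (simp add: add.commute)
qed

section \<open>Assembling the index bounds\<close>

lemma index_bounds:
  assumes "doubly_periodic U"
  shows "\<exists>m n :: int. coprime m n \<and> m \<ge> 4 \<and> n \<ge> 7
     \<and> \<theta>2 T / (2 * pi) = real_of_int m / real_of_int n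
     \<and> s_ind U \<ge> ereal (real_of_int (2 * n - 8))
     \<and> ereal_of_enat (l_ind U) \<ge> ereal (real_of_int (2 * n - 2))
     \<and> ereal_of_enat (N_Sigma U 1) \<ge> ereal (real_of_int (2 * m + 5))
     \<and> ereal_of_enat (N_Sigma U 2) \<ge> ereal (real_of_int (2 * n + 6))"
proof -
  obtain m n :: int where mn: "coprime m n" "n > 0" "\<theta>2 T / (2 * pi) = of_int m / of_int n"
    using doubly_periodic_rotation[OF assms] by metis
  note b = rotation_bounds[OF mn(2,3)]
  have conv: "ereal (real_of_int i) \<le> ereal_of_enat x" if "enat (nat i) \<le> x" "0 \<le> i" for i x
  proof -
    have "ereal_of_enat (enat (nat i)) \<le> ereal_of_enat x" using that by (simp only: ereal_of_enat_le_iff)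
    then show ?thesis using that by simp
  qed
  obtain Q where Q: "finite Q" "Q \<subseteq> {0..<6}" "enat (2 * nat n - 1) \<le> (\<Sum>l\<in>Q. multiplicity U l)"
    "enat (2 * nat n - 2) \<le> (\<Sum>l\<in>Q - {0}. multiplicity U l)"
    using spectrum_below_6[OF mn] by metis
  \<comment> \<open>The closed interval includes 6 itself with its seven dimensions;
    \<open>l_ind\<close> below gains nothing from them and also omits 0.\<close>
  have "enat (2 * nat n - 1 + 7) \<le> eigenvalue_count U {0..6}"
    using eigenvalue_count_insert[OF Q(1,2,3), of 7] multiplicity_6 by (simp add: numeral_eq_enat)
  moreover have "2 * nat n - 1 + 7 = nat (2 * n + 6)" using b by simp
  ultimately have N2: "ereal (real_of_int (2 * n + 6)) \<le> ereal_of_enat (N_Sigma U 2)"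
    using b by (intro conv) (auto simp: N_Sigma_def)
  have "(\<Sum>l\<in>Q - {0}. multiplicity U l) \<le> l_ind U"
    unfolding l_ind_def by (rule sum_le_eigenvalue_count) (use Q in \<open>auto simp: less_le\<close>)
  then have "enat (2 * nat n - 2) \<le> l_ind U" using Q(4) by (rule order_trans[rotated])
  moreover have "2 * nat n - 2 = nat (2 * n - 2)" using b by simp
  ultimately have l: "ereal (real_of_int (2 * n - 2)) \<le> ereal_of_enat (l_ind U)"
    using b by (intro conv) auto
  obtain Q' where Q': "finite Q'" "Q' \<subseteq> {0..<2}" "enat (2 * nat m - 1) \<le> (\<Sum>l\<in>Q'. multiplicity U l)"
    using spectrum_below_2[OF mn] by metis
  have "enat (2 * nat m - 1 + 6) \<le> eigenvalue_count U {0..2}"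
    using eigenvalue_count_insert[OF Q', of 6] multiplicity_2 by (simp add: numeral_eq_enat)
  moreover have "2 * nat m - 1 + 6 = nat (2 * m + 5)" using b by simp
  ultimately have N1: "ereal (real_of_int (2 * m + 5)) \<le> ereal_of_enat (N_Sigma U 1)"
    using b by (intro conv) (auto simp: N_Sigma_def)
  \<comment> \<open>(2 n + 6) - 1 - 6 - (8 - 1) = 2 n - 8. The case distinction covers a count that
    is infinite in \<open>ereal\<close>.\<close>
  have s: "ereal (real_of_int (2 * n - 8)) \<le> s_ind U"
    using N2 group_dim_pos
    by (cases "ereal_of_enat (N_Sigma U 2)") (auto simp: s_ind_def one_ereal_def numeral_eq_ereal)
  show ?thesis using mn b N1 N2 l s by (intro exI[of _ m] exI[of _ n]) simp
qed

end

theorem theoremF: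
  fixes J T :: real and \<gamma> \<theta>1 \<theta>2 :: "real \<Rightarrow> real" and u :: "real^2 \<Rightarrow> complex^3"
  assumes "0 < J" and "J < 1 / (3 * sqrt 3)"
    and "profile J \<gamma>" and "basic_period \<gamma> T" and "phases J \<gamma> \<theta>1 \<theta>2"
    and "u = u0 \<gamma> \<theta>1 \<theta>2" and "doubly_periodic u"
  shows "\<exists>m n :: int. coprime m n \<and> m \<ge> 4 \<and> n \<ge> 7
     \<and> \<theta>2 T / (2 * pi) = real_of_int m / real_of_int n
     \<and> s_ind u \<ge> ereal (real_of_int (2 * n - 8)) \<and> 2 * n - 8 \<ge> 6
     \<and> ereal_of_enat (l_ind u) \<ge> ereal (real_of_int (2 * n - 2)) \<and> 2 * n - 2 \<ge> 12
     \<and> ereal_of_enat (N_Sigma u 1) \<ge> ereal (real_of_int (2 * m + 5)) \<and> 2 * m + 5 \<ge> 13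
     \<and> ereal_of_enat (N_Sigma u 2) \<ge> ereal (real_of_int (2 * n + 6)) \<and> 2 * n + 6 \<ge> 20"
proof -
  interpret legendrian_profile J T \<gamma> \<theta>1 \<theta>2
    using assms by unfold_locales
  have u: "u = U" using assms(6) by (simp add: U_def)
  obtain m n :: int where "coprime m n" "m \<ge> 4" "n \<ge> 7" "\<theta>2 T / (2 * pi) = real_of_int m / real_of_int n"
    "s_ind u \<ge> ereal (real_of_int (2 * n - 8))"
    "ereal_of_enat (l_ind u) \<ge> ereal (real_of_int (2 * n - 2))"
    "ereal_of_enat (N_Sigma u 1) \<ge> ereal (real_of_int (2 * m + 5))"
    "ereal_of_enat (N_Sigma u 2) \<ge> ereal (real_of_int (2 * n + 6))"
    using index_bounds assms(7) unfolding u by metis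
  then show ?thesis by (intro exI[of _ m] exI[of _ n] conjI) (assumption | linarith)+
qed

end
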